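(* Consider the primal-dual pair $(P)$, $(D)$ and the primal-dual interior-point iteration described in the context, started from a feasible central point $(x^{(0)},y^{(0)},s^{(0)})$, i.e. $x^{(0)}\in\operatorname{int}(K)$, $s^{(0)}\in\operatorname{int}(K^* )$, $Ax^{(0)}=b$, $A^\top y^{(0)}+s^{(0)}=c$ and $\delta_D^0=0$. Alternate predictor steps ($\gamma_k=0$, $\alpha_k=0.047464/\sqrt{\vartheta}$) and corrector steps ($\gamma_k=1$, $\alpha_k=1$), beginning with a predictor step. Then this gives an algorithm that takes at most $42\sqrt{\vartheta}$ iterations to reduce $\mu$ by a factor of two (that is, for every $k$ there is $j\le42\sqrt\vartheta$ with $\mu_{k+j}\le\mu_k/2$). In particular, its iteration complexity is $O(\sqrt{\vartheta}\ln(1/\epsilon))$: there is an absolute constant $C$ such that for every $\epsilon\in(0,1/2]$ there is $k\le C\sqrt\vartheta\ln(1/\epsilon)$ with $\mu_k\le\epsilon\mu_0$.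
   Context: $\mathbb{E}$ is a finite-dimensional real vector space of dimension $n$ with dual $\mathbb{E}^*$ and pairing $\langle\cdot,\cdot\rangle$; bases are chosen, so linear maps are matrices. $K\subset\mathbb{E}$ is a pointed closed convex cone with nonempty interior, $K^*:=\{s\in\mathbb{E}^*:\langle s,x\rangle\ge0\ \forall x\in K\}$. $(P)$: $\inf\{\langle c,x\rangle: Ax=b,\ x\in K\}$ and $(D)$: $\sup\{\langle b,y\rangle: A^\top y+s=c,\ s\in K^*\}$, with $A$ surjective. A $\vartheta$-LHSCB for $K$ ($\vartheta\ge1$) is a $\mathcal{C}^3$ convex function $F:\operatorname{int}(K)\to\mathbb{R}$ such that $F\to+\infty$ along every sequence in $\operatorname{int}(K)$ converging to a boundary point of $K$, $F(tx)=F(x)-\vartheta\ln t$ for all $t>0$, and $|D^3F(x)[h,h,h]|\le2(D^2F(x)[h,h])^{3/2}$ for all $x\in\operatorname{int}(K)$, $h\in\mathbb{E}$. Fix such an $F$; $F_*(s):=\sup\{-\langle s,x\rangle-F(x):x\in\operatorname{int}(K)\}$ is its conjugate barrier. For $(x,s)\in\operatorname{int}(K)\oplus\operatorname{int}(K^* )$: $\mu:=\langle s,x\rangle/\vartheta$, $\tilde x:=-F_*'(s)$, $\tilde s:=-F'(x)$, $\delta_P:=x-\mu\tilde x$, $\delta_D:=s-\mu\tilde s$, $\check s:=(s+\mu\tilde s)/2$, $H:=\mu F_*''(\check s)$, $$H_1:=H+\frac{xx^\top}{\langle s,x\rangle}-\frac{Hss^\top H}{\langle s,Hs\rangle},\qquad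 T^2:=H_1+\frac{\delta_P\delta_P^\top}{\langle\delta_D,\delta_P\rangle}-\frac{H_1\delta_D\delta_D^\top H_1}{\langle\delta_D,H_1\delta_D\rangle},$$ with the convention that $T^2:=H_1$ if $\delta_D=0$ (equivalently $\delta_P=0$). $T^2$ is a map $\mathbb{E}^*\to\mathbb{E}$. Iteration: given $(x,y,s)=(x^{(k)},y^{(k)},s^{(k)})$ with its associated $\mu=\mu_k:=\langle s^{(k)},x^{(k)}\rangle/\vartheta$, $\delta_D^k:=s^{(k)}+\mu_kF'(x^{(k)})$ and $T^2$, and parameters $\gamma_k\in[0,1]$, $\alpha_k\ge0$, let $(d_x,d_y,d_s)$ solve $A^\top d_y+d_s=0$, $Ad_x=0$, $d_x+T^2d_s=-x-\gamma_k\mu F_*'(s)$, and set $(x^{(k+1)},y^{(k+1)},s^{(k+1)}):=(x,y,s)+\alpha_k(d_x,d_y,d_s)$. *)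

theory Defs
  imports "HOL-Analysis.Analysis"
begin

text \<open>
  With bases chosen, a space of dimension n and its dual are both \<open>real^'n\<close>, the pairing
  of \<open>s\<close> and \<open>x\<close> being the standard inner product \<open>s \<bullet> x\<close>. Barriers are total functions on
  \<open>real^'n\<close>, but only their values on the (open) interior of the cone are constrained.
\<close>

definition proper_cone :: "'a::euclidean_space set \<Rightarrow> bool" where
  "proper_cone K \<longleftrightarrow> closed K \<and> convex K \<and> cone K \<and>
     (\<forall>x. x \<in> K \<and> - x \<in> K \<longrightarrow> x = 0) \<and> interior K \<noteq> {}"

definition dual_cone :: "'a::real_inner set \<Rightarrow> 'a set" where
  "dual_cone K = {s. \<forall>x\<in>K. 0 \<le> s \<bullet> x}"

text \<open>Class \<open>C\<^sup>k\<close> on an open set: all iterated directional derivatives up to order \<open>k\<close> exist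
  as (Frechet) derivatives and are continuous.\<close>

primrec Ck_on :: "nat \<Rightarrow> ('a::real_normed_vector \<Rightarrow> real) \<Rightarrow> 'a set \<Rightarrow> bool" where
  "Ck_on 0 f S \<longleftrightarrow> continuous_on S f"
| "Ck_on (Suc k) f S \<longleftrightarrow> (\<forall>x\<in>S. f differentiable (at x)) \<and>
     (\<forall>v. Ck_on k (\<lambda>x. frechet_derivative f (at x) v) S)"

text \<open>\<open>Dk k f x h\<close> is the \<open>k\<close>-th derivative of \<open>f\<close> at \<open>x\<close>, evaluated at \<open>(h, \<dots>, h)\<close>.\<close>

primrec Dk :: "nat \<Rightarrow> ('a::real_normed_vector \<Rightarrow> real) \<Rightarrow> 'a \<Rightarrow> 'a \<Rightarrow> real" where
  "Dk 0 f x h = f x"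
| "Dk (Suc k) f x h = frechet_derivative (\<lambda>z. Dk k f z h) (at x) h"

definition LHSCB :: "real \<Rightarrow> 'a::euclidean_space set \<Rightarrow> ('a \<Rightarrow> real) \<Rightarrow> bool" where
  "LHSCB \<theta> K F \<longleftrightarrow> \<theta> \<ge> 1 \<and> Ck_on 3 F (interior K) \<and> convex_on (interior K) F \<and>
     (\<forall>X z. (\<forall>i. X i \<in> interior K) \<and> z \<in> frontier K \<and> X \<longlonglongrightarrow> z
        \<longrightarrow> filterlim (\<lambda>i. F (X i)) at_top sequentially) \<and>
     (\<forall>x\<in>interior K. \<forall>t>0. F (t *\<^sub>R x) = F x - \<theta> * ln t) \<and>
     (\<forall>x\<in>interior K. \<forall>h. \<bar>Dk 3 F x h\<bar> \<le> 2 * (Dk 2 F x h) powr (3/2))"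

text \<open>The supremum below is finite for \<open>s\<close> in the interior of the dual cone, the only place
  where the conjugate barrier (and its derivatives) are used.\<close>

definition conj_barrier :: "'a::euclidean_space set \<Rightarrow> ('a \<Rightarrow> real) \<Rightarrow> 'a \<Rightarrow> real" where
  "conj_barrier K F s = (SUP x\<in>interior K. - (s \<bullet> x) - F x)"

definition grad :: "('a::real_inner \<Rightarrow> real) \<Rightarrow> 'a \<Rightarrow> 'a" where
  "grad f x = (THE g. GDERIV f x :> g)"

definition hessian :: "(real^'n \<Rightarrow> real) \<Rightarrow> real^'n \<Rightarrow> real^'n^'n" where
  "hessian f x = jacobian (grad f) (at x)"

text \<open>\<open>outer u v\<close> is the rank-one matrix \<open>u v\<^sup>T\<close>.\<close>

definition outer :: "real^'n \<Rightarrow> real^'n \<Rightarrow> real^'n^'n" where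
  "outer u v = (\<chi> i j. u $ i * v $ j)"

definition mu :: "real \<Rightarrow> 'a::real_inner \<Rightarrow> 'a \<Rightarrow> real" where
  "mu \<theta> x s = (s \<bullet> x) / \<theta>"

definition x_tilde :: "(real^'n) set \<Rightarrow> (real^'n \<Rightarrow> real) \<Rightarrow> real^'n \<Rightarrow> real^'n" where
  "x_tilde K F s = - grad (conj_barrier K F) s"

definition s_tilde :: "(real^'n \<Rightarrow> real) \<Rightarrow> real^'n \<Rightarrow> real^'n" where
  "s_tilde F x = - grad F x"

definition delta_P ::
    "(real^'n) set \<Rightarrow> (real^'n \<Rightarrow> real) \<Rightarrow> real \<Rightarrow> real^'n \<Rightarrow> real^'n \<Rightarrow> real^'n" where
  "delta_P K F \<theta> x s = x - mu \<theta> x s *\<^sub>R x_tilde K F s"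

definition delta_D :: "(real^'n \<Rightarrow> real) \<Rightarrow> real \<Rightarrow> real^'n \<Rightarrow> real^'n \<Rightarrow> real^'n" where
  "delta_D F \<theta> x s = s - mu \<theta> x s *\<^sub>R s_tilde F x"

definition s_check :: "(real^'n \<Rightarrow> real) \<Rightarrow> real \<Rightarrow> real^'n \<Rightarrow> real^'n \<Rightarrow> real^'n" where
  "s_check F \<theta> x s = (1/2) *\<^sub>R (s + mu \<theta> x s *\<^sub>R s_tilde F x)"

definition H_mat ::
    "(real^'n) set \<Rightarrow> (real^'n \<Rightarrow> real) \<Rightarrow> real \<Rightarrow> real^'n \<Rightarrow> real^'n \<Rightarrow> real^'n^'n" where
  "H_mat K F \<theta> x s = mu \<theta> x s *\<^sub>R hessian (conj_barrier K F) (s_check F \<theta> x s)"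

definition H1_mat ::
    "(real^'n) set \<Rightarrow> (real^'n \<Rightarrow> real) \<Rightarrow> real \<Rightarrow> real^'n \<Rightarrow> real^'n \<Rightarrow> real^'n^'n" where
  "H1_mat K F \<theta> x s = (let H = H_mat K F \<theta> x s in
     H + (1 / (s \<bullet> x)) *\<^sub>R outer x x
       - (1 / (s \<bullet> (H *v s))) *\<^sub>R (H ** outer s s ** H))"

definition T2_mat ::
    "(real^'n) set \<Rightarrow> (real^'n \<Rightarrow> real) \<Rightarrow> real \<Rightarrow> real^'n \<Rightarrow> real^'n \<Rightarrow> real^'n^'n" where
  "T2_mat K F \<theta> x s = (let H1 = H1_mat K F \<theta> x s; dP = delta_P K F \<theta> x s; dD = delta_D F \<theta> x s in
     if dD = 0 then H1
     else H1 + (1 / (dD \<bullet> dP)) *\<^sub>R outer dP dP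
             - (1 / (dD \<bullet> (H1 *v dD))) *\<^sub>R (H1 ** outer dD dD ** H1))"

definition search_direction ::
    "real^'n^'m \<Rightarrow> (real^'n) set \<Rightarrow> (real^'n \<Rightarrow> real) \<Rightarrow> real \<Rightarrow> real \<Rightarrow> real^'n \<Rightarrow> real^'n \<Rightarrow>
     real^'n \<Rightarrow> real^'m \<Rightarrow> real^'n \<Rightarrow> bool" where
  "search_direction A K F \<theta> \<gamma> x s dx dy ds \<longleftrightarrow>
     transpose A *v dy + ds = 0 \<and> A *v dx = 0 \<and>
     dx + T2_mat K F \<theta> x s *v ds = - x - (\<gamma> * mu \<theta> x s) *\<^sub>R grad (conj_barrier K F) s"

definition interior_feasible ::
    "real^'n^'m \<Rightarrow> real^'m \<Rightarrow> real^'n \<Rightarrow> (real^'n) set \<Rightarrow> real^'n \<Rightarrow> real^'m \<Rightarrow> real^'n \<Rightarrow> bool" where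
  "interior_feasible A b c K x y s \<longleftrightarrow>
     x \<in> interior K \<and> s \<in> interior (dual_cone K) \<and> A *v x = b \<and> transpose A *v y + s = c"

text \<open>Infinite runs of the iteration with given parameter sequences. Membership of the iterates
  in the interiors of the cones is not required here: it is a property of the run, not a hypothesis on it.\<close>

definition pd_run ::
    "real^'n^'m \<Rightarrow> (real^'n) set \<Rightarrow> (real^'n \<Rightarrow> real) \<Rightarrow> real \<Rightarrow> (nat \<Rightarrow> real) \<Rightarrow> (nat \<Rightarrow> real) \<Rightarrow>
     real^'n \<Rightarrow> real^'m \<Rightarrow> real^'n \<Rightarrow>
     (nat \<Rightarrow> real^'n) \<Rightarrow> (nat \<Rightarrow> real^'m) \<Rightarrow> (nat \<Rightarrow> real^'n) \<Rightarrow> bool" where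
  "pd_run A K F \<theta> \<gamma> \<alpha> x0 y0 s0 x y s \<longleftrightarrow>
     x 0 = x0 \<and> y 0 = y0 \<and> s 0 = s0 \<and>
     (\<forall>k. \<exists>dx dy ds. search_direction A K F \<theta> (\<gamma> k) (x k) (s k) dx dy ds \<and>
        x (Suc k) = x k + \<alpha> k *\<^sub>R dx \<and>
        y (Suc k) = y k + \<alpha> k *\<^sub>R dy \<and>
        s (Suc k) = s k + \<alpha> k *\<^sub>R ds)"

text \<open>Even steps are predictor steps, odd steps are corrector steps.\<close>

definition pc_gamma :: "nat \<Rightarrow> real" where
  "pc_gamma k = (if even k then 0 else 1)"

definition pc_alpha :: "real \<Rightarrow> nat \<Rightarrow> real" where
  "pc_alpha \<theta> k = (if even k then 0.047464 / sqrt \<theta> else 1)"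

text \<open>The absolute constant of the complexity bound. A quantifier \<open>\<exists>C\<close> inside a theorem whose
  dimensions are type variables would let \<open>C\<close> depend on the dimensions, so the constant is
  fixed here: \<open>\<lceil>log 2 (1/\<epsilon>)\<rceil> \<le> 2 * log 2 (1/\<epsilon>)\<close> halvings of at most
  \<open>42 * sqrt \<theta>\<close> iterations each.\<close>

definition complexity_const :: real where
  "complexity_const = 84 / ln 2"

end

theory Submission
  imports Defs
begin

text \<open>
  Everything is scale invariant, so put \<open>z = x / \<mu>\<close> and \<open>\<delta> = \<delta>\<^sub>D = s + F'(z)\<close>, and measure the distance to
  the central path by the dual local norm of \<open>\<delta>\<close> at \<open>z\<close>. Since \<open>F\<^sub>*' = - X\<close> and \<open>F\<^sub>*'' = F''(X)\<inverse>\<close> for the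
  inverse \<open>X\<close> of \<open>- F'\<close>, self-concordance of \<open>F\<^sub>*\<close> is never needed: all estimates are made in the local norm
  of \<open>F\<close> at the single point \<open>X(s_check)\<close>, near which \<open>F'\<close> is linear up to a small relative error.
  In that norm \<open>T\<^sup>2 / \<mu>\<close> differs from \<open>F\<^sub>*''(s_check)\<close> by a relative error proportional to the distance, because each of its
  two rank-two updates exchanges a vector for a nearby one. A predictor step of local length about
  \<open>0.0475\<close> from distance \<open>0.004\<close> therefore ends at distance at most \<open>0.016\<close>, and a corrector step, being an
  approximate Newton step, brings the distance back below \<open>0.004\<close>. The secant equation \<open>T\<^sup>2 s = x\<close> makes
  the predictor multiply \<open>\<mu>\<close> by exactly \<open>1 - \<alpha>\<close>, and with \<open>T\<^sup>2 \<delta>\<^sub>D = \<delta>\<^sub>P\<close> the corrector preserves \<open>\<mu>\<close>.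
\<close>

section \<open>Symmetric positive definite matrices\<close>

text \<open>Two facts behind this argument have to be extracted from the barrier property itself.
  The Hessian of \<open>F\<close> is nondegenerate: along a null direction \<open>F\<close> is
  affine, so it stays bounded on bounded segments, the boundary is never reached, and pointedness of
  \<open>K\<close> is violated. And \<open>- F'\<close> maps the interior of \<open>K\<close> onto
  the interior of the dual cone, which is what makes \<open>X\<close> exist. The elementary bound on
  mixed third derivatives costs an exponent 5/2 in the comparison of Hessians. There is room for it:
  the estimates put the distance at about 0.0158 after a predictor and 0.0028 after a corrector,
  against the thresholds 0.016 and 0.004, and halving takes at most about 31 sqrt(\<theta>)
  iterations. The factor 1/sqrt(\<theta>) in the step length comes from homogeneity:
  \<open>F'\<close> has dual local norm sqrt(\<theta>) at every point, so \<open>s\<close> has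
  nearly that size near the central path.\<close>

definition spd :: "real^'n^'n \<Rightarrow> bool" where
  "spd W \<longleftrightarrow> (\<forall>u v. u \<bullet> (W *v v) = v \<bullet> (W *v u)) \<and> (\<forall>v. v \<noteq> 0 \<longrightarrow> 0 < v \<bullet> (W *v v))"

definition mnorm :: "real^'n^'n \<Rightarrow> real^'n \<Rightarrow> real" where
  "mnorm W v = sqrt (v \<bullet> (W *v v))"

lemma spd_sym: "spd W \<Longrightarrow> u \<bullet> (W *v v) = v \<bullet> (W *v u)"
  by (simp add: spd_def)

lemma spd_pos: "spd W \<Longrightarrow> v \<noteq> 0 \<Longrightarrow> 0 < v \<bullet> (W *v v)"
  by (simp add: spd_def)

lemma spd_nonneg: "spd W \<Longrightarrow> 0 \<le> v \<bullet> (W *v v)"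
  by (cases "v = 0") (auto simp: spd_def less_imp_le)

lemma mnorm_nonneg [simp]: "spd W \<Longrightarrow> 0 \<le> mnorm W v"
  by (simp add: mnorm_def spd_nonneg)

lemma mnorm_pos: "spd W \<Longrightarrow> v \<noteq> 0 \<Longrightarrow> 0 < mnorm W v"
  by (simp add: mnorm_def spd_pos)

lemma mnorm_sq: "spd W \<Longrightarrow> (mnorm W v)\<^sup>2 = v \<bullet> (W *v v)"
  by (simp add: mnorm_def spd_nonneg)

lemma mnorm_zero [simp]: "mnorm W 0 = 0"
  by (simp add: mnorm_def)

lemma mnorm_scale: "mnorm W (t *\<^sub>R v) = \<bar>t\<bar> * mnorm W v"
  by (simp add: mnorm_def matrix_vector_mult_scaleR real_sqrt_mult flip: power2_eq_square mult.assoc)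

lemma mnorm_minus [simp]: "mnorm W (- v) = mnorm W v"
  using mnorm_scale[of W "-1" v] by simp

lemma mnorm_minus_commute: "mnorm W (u - v) = mnorm W (v - u)"
  using mnorm_minus[of W "u - v"] by simp

lemma mnorm_cauchy:
  assumes "spd W"
  shows "\<bar>u \<bullet> (W *v v)\<bar> \<le> mnorm W u * mnorm W v"
proof (cases "v = 0")
  case True then show ?thesis using assms by simp
next
  case False
  define a b c where "a = u \<bullet> (W *v u)" and "b = u \<bullet> (W *v v)" and "c = v \<bullet> (W *v v)"
  have c: "c > 0" using spd_pos[OF assms False] by (simp add: c_def)
  have "0 \<le> (c *\<^sub>R u - b *\<^sub>R v) \<bullet> (W *v (c *\<^sub>R u - b *\<^sub>R v))"
    by (rule spd_nonneg[OF assms])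
  also have "\<dots> = c * (c * a - b\<^sup>2)"
    using spd_sym[OF assms, of v u]
    by (simp add: a_def b_def c_def matrix_vector_mult_diff_distrib matrix_vector_mult_scaleR
        inner_diff_left inner_diff_right algebra_simps power2_eq_square)
  finally have "b\<^sup>2 \<le> a * c" using c by (simp add: zero_le_mult_iff mult.commute)
  then have "sqrt (b\<^sup>2) \<le> sqrt (a * c)" by (rule real_sqrt_le_mono)
  then show ?thesis by (simp add: mnorm_def a_def b_def c_def real_sqrt_mult)
qed

lemma mnorm_add_sq:
  "spd W \<Longrightarrow> (mnorm W (u + v))\<^sup>2 = (mnorm W u)\<^sup>2 + 2 * (u \<bullet> (W *v v)) + (mnorm W v)\<^sup>2"
  using spd_sym[of W v u]
  by (simp add: mnorm_sq matrix_vector_right_distrib inner_add_left inner_add_right)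

lemma mnorm_triangle:
  assumes "spd W"
  shows "mnorm W (u + v) \<le> mnorm W u + mnorm W v"
proof (rule power2_le_imp_le)
  show "(mnorm W (u + v))\<^sup>2 \<le> (mnorm W u + mnorm W v)\<^sup>2"
    using mnorm_add_sq[OF assms, of u v] mnorm_cauchy[OF assms, of u v]
    by (simp add: power2_sum)
qed (simp add: assms)

lemma mnorm_triangle_diff: "spd W \<Longrightarrow> mnorm W (u - v) \<le> mnorm W u + mnorm W v"
  using mnorm_triangle[of W u "- v"] by simp

lemma mnorm_convex:
  assumes "spd W" "mnorm W u \<le> R" "mnorm W v \<le> R" "0 \<le> t" "t \<le> 1"
  shows "mnorm W ((1 - t) *\<^sub>R u + t *\<^sub>R v) \<le> R"
proof -
  have "mnorm W ((1 - t) *\<^sub>R u + t *\<^sub>R v) \<le> (1 - t) * mnorm W u + t * mnorm W v"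
    using mnorm_triangle[OF assms(1), of "(1 - t) *\<^sub>R u" "t *\<^sub>R v"] assms by (simp add: mnorm_scale)
  also have "\<dots> \<le> (1 - t) * R + t * R" using assms by (intro add_mono mult_left_mono) auto
  finally show ?thesis by (simp add: algebra_simps)
qed

lemma spd_invertible:
  assumes "spd W"
  shows "W *v (matrix_inv W *v v) = v" "matrix_inv W *v (W *v v) = v"
proof -
  have "\<forall>x. W *v x = 0 \<longrightarrow> x = 0"
    using spd_pos[OF assms] by (metis inner_zero_right less_irrefl)
  then obtain B where "B ** W = mat 1"
    by (metis matrix_left_invertible_ker)
  then have "invertible W" unfolding invertible_def using matrix_left_right_inverse by blast
  then have "W ** matrix_inv W = mat 1 \<and> matrix_inv W ** W = mat 1"
    unfolding invertible_def matrix_inv_def by (rule someI_ex)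
  then show "W *v (matrix_inv W *v v) = v" "matrix_inv W *v (W *v v) = v"
    by (simp_all add: matrix_vector_mul_assoc)
qed

lemma spd_matrix_inv:
  assumes "spd W"
  shows "spd (matrix_inv W)"
  unfolding spd_def
proof (intro conjI allI impI)
  fix u v
  show "u \<bullet> (matrix_inv W *v v) = v \<bullet> (matrix_inv W *v u)"
    using spd_sym[OF assms, of "matrix_inv W *v u" "matrix_inv W *v v"]
    by (simp add: spd_invertible[OF assms] inner_commute)
next
  fix v :: "real^'a" assume "v \<noteq> 0"
  then have "matrix_inv W *v v \<noteq> 0"
    by (metis assms matrix_vector_mult_0_right spd_invertible(1))
  from spd_pos[OF assms this] show "0 < v \<bullet> (matrix_inv W *v v)"
    by (simp add: spd_invertible[OF assms] inner_commute)
qed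

lemma mnorm_inv_mult: "spd W \<Longrightarrow> mnorm (matrix_inv W) (W *v v) = mnorm W v"
  by (simp add: mnorm_def spd_invertible inner_commute)

lemma mnorm_mult_inv: "spd W \<Longrightarrow> mnorm W (matrix_inv W *v v) = mnorm (matrix_inv W) v"
  by (simp add: mnorm_def spd_invertible inner_commute)

lemma mnorm_dual_cauchy:
  assumes "spd W"
  shows "\<bar>u \<bullet> v\<bar> \<le> mnorm W u * mnorm (matrix_inv W) v"
  using mnorm_cauchy[OF assms, of u "matrix_inv W *v v"]
  by (simp add: spd_invertible[OF assms] mnorm_mult_inv[OF assms])

text \<open>Testing with \<open>matrix_inv W *v w\<close> makes the Cauchy inequality sharp. For
  \<open>w = 0\<close> the sign of \<open>C\<close> is what is needed, and any nonzero
  \<open>u\<close> reveals it.\<close>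

lemma mnorm_inv_leI:
  assumes "spd W" "\<And>u. \<bar>u \<bullet> w\<bar> \<le> C * mnorm W u"
  shows "mnorm (matrix_inv W) w \<le> C"
proof (cases "w = 0")
  case True
  obtain v :: "real^'a" where "v \<noteq> 0" using UNIV_not_singleton[of 0] by auto
  then have "0 \<le> C * mnorm W v" "0 < mnorm W v"
    using assms(2)[of v] mnorm_pos[OF assms(1)] by auto
  then show ?thesis using True by (simp add: zero_le_mult_iff)
next
  case False
  let ?n = "mnorm (matrix_inv W) w"
  have p: "?n > 0" by (rule mnorm_pos[OF spd_matrix_inv[OF assms(1)] False])
  have "?n\<^sup>2 = (matrix_inv W *v w) \<bullet> w"
    by (simp add: mnorm_sq spd_matrix_inv assms(1) inner_commute)
  also have "\<dots> \<le> C * ?n"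
    using assms(2)[of "matrix_inv W *v w"] by (simp add: mnorm_mult_inv[OF assms(1)])
  finally show ?thesis using p by (simp add: power2_eq_square)
qed

lemma mnorm_inv_mono:
  assumes "spd V" "spd W" "\<And>u. mnorm V u \<le> k * mnorm W u"
  shows "mnorm (matrix_inv W) w \<le> k * mnorm (matrix_inv V) w"
proof (rule mnorm_inv_leI[OF assms(2)])
  fix u
  have "\<bar>u \<bullet> w\<bar> \<le> mnorm V u * mnorm (matrix_inv V) w" by (rule mnorm_dual_cauchy[OF assms(1)])
  also have "\<dots> \<le> (k * mnorm W u) * mnorm (matrix_inv V) w"
    by (intro mult_right_mono assms(3)) (simp add: assms(1) spd_matrix_inv)
  finally show "\<bar>u \<bullet> w\<bar> \<le> k * mnorm (matrix_inv V) w * mnorm W u" by (simp add: ac_simps)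
qed

text \<open>Polarization: for unit vectors, four times the mixed value is the difference of the form
  at \<open>u + v\<close> and at \<open>u - v\<close>, and the parallelogram law makes the two
  bounds add up to \<open>4 \<omega>\<close>. In contrast to the cubic case below, no constant is
  lost.\<close>

lemma symmetric_form_bound:
  fixes B :: "real^'n^'n"
  assumes "spd W" "\<And>u v. u \<bullet> (B *v v) = v \<bullet> (B *v u)"
    and q: "\<And>v. \<bar>v \<bullet> (B *v v)\<bar> \<le> \<omega> * (mnorm W v)\<^sup>2"
  shows "\<bar>u \<bullet> (B *v v)\<bar> \<le> \<omega> * mnorm W u * mnorm W v"
proof (cases "u = 0 \<or> v = 0")
  case True then show ?thesis by auto
next
  case False
  define a b where "a = mnorm W u" and "b = mnorm W v"
  have ab: "a > 0" "b > 0" using False mnorm_pos[OF assms(1)] by (auto simp: a_def b_def)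
  have eq: "4 * (x \<bullet> (B *v y)) = (x + y) \<bullet> (B *v (x + y)) - (x - y) \<bullet> (B *v (x - y))" for x y
    using assms(2)[of y x]
    by (simp add: matrix_vector_right_distrib matrix_vector_mult_diff_distrib
        inner_add_left inner_add_right inner_diff_left inner_diff_right)
  have par: "(mnorm W (x + y))\<^sup>2 + (mnorm W (x - y))\<^sup>2 = 2 * (mnorm W x)\<^sup>2 + 2 * (mnorm W y)\<^sup>2" for x y
    by (simp add: mnorm_sq[OF assms(1)] matrix_vector_right_distrib matrix_vector_mult_diff_distrib
        inner_add_left inner_add_right inner_diff_left inner_diff_right)
  have bnd: "\<bar>x \<bullet> (B *v y)\<bar> \<le> \<omega>" if "mnorm W x = 1" "mnorm W y = 1" for x y
  proof -
    have "\<bar>4 * (x \<bullet> (B *v y))\<bar> \<le> \<omega> * (mnorm W (x + y))\<^sup>2 + \<omega> * (mnorm W (x - y))\<^sup>2"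
      using q[of "x + y"] q[of "x - y"] eq[of x y] by linarith
    also have "\<dots> = 4 * \<omega>" using par[of x y] that by (simp flip: distrib_left)
    finally show ?thesis by simp
  qed
  have "\<bar>(inverse a *\<^sub>R u) \<bullet> (B *v (inverse b *\<^sub>R v))\<bar> \<le> \<omega>"
    using ab by (intro bnd) (simp_all add: mnorm_scale flip: a_def b_def)
  then have "\<bar>u \<bullet> (B *v v)\<bar> / (a * b) \<le> \<omega>"
    using ab by (simp add: matrix_vector_mult_scaleR abs_mult field_simps)
  then show ?thesis using ab by (simp add: a_def[symmetric] b_def[symmetric] field_simps)
qed

text \<open>\<open>p\<close> is a perturbation of \<open>P a\<close> of relative size
  \<open>\<eta>\<close>. In the numerator the two cross terms and the square give
  \<open>2 \<eta> + \<eta>^2\<close>, changing the denominator gives another \<open>\<eta>\<close>,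
  and the new denominator is at least \<open>1 - \<eta>\<close> times the old one.\<close>

lemma rank_one_update_bound:
  assumes "spd P" "a \<noteq> 0" "0 \<le> \<eta>" "\<eta> < 1"
    and close: "\<And>u. \<bar>u \<bullet> (p - P *v a)\<bar> \<le> \<eta> * mnorm P u * mnorm P a"
  shows "0 < a \<bullet> p"
    and "\<bar>(u \<bullet> p) * (v \<bullet> p) / (a \<bullet> p) - (u \<bullet> (P *v a)) * (v \<bullet> (P *v a)) / (a \<bullet> (P *v a))\<bar>
        \<le> (3 * \<eta> + \<eta>\<^sup>2) / (1 - \<eta>) * (mnorm P u * mnorm P v)"
proof -
  define n where "n = mnorm P a"
  have n: "n > 0" using mnorm_pos[OF assms(1,2)] by (simp add: n_def)
  define e where "e = p - P *v a"
  define k where "k = a \<bullet> e"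
  have na: "a \<bullet> (P *v a) = n\<^sup>2" using mnorm_sq[OF assms(1)] by (simp add: n_def)
  have k: "\<bar>k\<bar> \<le> \<eta> * n\<^sup>2" using close[of a] by (simp add: k_def e_def n_def power2_eq_square)
  have ap: "a \<bullet> p = n\<^sup>2 + k" by (simp add: k_def e_def na inner_diff_right)
  have kn: "(1 - \<eta>) * n\<^sup>2 \<le> n\<^sup>2 + k" using k by (simp add: algebra_simps)
  have n2: "n\<^sup>2 > 0" "(1 - \<eta>) * n\<^sup>2 > 0" using n assms(4) by auto
  show pos: "0 < a \<bullet> p" using kn n2 ap by linarith
  define U V where "U = mnorm P u" and "V = mnorm P v"
  have UV: "U \<ge> 0" "V \<ge> 0" by (simp_all add: U_def V_def assms(1))
  define ua ue va ve where "ua = u \<bullet> (P *v a)" and "ue = u \<bullet> e" and "va = v \<bullet> (P *v a)" and "ve = v \<bullet> e"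
  have b1: "\<bar>ua\<bar> \<le> U * n" "\<bar>va\<bar> \<le> V * n"
    using mnorm_cauchy[OF assms(1)] by (auto simp: ua_def va_def U_def V_def n_def)
  have b2: "\<bar>ue\<bar> \<le> \<eta> * U * n" "\<bar>ve\<bar> \<le> \<eta> * V * n"
    using close[of u] close[of v] by (auto simp: ue_def ve_def U_def V_def n_def e_def)
  have up: "u \<bullet> p = ua + ue" "v \<bullet> p = va + ve"
    by (simp_all add: ua_def ue_def va_def ve_def e_def inner_diff_right)
  have m: "\<bar>x * y\<bar> \<le> A * B" if "\<bar>x\<bar> \<le> A" "\<bar>y\<bar> \<le> B" for x y A B :: real
    using that by (simp add: abs_mult mult_mono')
  have "\<bar>ua * ve\<bar> \<le> (U * n) * (\<eta> * V * n)" "\<bar>ue * va\<bar> \<le> (\<eta> * U * n) * (V * n)"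
    "\<bar>ue * ve\<bar> \<le> (\<eta> * U * n) * (\<eta> * V * n)" "\<bar>(ua * va) * k\<bar> \<le> ((U * n) * (V * n)) * (\<eta> * n\<^sup>2)"
    by (intro m b1 b2 k)+
  moreover define N where "N = U * V * n\<^sup>2"
  ultimately have t: "\<bar>ua * ve\<bar> \<le> \<eta> * N" "\<bar>ue * va\<bar> \<le> \<eta> * N" "\<bar>ue * ve\<bar> \<le> \<eta>\<^sup>2 * N"
    "\<bar>(ua * va) * k\<bar> \<le> \<eta> * N * n\<^sup>2"
    by (simp_all add: power2_eq_square ac_simps)
  have "\<bar>(ua * va) * k / n\<^sup>2\<bar> \<le> \<eta> * N"
    using t(4) n2(1) by (simp add: abs_mult field_simps)
  moreover define Q where "Q = ua * ve + ue * va + ue * ve - (ua * va) * k / n\<^sup>2"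
  moreover have "(3 * \<eta> + \<eta>\<^sup>2) * N = \<eta> * N + \<eta> * N + \<eta> * N + \<eta>\<^sup>2 * N"
    by (simp add: algebra_simps)
  ultimately have Q: "\<bar>Q\<bar> \<le> (3 * \<eta> + \<eta>\<^sup>2) * N"
    using t(1-3) by linarith
  have "(u \<bullet> p) * (v \<bullet> p) / (a \<bullet> p) - ua * va / (a \<bullet> (P *v a)) = Q / (n\<^sup>2 + k)"
    using pos n2 unfolding up na Q_def by (simp add: ap field_simps)
  then have "\<bar>(u \<bullet> p) * (v \<bullet> p) / (a \<bullet> p) - ua * va / (a \<bullet> (P *v a))\<bar> = \<bar>Q\<bar> / (n\<^sup>2 + k)"
    using pos ap by (simp add: abs_div)
  also have "\<dots> \<le> (3 * \<eta> + \<eta>\<^sup>2) * N / ((1 - \<eta>) * n\<^sup>2)"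
    using Q kn n2 by (intro frac_le) auto
  also have "\<dots> = (3 * \<eta> + \<eta>\<^sup>2) / (1 - \<eta>) * (U * V)"
    using n2(1) by (simp add: N_def)
  finally show "\<bar>(u \<bullet> p) * (v \<bullet> p) / (a \<bullet> p) - (u \<bullet> (P *v a)) * (v \<bullet> (P *v a)) / (a \<bullet> (P *v a))\<bar>
        \<le> (3 * \<eta> + \<eta>\<^sup>2) / (1 - \<eta>) * (mnorm P u * mnorm P v)"
    by (simp add: ua_def va_def U_def V_def)
qed

section \<open>Second derivatives and cubic forms\<close>

lemma line_derivative:
  fixes f :: "'a::real_normed_vector \<Rightarrow> real"
  assumes "f differentiable (at (x + t *\<^sub>R h))"
  shows "((\<lambda>t. f (x + t *\<^sub>R h)) has_real_derivative frechet_derivative f (at (x + t *\<^sub>R h)) h) (at t)"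
proof -
  have 1: "((\<lambda>t. x + t *\<^sub>R h) has_derivative (\<lambda>r. r *\<^sub>R h)) (at t)"
    by (auto intro!: derivative_eq_intros)
  have 2: "(f has_derivative frechet_derivative f (at (x + t *\<^sub>R h))) (at (x + t *\<^sub>R h))"
    using assms by (simp add: frechet_derivative_works)
  from has_derivative_compose[OF 1 2]
  show ?thesis
    using linear_frechet_derivative[OF assms]
    by (simp add: has_field_derivative_def linear_scale mult.commute[of _ "frechet_derivative f (at (x + t *\<^sub>R h)) h"])
qed

text \<open>Schwarz's theorem by the classical second difference: it is symmetric in
  \<open>v\<close> and \<open>w\<close>, and two applications of the mean value theorem turn it into
  a mixed second derivative at a nearby point. Continuity then closes the gap.\<close>

lemma Ck2_symmetric:
  fixes f :: "'a::real_normed_vector \<Rightarrow> real"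
  assumes C: "Ck_on 2 f S" and S: "open S" "x \<in> S"
  shows "frechet_derivative (\<lambda>y. frechet_derivative f (at y) v) (at x) w =
         frechet_derivative (\<lambda>y. frechet_derivative f (at y) w) (at x) v"
proof -
  define D where "D v y = frechet_derivative f (at y) v" for v y
  define E where "E v w y = frechet_derivative (D v) (at y) w" for v w y
  have df: "f differentiable (at y)" if "y \<in> S" for y
    using C that by (simp add: numeral_2_eq_2)
  have dD: "D v differentiable (at y)" if "y \<in> S" for v y
    using C that by (simp add: numeral_2_eq_2 D_def[abs_def])
  have cE: "continuous_on S (E v w)" for v w
    using C by (simp add: numeral_2_eq_2 D_def[abs_def] E_def[abs_def])
  have key: "\<exists>y \<in> ball x r. f (x + t *\<^sub>R v + t *\<^sub>R w) - f (x + t *\<^sub>R v) - f (x + t *\<^sub>R w) + f x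
      = t * t * E v w y"
    if r: "ball x r \<subseteq> S" and t: "t > 0" "t * (norm v + norm w) < r" for r t v w
  proof -
    have inb: "x + a *\<^sub>R v + c *\<^sub>R w \<in> ball x r" if "0 \<le> a" "a \<le> t" "0 \<le> c" "c \<le> t" for a c
    proof -
      have "norm (a *\<^sub>R v + c *\<^sub>R w) \<le> a * norm v + c * norm w"
        using norm_triangle_ineq[of "a *\<^sub>R v" "c *\<^sub>R w"] that by simp
      also have "\<dots> \<le> t * norm v + t * norm w" using that by (intro add_mono mult_right_mono) auto
      finally show ?thesis using t(2) norm_minus_cancel[of "a *\<^sub>R v + c *\<^sub>R w"]
        by (simp add: dist_norm algebra_simps)
    qed
    then have inS: "x + a *\<^sub>R v + c *\<^sub>R w \<in> S" if "0 \<le> a" "a \<le> t" "0 \<le> c" "c \<le> t" for a c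
      using that r by blast
    define p where "p a = f ((x + t *\<^sub>R w) + a *\<^sub>R v) - f (x + a *\<^sub>R v)" for a
    have "\<exists>z>0. z < t \<and> p t - p 0 = (t - 0) * (D v ((x + t *\<^sub>R w) + z *\<^sub>R v) - D v (x + z *\<^sub>R v))"
    proof (rule MVT2)
      fix a assume a: "0 \<le> a" "a \<le> t"
      show "(p has_real_derivative D v ((x + t *\<^sub>R w) + a *\<^sub>R v) - D v (x + a *\<^sub>R v)) (at a)"
        unfolding p_def D_def using inS[OF a, of t] inS[OF a, of 0] t(1)
        by (intro DERIV_diff line_derivative df) (simp_all add: algebra_simps)
    qed (rule t(1))
    then obtain a where a: "0 < a" "a < t"
      and pa: "p t - p 0 = t * (D v ((x + a *\<^sub>R v) + t *\<^sub>R w) - D v ((x + a *\<^sub>R v) + 0 *\<^sub>R w))"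
      by (auto simp: algebra_simps)
    have "\<exists>z>0. z < t \<and> D v ((x + a *\<^sub>R v) + t *\<^sub>R w) - D v ((x + a *\<^sub>R v) + 0 *\<^sub>R w)
        = (t - 0) * E v w ((x + a *\<^sub>R v) + z *\<^sub>R w)"
      unfolding E_def using a inS by (intro MVT2 t(1) line_derivative dD) auto
    then obtain c where c: "0 < c" "c < t"
      and "D v ((x + a *\<^sub>R v) + t *\<^sub>R w) - D v ((x + a *\<^sub>R v) + 0 *\<^sub>R w)
        = t * E v w ((x + a *\<^sub>R v) + c *\<^sub>R w)" by auto
    with pa have "p t - p 0 = t * t * E v w (x + a *\<^sub>R v + c *\<^sub>R w)" by simp
    moreover have "x + a *\<^sub>R v + c *\<^sub>R w \<in> ball x r" using a c by (intro inb) auto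
    moreover have "p t - p 0 = f (x + t *\<^sub>R v + t *\<^sub>R w) - f (x + t *\<^sub>R v) - f (x + t *\<^sub>R w) + f x"
      by (simp add: p_def algebra_simps)
    ultimately show ?thesis by metis
  qed
  have "\<bar>E v w x - E w v x\<bar> \<le> e" if "e > 0" for e
  proof -
    have "\<exists>r>0. ball x r \<subseteq> S \<and> (\<forall>y\<in>ball x r. \<bar>E v w y - E v w x\<bar> < e/2)" for v w
    proof -
      obtain r1 where r1: "r1 > 0" "ball x r1 \<subseteq> S" using S open_contains_ball by blast
      have "continuous (at x) (E v w)" using cE S continuous_on_eq_continuous_at by blast
      then obtain r2 where r2: "r2 > 0" "\<And>y. dist y x < r2 \<Longrightarrow> dist (E v w y) (E v w x) < e/2"
        using \<open>e > 0\<close> unfolding continuous_at_eps_delta dist_real_def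
        by (metis half_gt_zero dist_real_def)
      show ?thesis
        using r1 r2 by (intro exI[of _ "min r1 r2"]) (auto simp: dist_real_def dist_commute)
    qed
    then obtain r1 r2 where r: "r1 > 0" "ball x r1 \<subseteq> S" "\<And>y. y\<in>ball x r1 \<Longrightarrow> \<bar>E v w y - E v w x\<bar> < e/2"
      "r2 > 0" "ball x r2 \<subseteq> S" "\<And>y. y\<in>ball x r2 \<Longrightarrow> \<bar>E w v y - E w v x\<bar> < e/2"
      by metis
    define q where "q = min r1 r2 / 2 / (norm v + norm w + 1)"
    have q: "q > 0" using r by (auto simp: q_def intro!: divide_pos_pos add_nonneg_pos)
    have "q * (norm v + norm w + 1) = min r1 r2 / 2"
      unfolding q_def by (smt (verit) norm_ge_zero nonzero_eq_divide_eq)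
    then have "q * (norm v + norm w) + q = min r1 r2 / 2" by (simp add: distrib_left)
    moreover have "min r1 r2 > 0" using r by simp
    ultimately have "q * (norm v + norm w) < min r1 r2" using q by linarith
    then have q': "q * (norm v + norm w) < r1" "q * (norm w + norm v) < r2" by (simp_all add: add.commute)
    obtain y1 where y1: "y1 \<in> ball x r1"
      "f (x + q *\<^sub>R v + q *\<^sub>R w) - f (x + q *\<^sub>R v) - f (x + q *\<^sub>R w) + f x = q * q * E v w y1"
      using key[OF r(2) q q'(1)] by blast
    obtain y2 where y2: "y2 \<in> ball x r2"
      "f (x + q *\<^sub>R w + q *\<^sub>R v) - f (x + q *\<^sub>R w) - f (x + q *\<^sub>R v) + f x = q * q * E w v y2"
      using key[OF r(5) q q'(2)] by blast
    have "q * q * E v w y1 = q * q * E w v y2" using y1(2) y2(2) by (simp add: algebra_simps)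
    then have "E v w y1 = E w v y2" using q by simp
    then show ?thesis using r(3)[OF y1(1)] r(6)[OF y2(1)] by linarith
  qed
  then have "E v w x - E w v x = 0"
    by (metis abs_le_zero_iff field_le_epsilon add_0)
  then show ?thesis by (simp add: E_def D_def[abs_def])
qed

text \<open>The part of the cube that is odd in \<open>h\<close>:
  \<open>(u + h/2)^3 - (u - h/2)^3 = 3 u^2 h + h^3/4\<close>. Only diagonal values remain, and those
  are what self-concordance bounds.\<close>

lemma cubic_form_polarization:
  fixes T :: "'a::real_vector \<Rightarrow> 'a \<Rightarrow> 'a \<Rightarrow> real"
  assumes lin: "\<And>u v. linear (T u v)"
    and sym: "\<And>u v w. T u v w = T v u w" "\<And>u v w. T u v w = T u w v"
  shows "3 * T u u h = T (u + (1/2) *\<^sub>R h) (u + (1/2) *\<^sub>R h) (u + (1/2) *\<^sub>R h)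
    - T (u - (1/2) *\<^sub>R h) (u - (1/2) *\<^sub>R h) (u - (1/2) *\<^sub>R h) - T h h h / 4"
proof -
  have l3: "T a b (c + d) = T a b c + T a b d" "T a b (c - d) = T a b c - T a b d"
    "T a b (r *\<^sub>R c) = r * T a b c" for a b c d r
    using lin[of a b] by (simp_all add: linear_add linear_diff linear_scale)
  have l2: "T a (c + d) b = T a c b + T a d b" "T a (c - d) b = T a c b - T a d b"
    "T a (r *\<^sub>R c) b = r * T a c b" for a b c d r
    using l3 sym(2) by metis+
  have l1: "T (c + d) a b = T c a b + T d a b" "T (c - d) a b = T c a b - T d a b"
    "T (r *\<^sub>R c) a b = r * T c a b" for a b c d r
    using l2 sym(1) by metis+
  have s: "T u h u = T u u h" "T h u u = T u u h" "T h u h = T u h h" "T h h u = T u h h"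
    by (metis sym)+
  show ?thesis by (simp add: l1 l2 l3 s algebra_simps)
qed

text \<open>For unit vectors \<open>u\<close>, \<open>h\<close> the norms \<open>p\<close>,
  \<open>q\<close> of \<open>u + h/2\<close>, \<open>u - h/2\<close> satisfy these hypotheses, by
  the parallelogram law and the triangle inequality. With the sum of squares fixed, the sum of cubes
  decreases in \<open>p + q\<close> from 2 on, so the worst case is 2. The resulting 7/2 gives 5/4 =
  (7/2 + 1/4)/3 in \<open>cubic_form_bound\<close>.\<close>

lemma cubes_sum_bound:
  fixes p q :: real
  assumes "0 \<le> p" "0 \<le> q" "p\<^sup>2 + q\<^sup>2 = 5/2" "2 \<le> p + q"
  shows "p^3 + q^3 \<le> 7/2"
proof -
  define s where "s = p + q"
  have pq: "p * q = (s\<^sup>2 - 5/2) / 2" using assms(3) by (simp add: s_def power2_sum)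
  have "p^3 + q^3 = s * (p\<^sup>2 + q\<^sup>2 - p * q)" by (simp add: s_def algebra_simps power2_eq_square power3_eq_cube)
  also have "\<dots> = s * (15/4) - s^3 / 2"
    by (simp add: assms(3) pq) (simp add: field_simps power2_eq_square power3_eq_cube)
  also have "\<dots> = 7/2 - (s - 2) * (s\<^sup>2 + 2 * s - 7/2) / 2"
    by (simp add: field_simps power2_eq_square power3_eq_cube)
  also have "\<dots> \<le> 7/2"
  proof -
    have "2\<^sup>2 \<le> s\<^sup>2" using assms(4) by (intro power_mono) (auto simp: s_def)
    then have "0 \<le> (s - 2) * (s\<^sup>2 + 2 * s - 7/2)" using assms(4) by (intro mult_nonneg_nonneg) (auto simp: s_def)
    then show ?thesis by simp
  qed
  finally show ?thesis .
qed

text \<open>The sharp constant (Banach) is \<open>C\<close> instead of \<open>5/4 C\<close>; the weaker one has an elementary proof.\<close>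

lemma cubic_form_bound:
  fixes T :: "real^'n \<Rightarrow> real^'n \<Rightarrow> real^'n \<Rightarrow> real"
  assumes lin: "\<And>u v. linear (T u v)"
    and sym: "\<And>u v w. T u v w = T v u w" "\<And>u v w. T u v w = T u w v"
    and W: "spd W" and diag: "\<And>h. \<bar>T h h h\<bar> \<le> C * (mnorm W h)^3"
  shows "\<bar>T u u h\<bar> \<le> 5/4 * C * (mnorm W u)\<^sup>2 * mnorm W h"
proof (cases "u = 0 \<or> h = 0")
  case True
  have "T u u 0 = 0" "T 0 0 h = 0" using lin sym by (metis linear_0)+
  then show ?thesis using True by auto
next
  case False
  define a b where "a = mnorm W u" and "b = mnorm W h"
  have ab: "a > 0" "b > 0" using False mnorm_pos[OF W] by (auto simp: a_def b_def)
  have unit: "\<bar>T x x y\<bar> \<le> 5/4 * C" if x: "mnorm W x = 1" and y: "mnorm W y = 1" for x y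
  proof -
    define p q where "p = mnorm W (x + (1/2) *\<^sub>R y)" and "q = mnorm W (x - (1/2) *\<^sub>R y)"
    have nn: "p \<ge> 0" "q \<ge> 0" by (simp_all add: p_def q_def W)
    have "p\<^sup>2 + q\<^sup>2 = 2 * (mnorm W x)\<^sup>2 + (mnorm W y)\<^sup>2 / 2"
      by (simp add: p_def q_def mnorm_sq[OF W] matrix_vector_right_distrib matrix_vector_mult_diff_distrib
        inner_add_left inner_add_right inner_diff_left inner_diff_right matrix_vector_mult_scaleR field_simps)
    moreover have "mnorm W ((x + (1/2) *\<^sub>R y) + (x - (1/2) *\<^sub>R y)) \<le> p + q"
      unfolding p_def q_def by (rule mnorm_triangle[OF W])
    moreover have "(x + (1/2) *\<^sub>R y) + (x - (1/2) *\<^sub>R y) = 2 *\<^sub>R x" by (simp add: scaleR_2)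
    ultimately have pq: "p^3 + q^3 \<le> 7/2" using x y nn by (intro cubes_sum_bound) (auto simp: mnorm_scale)
    have C: "C \<ge> 0" using diag[of y] y by simp
    have "\<bar>3 * T x x y\<bar> \<le> C * p^3 + C * q^3 + C / 4"
      using diag[of "x + (1/2) *\<^sub>R y"] diag[of "x - (1/2) *\<^sub>R y"] diag[of y]
        cubic_form_polarization[OF lin sym, of x y] y
      unfolding p_def q_def by simp
    also have "\<dots> \<le> C * (7/2) + C / 4" using mult_left_mono[OF pq C] by (simp add: distrib_left)
    finally show ?thesis by simp
  qed
  have sc: "T (r *\<^sub>R x) (r *\<^sub>R x) (s *\<^sub>R y) = r * r * s * T x x y" for r s x y
  proof -
    have l: "T a b (r *\<^sub>R c) = r * T a b c" for a b c r
      using linear_scale[OF lin] by simp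
    have "T (r *\<^sub>R x) (r *\<^sub>R x) (s *\<^sub>R y) = s * T (r *\<^sub>R x) (r *\<^sub>R x) y" by (rule l)
    also have "T (r *\<^sub>R x) (r *\<^sub>R x) y = T (r *\<^sub>R x) y (r *\<^sub>R x)" by (rule sym(2))
    also have "\<dots> = r * T (r *\<^sub>R x) y x" by (rule l)
    also have "T (r *\<^sub>R x) y x = T x y (r *\<^sub>R x)" by (metis sym)
    also have "\<dots> = r * T x y x" by (rule l)
    also have "T x y x = T x x y" by (rule sym(2))
    finally show ?thesis by simp
  qed
  have "\<bar>T (inverse a *\<^sub>R u) (inverse a *\<^sub>R u) (inverse b *\<^sub>R h)\<bar> \<le> 5/4 * C"
    using ab by (intro unit) (simp_all add: mnorm_scale flip: a_def b_def)
  then have "\<bar>T u u h\<bar> / (a * a * b) \<le> 5/4 * C"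
    unfolding sc using ab by (simp add: abs_mult field_simps)
  then show ?thesis using ab by (simp add: a_def[symmetric] b_def[symmetric] field_simps power2_eq_square)
qed

section \<open>Derivatives of a barrier\<close>

locale lhscb =
  fixes K :: "(real^'n) set" and F :: "real^'n \<Rightarrow> real" and \<theta> :: real
  assumes proper: "proper_cone K" and LHSCB: "LHSCB \<theta> K F"
begin

abbreviation "S \<equiv> interior K"
abbreviation "g \<equiv> grad F"
abbreviation "G \<equiv> hessian F"

lemma theta_ge_1: "1 \<le> \<theta>"
  using LHSCB by (simp add: LHSCB_def)

lemma S_ne: "S \<noteq> {}" and K_closed: "closed K" and K_convex: "convex K" and K_cone: "cone K"
  and K_pointed: "x \<in> K \<Longrightarrow> - x \<in> K \<Longrightarrow> x = 0"
  using proper by (auto simp: proper_cone_def)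

lemma S_open: "open S" and S_sub: "x \<in> S \<Longrightarrow> x \<in> K"
  using interior_subset by auto

lemma S_convex: "convex S"
  using K_convex by (rule convex_interior)

lemma Ck3: "Ck_on (Suc (Suc (Suc 0))) F S"
  using LHSCB by (simp add: LHSCB_def numeral_3_eq_3)

lemma F_has_derivative: "x \<in> S \<Longrightarrow> (F has_derivative (\<lambda>h. h \<bullet> g x)) (at x)"
proof -
  assume "x \<in> S"
  then have d: "(F has_derivative frechet_derivative F (at x)) (at x)"
    using Ck3 by (simp add: frechet_derivative_works)
  define v where "v = (\<chi> i. frechet_derivative F (at x) (axis i 1))"
  have lin: "linear (frechet_derivative F (at x))"
    using d has_derivative_linear by blast
  have "frechet_derivative F (at x) h = h \<bullet> v" for h
  proof -
    have "frechet_derivative F (at x) h = frechet_derivative F (at x) (\<Sum>i\<in>UNIV. h $ i *\<^sub>R axis i 1)"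
      by (metis basis_expansion scalar_mult_eq_scaleR)
    also have "\<dots> = h \<bullet> v"
      by (simp add: linear_sum[OF lin] linear_scale[OF lin] v_def inner_vec_def)
    finally show ?thesis .
  qed
  then have "GDERIV F x :> v"
    using d by (simp add: gderiv_def) (metis (no_types, lifting) ext)
  moreover have "w = v" if "GDERIV F x :> w" for w
  proof -
    have "(\<lambda>h. h \<bullet> w) = (\<lambda>h. h \<bullet> v)"
      using that \<open>GDERIV F x :> v\<close> unfolding gderiv_def by (rule has_derivative_unique)
    then show ?thesis by (metis inner_commute vector_eq_rdot)
  qed
  ultimately have "GDERIV F x :> g x" unfolding grad_def by (rule theI)
  then show ?thesis by (simp add: gderiv_def)
qed

lemma F_frechet: "x \<in> S \<Longrightarrow> frechet_derivative F (at x) v = v \<bullet> g x"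
  using frechet_derivative_at[OF F_has_derivative] by metis

text \<open>\<open>Ck_on\<close> provides iterated directional derivatives of \<open>F\<close>. On
  the open set \<open>S\<close> they agree with the components of \<open>g\<close>, so
  differentiability and derivatives transfer; \<open>form_differentiable\<close> repeats this one
  order higher.\<close>

lemma directional_differentiable: "x \<in> S \<Longrightarrow> (\<lambda>y. v \<bullet> g y) differentiable (at x)"
  and directional_frechet: "x \<in> S \<Longrightarrow>
    frechet_derivative (\<lambda>y. frechet_derivative F (at y) v) (at x) =
    frechet_derivative (\<lambda>y. v \<bullet> g y) (at x)"
proof -
  assume x: "x \<in> S"
  have d: "(\<lambda>y. frechet_derivative F (at y) v) differentiable (at x)"
    using Ck3 x by simp
  show "(\<lambda>y. v \<bullet> g y) differentiable (at x)"
    using d has_derivative_transform_within_open[OF _ S_open x, of "\<lambda>y. frechet_derivative F (at y) v"]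
    unfolding differentiable_def by (metis F_frechet)
  show "frechet_derivative (\<lambda>y. frechet_derivative F (at y) v) (at x) =
    frechet_derivative (\<lambda>y. v \<bullet> g y) (at x)"
    by (rule frechet_derivative_transform_within_open[OF d S_open x]) (simp add: F_frechet)
qed

lemma g_has_derivative: "x \<in> S \<Longrightarrow> (g has_derivative (\<lambda>h. G x *v h)) (at x)"
proof -
  assume x: "x \<in> S"
  have "g differentiable (at x)"
    using directional_differentiable[OF x]
    by (subst differentiable_componentwise_within) (simp add: inner_commute)
  then show ?thesis by (simp add: jacobian_works hessian_def)
qed

lemma frechet2: "x \<in> S \<Longrightarrow>
    frechet_derivative (\<lambda>y. frechet_derivative F (at y) v) (at x) w = v \<bullet> (G x *v w)"
proof -
  assume x: "x \<in> S"
  have "((\<lambda>y. v \<bullet> g y) has_derivative (\<lambda>w. v \<bullet> (G x *v w))) (at x)"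
    by (intro has_derivative_inner_right g_has_derivative x)
  from frechet_derivative_at[OF this] show ?thesis
    by (simp add: directional_frechet[OF x] fun_eq_iff)
qed

lemma G_sym: "x \<in> S \<Longrightarrow> u \<bullet> (G x *v v) = v \<bullet> (G x *v u)"
proof -
  assume x: "x \<in> S"
  have "Ck_on 2 F S"
  proof -
    have "continuous_on S (\<lambda>y. frechet_derivative (\<lambda>y. frechet_derivative F (at y) v) (at y) w)" for v w
      using Ck3 by (intro differentiable_imp_continuous_on) (auto simp: differentiable_on_def intro: differentiable_at_withinI)
    then show ?thesis using Ck3 by (simp add: numeral_2_eq_2)
  qed
  from Ck2_symmetric[OF this S_open x, of u v] show ?thesis by (simp add: frechet2[OF x])
qed

text \<open>Differentiating the Hessian form makes linearity in \<open>w\<close> immediate.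
  \<open>T3_sym1\<close> and \<open>T3_sym2\<close> supply the symmetry that the polarization
  argument needs.\<close>

definition T3 :: "real^'n \<Rightarrow> real^'n \<Rightarrow> real^'n \<Rightarrow> real^'n \<Rightarrow> real" where
  "T3 x u v w = frechet_derivative (\<lambda>y. u \<bullet> (G y *v v)) (at x) w"

lemma form_differentiable: "x \<in> S \<Longrightarrow> (\<lambda>y. u \<bullet> (G y *v v)) differentiable (at x)"
  and form_frechet: "x \<in> S \<Longrightarrow>
    frechet_derivative (\<lambda>y. frechet_derivative (\<lambda>y. frechet_derivative F (at y) u) (at y) v) (at x) = T3 x u v"
proof -
  assume x: "x \<in> S"
  have d: "(\<lambda>y. frechet_derivative (\<lambda>y. frechet_derivative F (at y) u) (at y) v) differentiable (at x)"
    using Ck3 x by simp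
  show "(\<lambda>y. u \<bullet> (G y *v v)) differentiable (at x)"
    using d has_derivative_transform_within_open[OF _ S_open x,
      of "\<lambda>y. frechet_derivative (\<lambda>y. frechet_derivative F (at y) u) (at y) v"]
    unfolding differentiable_def by (metis frechet2)
  show "frechet_derivative (\<lambda>y. frechet_derivative (\<lambda>y. frechet_derivative F (at y) u) (at y) v) (at x) = T3 x u v"
    unfolding T3_def
    by (rule frechet_derivative_transform_within_open[OF d S_open x]) (simp add: frechet2)
qed

lemma T3_linear: "x \<in> S \<Longrightarrow> linear (T3 x u v)"
  unfolding T3_def by (rule linear_frechet_derivative[OF form_differentiable])

lemma T3_sym1: "x \<in> S \<Longrightarrow> T3 x u v w = T3 x v u w"
  unfolding T3_def
  by (subst frechet_derivative_transform_within_open[OF form_differentiable S_open, of x _ _ "\<lambda>y. v \<bullet> (G y *v u)"])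
    (auto simp: G_sym)

lemma T3_sym2: "x \<in> S \<Longrightarrow> T3 x u v w = T3 x u w v"
proof -
  assume x: "x \<in> S"
  have "Ck_on 2 (\<lambda>y. frechet_derivative F (at y) u) S" using Ck3 by (simp add: numeral_2_eq_2)
  from Ck2_symmetric[OF this S_open x, of v w] show ?thesis by (simp add: form_frechet[OF x])
qed

lemma Dk2: "x \<in> S \<Longrightarrow> Dk 2 F x h = h \<bullet> (G x *v h)"
  by (simp add: numeral_2_eq_2 frechet2)

lemma Dk3: "x \<in> S \<Longrightarrow> Dk 3 F x h = T3 x h h h"
  by (simp add: numeral_3_eq_3 form_frechet)

lemma F_line: "x + t *\<^sub>R h \<in> S \<Longrightarrow>
    ((\<lambda>t. F (x + t *\<^sub>R h)) has_real_derivative h \<bullet> g (x + t *\<^sub>R h)) (at t)"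
  using line_derivative[of F x t h] F_has_derivative[of "x + t *\<^sub>R h"]
  by (auto simp: F_frechet differentiable_def)

lemma g_line: "x + t *\<^sub>R h \<in> S \<Longrightarrow>
    ((\<lambda>t. u \<bullet> g (x + t *\<^sub>R h)) has_real_derivative u \<bullet> (G (x + t *\<^sub>R h) *v h)) (at t)"
  using line_derivative[of "\<lambda>y. u \<bullet> g y" x t h] directional_differentiable[of "x + t *\<^sub>R h" u]
  by (simp add: directional_frechet[symmetric] frechet2)

lemma G_line: "x + t *\<^sub>R h \<in> S \<Longrightarrow>
    ((\<lambda>t. u \<bullet> (G (x + t *\<^sub>R h) *v v)) has_real_derivative T3 (x + t *\<^sub>R h) u v h) (at t)"
  using line_derivative[of "\<lambda>y. u \<bullet> (G y *v v)" x t h] form_differentiable[of "x + t *\<^sub>R h" u v]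
  by (simp add: T3_def)

text \<open>The difference quotient of a convex function along the segment is at most the slope of
  the chord, and its limit at 0 is the directional derivative.\<close>

lemma F_tangent:
  assumes "x \<in> S" "y \<in> S"
  shows "F x + (y - x) \<bullet> g x \<le> F y"
proof -
  have cv: "convex_on S F" using LHSCB by (simp add: LHSCB_def)
  have "((\<lambda>t. F (x + t *\<^sub>R (y - x))) has_real_derivative (y - x) \<bullet> g x) (at 0)"
    using F_line[of x 0 "y - x"] assms by simp
  then have "((\<lambda>t. (F (x + t *\<^sub>R (y - x)) - F x) / t) \<longlongrightarrow> (y - x) \<bullet> g x) (at 0)"
    by (simp add: has_field_derivative_iff)
  then have "((\<lambda>t. (F (x + t *\<^sub>R (y - x)) - F x) / t) \<longlongrightarrow> (y - x) \<bullet> g x) (at_right 0)"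
    by (rule filterlim_mono) (auto simp: at_le)
  moreover have "eventually (\<lambda>t. (F (x + t *\<^sub>R (y - x)) - F x) / t \<le> F y - F x) (at_right 0)"
    unfolding eventually_at_right_field
  proof (intro exI[of _ 1] conjI allI impI)
    fix t :: real assume t: "0 < t" "t < 1"
    have "F ((1 - t) *\<^sub>R x + t *\<^sub>R y) \<le> (1 - t) * F x + t * F y"
      using cv assms t by (intro convex_onD) auto
    moreover have "(1 - t) *\<^sub>R x + t *\<^sub>R y = x + t *\<^sub>R (y - x)" by (simp add: algebra_simps)
    ultimately show "(F (x + t *\<^sub>R (y - x)) - F x) / t \<le> F y - F x"
      using t by (simp add: field_simps)
  qed simp
  ultimately have "(y - x) \<bullet> g x \<le> F y - F x"
    by (intro tendsto_upperbound) auto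
  then show ?thesis by simp
qed

lemma g_monotone: "x \<in> S \<Longrightarrow> y \<in> S \<Longrightarrow> 0 \<le> (y - x) \<bullet> (g y - g x)"
  using F_tangent[of x y] F_tangent[of y x] by (simp add: inner_diff_left inner_diff_right)

lemma G_nonneg: "x \<in> S \<Longrightarrow> 0 \<le> h \<bullet> (G x *v h)"
proof -
  assume x: "x \<in> S"
  have "((\<lambda>t. h \<bullet> g (x + t *\<^sub>R h)) has_real_derivative h \<bullet> (G x *v h)) (at 0)"
    using g_line[of x 0 h h] x by simp
  then have "((\<lambda>t. (h \<bullet> g (x + t *\<^sub>R h) - h \<bullet> g x) / t) \<longlongrightarrow> h \<bullet> (G x *v h)) (at 0)"
    by (simp add: has_field_derivative_iff)
  then have "((\<lambda>t. (h \<bullet> g (x + t *\<^sub>R h) - h \<bullet> g x) / t) \<longlongrightarrow> h \<bullet> (G x *v h)) (at_right 0)"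
    by (rule filterlim_mono) (auto simp: at_le)
  moreover have "((\<lambda>t. x + t *\<^sub>R h) \<longlongrightarrow> x + 0 *\<^sub>R h) (at_right 0)" by (intro tendsto_intros)
  then have "eventually (\<lambda>t. x + t *\<^sub>R h \<in> S) (at_right 0)"
    using S_open x by (auto dest: topological_tendstoD)
  then have "eventually (\<lambda>t. 0 \<le> (h \<bullet> g (x + t *\<^sub>R h) - h \<bullet> g x) / t) (at_right 0)"
    using eventually_at_right_less[of 0]
  proof eventually_elim
    case (elim t)
    then show ?case using g_monotone[OF x, of "x + t *\<^sub>R h"]
      by (simp add: inner_diff_right zero_le_mult_iff flip: right_diff_distrib)
  qed
  ultimately show ?thesis by (intro tendsto_lowerbound) auto
qed

lemma T3_self_concordant: "x \<in> S \<Longrightarrow> \<bar>T3 x h h h\<bar> \<le> 2 * (sqrt (h \<bullet> (G x *v h)))^3"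
proof -
  assume x: "x \<in> S"
  have "\<bar>T3 x h h h\<bar> \<le> 2 * (h \<bullet> (G x *v h)) powr (3/2)"
    using LHSCB x by (metis Dk2[OF x] Dk3[OF x] LHSCB_def)
  also have "(h \<bullet> (G x *v h)) powr (3/2) = (sqrt (h \<bullet> (G x *v h)))^3"
  \<comment> \<open>In a degenerate direction \<open>0 powr (3/2)\<close> is 0, so the two powers
    agree there as well. Nondegeneracy is proved only later, from this very bound.\<close>
  proof (cases "h \<bullet> (G x *v h) = 0")
    case False
    then have a: "h \<bullet> (G x *v h) > 0" using G_nonneg[OF x, of h] by simp
    have "(h \<bullet> (G x *v h)) powr (3/2) = ((h \<bullet> (G x *v h)) powr (1/2)) powr 3"
      by (simp add: powr_powr)
    then show ?thesis using a by (simp add: powr_half_sqrt)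
  qed simp
  finally show ?thesis .
qed

end

section \<open>Self-concordance and the Dikin ellipsoid\<close>

text \<open>The shift \<open>\<eta>\<close> keeps the quotients meaningful where \<open>\<phi>\<close> vanishes; this case is what excludes
  degenerate directions of the Hessian.\<close>

lemma inverse_sqrt_lipschitz:
  fixes \<phi> \<phi>' :: "real \<Rightarrow> real"
  assumes "a \<le> b"
    and "\<And>t. a \<le> t \<Longrightarrow> t \<le> b \<Longrightarrow> (\<phi> has_real_derivative \<phi>' t) (at t)"
    and "\<And>t. a \<le> t \<Longrightarrow> t \<le> b \<Longrightarrow> 0 \<le> \<phi> t \<and> 0 < \<phi> t + \<eta>"
    and "\<And>t. a \<le> t \<Longrightarrow> t \<le> b \<Longrightarrow> \<bar>\<phi>' t\<bar> \<le> 2 * (sqrt (\<phi> t))^3"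
    and "0 \<le> \<eta>"
  shows "\<bar>1 / sqrt (\<phi> b + \<eta>) - 1 / sqrt (\<phi> a + \<eta>)\<bar> \<le> b - a"
proof (cases "a = b")
  case False
  define D where "D t = - \<phi>' t / (2 * (sqrt (\<phi> t + \<eta>))^3)" for t
  have "\<exists>z>a. z < b \<and> 1 / sqrt (\<phi> b + \<eta>) - 1 / sqrt (\<phi> a + \<eta>) = (b - a) * D z"
  proof (rule MVT2)
    fix t assume t: "a \<le> t" "t \<le> b"
    have p: "\<phi> t + \<eta> > 0" using assms(3)[OF t] by simp
    have "((\<lambda>t. 1 / sqrt (\<phi> t + \<eta>)) has_real_derivative
        - (\<phi>' t * (inverse (sqrt (\<phi> t + \<eta>)) / 2)) / (sqrt (\<phi> t + \<eta>))\<^sup>2) (at t)"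
      using p by (auto intro!: derivative_eq_intros assms(2)[OF t] simp: power2_eq_square)
    also have "- (\<phi>' t * (inverse (sqrt (\<phi> t + \<eta>)) / 2)) / (sqrt (\<phi> t + \<eta>))\<^sup>2 = D t"
      using p by (simp add: D_def field_simps power3_eq_cube power2_eq_square)
    finally show "((\<lambda>t. 1 / sqrt (\<phi> t + \<eta>)) has_real_derivative D t) (at t)" .
  qed (use assms False in simp)
  then obtain z where z: "a < z" "z < b"
    and eq: "1 / sqrt (\<phi> b + \<eta>) - 1 / sqrt (\<phi> a + \<eta>) = (b - a) * D z" by blast
  have p: "0 < sqrt (\<phi> z + \<eta>)" using assms(3)[of z] z by simp
  have "\<bar>\<phi>' z\<bar> \<le> 2 * (sqrt (\<phi> z))^3" using assms(4) z by simp
  also have "\<dots> \<le> 2 * (sqrt (\<phi> z + \<eta>))^3"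
    using assms(5) assms(3)[of z] z by (intro mult_left_mono power_mono) auto
  finally have "\<bar>D z\<bar> \<le> 1" using p by (simp add: D_def abs_mult)
  then have "(b - a) * \<bar>D z\<bar> \<le> (b - a) * 1" using assms(1) by (intro mult_left_mono) auto
  then show ?thesis using eq assms(1) by (simp add: abs_mult)
qed simp

context lhscb
begin

abbreviation "nrm x \<equiv> mnorm (G x)"
abbreviation "dnrm x \<equiv> mnorm (matrix_inv (G x))"

section \<open>Points that stay inside the cone\<close>

lemma segment_in_S:
  assumes "x \<in> S" "x + T *\<^sub>R h \<in> S" "0 \<le> t" "t \<le> T"
  shows "x + t *\<^sub>R h \<in> S"
proof (cases "T = 0")
  case False
  then have T: "T > 0" using assms by simp
  have "(1 - t / T) *\<^sub>R x + (t / T) *\<^sub>R (x + T *\<^sub>R h) \<in> S"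
    using assms T by (intro convexD[OF S_convex]) auto
  also have "(1 - t / T) *\<^sub>R x + (t / T) *\<^sub>R (x + T *\<^sub>R h) = x + t *\<^sub>R h"
    using T by (simp add: scaleR_right_distrib scaleR_diff_left)
  finally show ?thesis .
qed (use assms in simp)

text \<open>At the first exit time the segment meets the frontier, where \<open>F\<close> blows up
  along points approaching from inside. Membership in the open cone is thereby reduced to an upper
  bound on \<open>F\<close>, which both uses below obtain by integrating its derivatives.\<close>

lemma barrier_bounded_stays:
  assumes x: "x \<in> S" and B: "\<And>t. 0 \<le> t \<Longrightarrow> t \<le> 1 \<Longrightarrow> x + t *\<^sub>R h \<in> S \<Longrightarrow> F (x + t *\<^sub>R h) \<le> B"
  shows "x + h \<in> S"
proof (rule ccontr)
  assume out: "x + h \<notin> S"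
  define I where "I = {t. 0 \<le> t \<and> t \<le> 1 \<and> x + t *\<^sub>R h \<in> S}"
  define T where "T = Sup I"
  have I0: "0 \<in> I" using x by (simp add: I_def)
  have bdd: "bdd_above I" by (auto simp: I_def bdd_above_def)
  have T: "0 \<le> T" "T \<le> 1" unfolding T_def
    using I0 bdd by (auto intro!: cSup_upper cSup_least simp: I_def)
  have cont: "isCont (\<lambda>t. x + t *\<^sub>R h) T" by (intro continuous_intros)
  have notS: "x + T *\<^sub>R h \<notin> S"
  proof
    assume S: "x + T *\<^sub>R h \<in> S"
    then have "T < 1" using out T by (cases "T = 1") auto
    have "eventually (\<lambda>t. x + t *\<^sub>R h \<in> S) (at T)"
      using cont S S_open unfolding isCont_def by (auto dest: topological_tendstoD)
    then have "eventually (\<lambda>t. x + t *\<^sub>R h \<in> S) (at_right T)"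
      by (auto simp: eventually_at_split)
    moreover have "eventually (\<lambda>t. t < 1) (at_right T)"
      using \<open>T < 1\<close> unfolding eventually_at_right_field by (intro exI[of _ 1]) auto
    moreover have "eventually (\<lambda>t. t > T) (at_right T)" by (rule eventually_at_right_less)
    ultimately have "eventually (\<lambda>t. x + t *\<^sub>R h \<in> S \<and> t < 1 \<and> t > T) (at_right T)"
      by eventually_elim auto
    then obtain t where "x + t *\<^sub>R h \<in> S" "t < 1" "t > T"
      by (auto dest!: eventually_happens simp: trivial_limit_at_right_real)
    then have "t \<in> I" using T by (auto simp: I_def)
    then show False using cSup_upper[OF _ bdd, of t] \<open>t > T\<close> by (simp add: T_def)
  qed
  then have "T > 0" using x T by (cases "T = 0") auto
  have before: "x + t *\<^sub>R h \<in> S" if t: "0 \<le> t" "t < T" for t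
  proof -
    obtain t' where "t' \<in> I" "t < t'" using less_cSupD[of I t] I0 t by (auto simp: T_def)
    then show ?thesis using segment_in_S[OF x, of t' h t] t by (auto simp: I_def)
  qed
  define X where "X i = x + (T - T / real (Suc i)) *\<^sub>R h" for i
  have ti: "0 \<le> T - T / real (Suc i)" "T - T / real (Suc i) < T" for i
    using \<open>T > 0\<close> by (simp_all add: field_simps)
  have "X \<longlonglongrightarrow> x + (T - T * 0) *\<^sub>R h"
    unfolding X_def divide_inverse by (intro tendsto_intros LIMSEQ_inverse_real_of_nat)
  then have lim: "X \<longlonglongrightarrow> x + T *\<^sub>R h" by simp
  have "x + T *\<^sub>R h \<in> closure S"
    unfolding closure_sequential
    by (rule exI[of _ X]) (use lim before ti in \<open>auto simp: X_def\<close>)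
  then have "x + T *\<^sub>R h \<in> frontier K"
    using notS K_closed closure_mono[OF interior_subset, of K] by (auto simp: frontier_def)
  then have "filterlim (\<lambda>i. F (X i)) at_top sequentially"
  proof -
    have "\<forall>i. X i \<in> S" using before ti by (simp add: X_def)
    then show ?thesis using LHSCB lim \<open>x + T *\<^sub>R h \<in> frontier K\<close> unfolding LHSCB_def by metis
  qed
  then have "eventually (\<lambda>i. F (X i) > B) sequentially" by (simp add: filterlim_at_top_dense)
  then obtain i where "F (X i) > B" by (auto dest: eventually_happens)
  moreover have "F (X i) \<le> B"
    unfolding X_def using ti[of i] T before by (intro B) auto
  ultimately show False by simp
qed

text \<open>The points \<open>(x + n h) / n\<close> of the cone converge to
  \<open>h\<close>.\<close>

lemma recession_direction:
  assumes "\<And>t. 0 \<le> t \<Longrightarrow> x + t *\<^sub>R h \<in> K"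
  shows "h \<in> K"
proof -
  define X where "X i = inverse (real (Suc i)) *\<^sub>R (x + real (Suc i) *\<^sub>R h)" for i
  have "X i \<in> K" for i unfolding X_def using assms K_cone by (simp add: mem_cone)
  moreover have "X = (\<lambda>i. inverse (real (Suc i)) *\<^sub>R x + h)"
    by (auto simp: X_def scaleR_right_distrib)
  moreover have "(\<lambda>i. inverse (real (Suc i)) *\<^sub>R x + h) \<longlonglongrightarrow> 0 *\<^sub>R x + h"
    by (intro tendsto_intros LIMSEQ_inverse_real_of_nat)
  ultimately have "X \<longlonglongrightarrow> h" "\<forall>i. X i \<in> K" by simp_all
  then show ?thesis using K_closed unfolding closed_sequential_limits by blast
qed

lemma inverse_norm_lipschitz:
  assumes "x \<in> S" "x + t *\<^sub>R h \<in> S" "0 \<le> t" "0 \<le> \<eta>"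
    and "\<And>r. 0 \<le> r \<Longrightarrow> r \<le> t \<Longrightarrow> 0 < h \<bullet> (G (x + r *\<^sub>R h) *v h) + \<eta>"
  shows "\<bar>1 / sqrt (h \<bullet> (G (x + t *\<^sub>R h) *v h) + \<eta>) - 1 / sqrt (h \<bullet> (G x *v h) + \<eta>)\<bar> \<le> t"
proof -
  note seg = segment_in_S[OF assms(1,2)]
  have "\<bar>1 / sqrt (h \<bullet> (G (x + t *\<^sub>R h) *v h) + \<eta>) - 1 / sqrt (h \<bullet> (G (x + 0 *\<^sub>R h) *v h) + \<eta>)\<bar> \<le> t - 0"
    by (rule inverse_sqrt_lipschitz[of 0 t "\<lambda>t. h \<bullet> (G (x + t *\<^sub>R h) *v h)"
          "\<lambda>t. T3 (x + t *\<^sub>R h) h h h"])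
      (use assms seg G_line T3_self_concordant G_nonneg in auto)
  then show ?thesis by simp
qed

text \<open>Along the line the inverse local norm of \<open>h\<close> is Lipschitz with constant 1,
  so it cannot pass from infinite to finite in finite time. The shift \<open>1/k^2\<close> replaces
  the infinite value at \<open>x\<close> by exactly \<open>k\<close>, and \<open>k\<close> is taken
  larger than the value at the other end plus \<open>t\<close>.\<close>

lemma degenerate_line:
  assumes x: "x \<in> S" and h: "h \<bullet> (G x *v h) = 0" and t: "0 \<le> t" "x + t *\<^sub>R h \<in> S"
  shows "h \<bullet> (G (x + t *\<^sub>R h) *v h) = 0"
proof (rule ccontr)
  let ?p = "h \<bullet> (G (x + t *\<^sub>R h) *v h)"
  assume "?p \<noteq> 0"
  then have p: "?p > 0" using G_nonneg[OF t(2), of h] by simp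
  define k where "k = t + 1 / sqrt ?p + 1"
  have k: "k > 0" using t p by (auto simp: k_def intro!: add_nonneg_pos)
  have "\<bar>1 / sqrt (?p + 1 / k\<^sup>2) - 1 / sqrt (h \<bullet> (G x *v h) + 1 / k\<^sup>2)\<bar> \<le> t"
    using k by (intro inverse_norm_lipschitz x t)
      (auto intro!: add_nonneg_pos G_nonneg segment_in_S[OF x t(2)])
  then have "\<bar>1 / sqrt (?p + 1 / k\<^sup>2) - k\<bar> \<le> t"
    using k by (simp add: h real_sqrt_divide)
  moreover have "1 / sqrt (?p + 1 / k\<^sup>2) \<le> 1 / sqrt ?p"
    using p k by (intro divide_left_mono) (auto intro!: add_pos_pos mult_pos_pos)
  ultimately show False by (simp add: k_def)
qed

text \<open>On a degenerate line the derivative of \<open>F\<close> is constant, so \<open>F\<close>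
  is bounded on bounded pieces and the boundary is never met.\<close>

lemma degenerate_ray:
  assumes x: "x \<in> S" and h: "h \<bullet> (G x *v h) = 0" and t: "0 \<le> t"
  shows "x + t *\<^sub>R h \<in> S"
proof (rule barrier_bounded_stays[OF x])
  fix r assume r: "0 \<le> r" "r \<le> (1::real)" "x + r *\<^sub>R t *\<^sub>R h \<in> S"
  let ?k = "r * t"
  have k: "0 \<le> ?k" "?k \<le> t" "x + ?k *\<^sub>R h \<in> S"
    using r t mult_right_mono[of r 1 t] by auto
  note seg = segment_in_S[OF x k(3)]
  have grad: "h \<bullet> g (x + q *\<^sub>R h) = h \<bullet> g x" if q: "0 \<le> q" "q \<le> ?k" for q
  proof (cases "q = 0")
    case False
    have "\<exists>z>0. z < q \<and> h \<bullet> g (x + q *\<^sub>R h) - h \<bullet> g (x + 0 *\<^sub>R h) = (q - 0) * (h \<bullet> (G (x + z *\<^sub>R h) *v h))"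
      using q False seg by (intro MVT2 g_line) auto
    then obtain z where "0 < z" "z < q" "h \<bullet> g (x + q *\<^sub>R h) - h \<bullet> g x = q * (h \<bullet> (G (x + z *\<^sub>R h) *v h))"
      by auto
    moreover have "h \<bullet> (G (x + z *\<^sub>R h) *v h) = 0"
      using \<open>0 < z\<close> \<open>z < q\<close> q by (intro degenerate_line x h seg) auto
    ultimately show ?thesis by simp
  qed simp
  have "F (x + ?k *\<^sub>R h) - F x \<le> ?k * (h \<bullet> g x)"
  proof (cases "?k = 0")
    case False
    have "\<exists>z>0. z < ?k \<and> F (x + ?k *\<^sub>R h) - F (x + 0 *\<^sub>R h) = (?k - 0) * (h \<bullet> g (x + z *\<^sub>R h))"
      using k False seg less_le[of 0 ?k] by (intro MVT2 F_line) metis+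
    then show ?thesis using grad by auto
  qed auto
  also have "\<dots> \<le> t * \<bar>h \<bullet> g x\<bar>"
    by (rule order_trans[OF mult_left_mono[OF abs_ge_self k(1)] mult_right_mono[OF k(2)]]) simp
  finally show "F (x + r *\<^sub>R t *\<^sub>R h) \<le> F x + t * \<bar>h \<bullet> g x\<bar>" by simp
qed

text \<open>For a null vector \<open>v\<close> both \<open>v\<close> and \<open>- v\<close> are
  directions of recession, which pointedness excludes unless \<open>v = 0\<close>.\<close>

lemma G_spd: "x \<in> S \<Longrightarrow> spd (G x)"
proof -
  assume x: "x \<in> S"
  have "v = 0" if v: "v \<bullet> (G x *v v) = 0" for v
  proof (rule K_pointed)
    have "(- v) \<bullet> (G x *v (- v)) = 0" using v matrix_vector_mult_scaleR[of "G x" "-1" v] by simp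
    then show "v \<in> K" "- v \<in> K"
      using degenerate_ray[OF x] v S_sub by (blast intro: recession_direction)+
  qed
  then show ?thesis using G_nonneg[OF x] G_sym[OF x] unfolding spd_def by (metis less_eq_real_def)
qed

lemma nrm_nonneg [simp]: "x \<in> S \<Longrightarrow> 0 \<le> nrm x v"
  by (simp add: G_spd)

lemma dnrm_nonneg [simp]: "x \<in> S \<Longrightarrow> 0 \<le> dnrm x v"
  by (simp add: G_spd spd_matrix_inv)

section \<open>Local norms along a line and the Dikin ellipsoid\<close>

lemma nrm_lipschitz:
  assumes "x \<in> S" "x + t *\<^sub>R h \<in> S" "0 \<le> t" "h \<noteq> 0"
  shows "\<bar>1 / nrm (x + t *\<^sub>R h) h - 1 / nrm x h\<bar> \<le> t"
  using inverse_norm_lipschitz[OF assms(1-3), of 0] assms spd_pos[OF G_spd[OF segment_in_S[OF assms(1,2)]]]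
  by (simp add: mnorm_def)

lemma nrm_line_upper:
  assumes "x \<in> S" "x + t *\<^sub>R h \<in> S" "0 \<le> t" "t * nrm x h < 1"
  shows "nrm (x + t *\<^sub>R h) h \<le> nrm x h / (1 - t * nrm x h)"
proof (cases "h = 0")
  case False
  have p: "nrm x h > 0" "nrm (x + t *\<^sub>R h) h > 0" using assms False by (auto intro: mnorm_pos G_spd)
  have "1 / nrm (x + t *\<^sub>R h) h \<ge> 1 / nrm x h - t" using nrm_lipschitz[OF assms(1-3) False] by linarith
  moreover have "1 / nrm x h - t = (1 - t * nrm x h) / nrm x h" using p by (simp add: field_simps)
  ultimately show ?thesis using p assms(4) by (simp add: field_simps)
qed simp

lemma nrm_line_lower:
  assumes "x \<in> S" "x + t *\<^sub>R h \<in> S" "0 \<le> t"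
  shows "nrm x h / (1 + t * nrm x h) \<le> nrm (x + t *\<^sub>R h) h"
proof (cases "h = 0")
  case False
  have p: "nrm x h > 0" "nrm (x + t *\<^sub>R h) h > 0" using assms False by (auto intro: mnorm_pos G_spd)
  have "1 / nrm (x + t *\<^sub>R h) h \<le> 1 / nrm x h + t" using nrm_lipschitz[OF assms(1-3) False] by linarith
  moreover have "1 / nrm x h + t = (1 + t * nrm x h) / nrm x h" using p by (simp add: field_simps)
  moreover have "1 + t * nrm x h > 0" using p assms(3) by (simp add: add_pos_nonneg)
  ultimately show ?thesis using p by (simp add: field_simps)
qed simp

text \<open>With \<open>r\<close> the local norm of \<open>h\<close> at \<open>x\<close>, its local
  norm along the segment is at most \<open>r / (1 - r)\<close>. Two integrations then bound
  \<open>F\<close>, so the segment cannot leave \<open>S\<close>.\<close>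

lemma dikin:
  assumes x: "x \<in> S" and r: "nrm x h < 1"
  shows "x + h \<in> S"
proof (rule barrier_bounded_stays[OF x])
  fix t assume t: "0 \<le> t" "t \<le> (1::real)" "x + t *\<^sub>R h \<in> S"
  note seg = segment_in_S[OF x t(3)]
  define r where "r = nrm x h"
  define B where "B = (r / (1 - r))\<^sup>2"
  have r01: "0 \<le> r" "r < 1" using x r by (simp_all add: r_def)
  have hess: "h \<bullet> (G (x + q *\<^sub>R h) *v h) \<le> B" if q: "0 \<le> q" "q \<le> t" for q
  proof -
    have qr: "q * r \<le> r" using q t r01 by (simp add: mult_left_le_one_le)
    then have "nrm (x + q *\<^sub>R h) h \<le> r / (1 - q * r)"
      unfolding r_def using q seg r by (intro nrm_line_upper x) (auto simp: r_def)
    also have "\<dots> \<le> r / (1 - r)" using r01 qr by (intro divide_left_mono) auto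
    finally have "(nrm (x + q *\<^sub>R h) h)\<^sup>2 \<le> B"
      unfolding B_def using q seg by (intro power_mono) auto
    then show ?thesis using q seg by (simp add: mnorm_sq G_spd)
  qed
  have grad: "h \<bullet> g (x + q *\<^sub>R h) \<le> \<bar>h \<bullet> g x\<bar> + B" if q: "0 \<le> q" "q \<le> t" for q
  proof (cases "q = 0")
    case False
    have "\<exists>z>0. z < q \<and> h \<bullet> g (x + q *\<^sub>R h) - h \<bullet> g (x + 0 *\<^sub>R h) = (q - 0) * (h \<bullet> (G (x + z *\<^sub>R h) *v h))"
      using q False seg by (intro MVT2 g_line) auto
    then obtain z where z: "0 < z" "z < q" "h \<bullet> g (x + q *\<^sub>R h) - h \<bullet> g x = q * (h \<bullet> (G (x + z *\<^sub>R h) *v h))"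
      by auto
    moreover have "q * (h \<bullet> (G (x + z *\<^sub>R h) *v h)) \<le> 1 * B"
      using z q t hess[of z] by (intro mult_mono) (auto intro!: G_nonneg seg)
    ultimately show ?thesis by simp
  qed (simp add: B_def add_increasing2)
  show "F (x + t *\<^sub>R h) \<le> F x + (\<bar>h \<bullet> g x\<bar> + B)"
  proof (cases "t = 0")
    case False
    have "\<exists>z>0. z < t \<and> F (x + t *\<^sub>R h) - F (x + 0 *\<^sub>R h) = (t - 0) * (h \<bullet> g (x + z *\<^sub>R h))"
      using t False seg by (intro MVT2 F_line) auto
    then obtain z where z: "0 < z" "z < t" "F (x + t *\<^sub>R h) - F x = t * (h \<bullet> g (x + z *\<^sub>R h))" by auto
    have "t * (h \<bullet> g (x + z *\<^sub>R h)) \<le> t * (\<bar>h \<bullet> g x\<bar> + B)"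
      using grad[of z] z t by (intro mult_left_mono) auto
    also have "\<dots> \<le> 1 * (\<bar>h \<bullet> g x\<bar> + B)"
      using t by (intro mult_right_mono) (auto simp: B_def)
    finally show ?thesis using z by simp
  qed (simp add: B_def)
qed

end

section \<open>Comparison of local norms, homogeneity\<close>

lemma mnorm_continuous: "continuous_on A (mnorm W)"
  unfolding mnorm_def
  by (intro continuous_intros bounded_linear.continuous_on[OF matrix_vector_mul_bounded_linear])

context lhscb
begin

text \<open>Along the segment the form \<open>q\<close> satisfies
  \<open>|q'| \<le> (5/2) r q / (1 - t r)\<close>, where 5/2 is 2 from self-concordance times 5/4
  from \<open>cubic_form_bound\<close>. Hence \<open>q (1 - t r)^(5/2)\<close> decreases and
  \<open>q / (1 - t r)^(5/2)\<close> increases; both are squared to have integer exponents. The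
  condition on \<open>\<omega>\<close> says \<open>1 + \<omega> \<ge> (1 - R)^(-5/2)\<close> in a
  form that arithmetic on numerals can decide.\<close>

lemma hess_compare:
  assumes x: "x \<in> S" and y: "nrm x (y - x) \<le> R" "R < 1"
    and \<omega>: "0 \<le> \<omega>" "1 \<le> (1 + \<omega>)\<^sup>2 * (1 - R)^5"
  shows "y \<in> S" "u \<bullet> (G y *v u) \<le> (1 + \<omega>) * (u \<bullet> (G x *v u))"
    "u \<bullet> (G x *v u) \<le> (1 + \<omega>) * (u \<bullet> (G y *v u))"
proof -
  define h where "h = y - x"
  define r where "r = nrm x h"
  have r: "0 \<le> r" "r \<le> R" "r < 1" using assms by (auto simp: r_def h_def)
  have y_eq: "y = x + 1 *\<^sub>R h" by (simp add: h_def)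
  show yS: "y \<in> S" using dikin[OF x, of h] r by (simp add: r_def h_def)
  have seg: "x + t *\<^sub>R h \<in> S" if "0 \<le> t" "t \<le> 1" for t
    using segment_in_S[OF x, of 1 h t] yS y_eq that by simp
  define q where "q t = u \<bullet> (G (x + t *\<^sub>R h) *v u)" for t
  define q' where "q' t = T3 (x + t *\<^sub>R h) u u h" for t
  have q: "(q has_real_derivative q' t) (at t)" and q0: "0 \<le> q t"
    and q'b: "\<bar>q' t\<bar> * (1 - t * r) \<le> 5/2 * r * q t" and tr: "0 < 1 - t * r"
    if t: "0 \<le> t" "t \<le> 1" for t
  proof -
    show "(q has_real_derivative q' t) (at t)"
      unfolding q_def q'_def by (intro G_line seg t)
    show q0: "0 \<le> q t" unfolding q_def by (intro G_nonneg seg t)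
    have "t * r \<le> r" using t r by (simp add: mult_left_le_one_le)
    then show tr: "0 < 1 - t * r" using r by simp
    let ?x = "x + t *\<^sub>R h"
    have "\<bar>T3 ?x u u h\<bar> \<le> 5/4 * 2 * (nrm ?x u)\<^sup>2 * nrm ?x h"
      using seg[OF t] T3_self_concordant[OF seg[OF t]]
      by (intro cubic_form_bound T3_linear T3_sym1 T3_sym2 G_spd) (auto simp: mnorm_def)
    also have "(nrm ?x u)\<^sup>2 = q t" using seg[OF t] by (simp add: mnorm_sq G_spd q_def)
    also have "5/4 * 2 * q t * nrm ?x h \<le> 5/4 * 2 * q t * (r / (1 - t * r))"
      using q0 nrm_line_upper[OF x seg[OF t]] t tr by (intro mult_left_mono) (auto simp: r_def)
    finally have "\<bar>q' t\<bar> \<le> 5/2 * q t * r / (1 - t * r)" by (simp add: q'_def)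
    then show "\<bar>q' t\<bar> * (1 - t * r) \<le> 5/2 * r * q t" using tr by (simp add: field_simps)
  qed
  have "(q 1)\<^sup>2 * (1 - 1 * r)^5 \<le> (q 0)\<^sup>2 * (1 - 0 * r)^5"
  proof (rule DERIV_nonpos_imp_nonincreasing[of 0 1 "\<lambda>t. (q t)\<^sup>2 * (1 - t * r)^5"])
    fix t :: real assume t: "0 \<le> t" "t \<le> 1"
    let ?D = "q t * (1 - t * r)^4 * (2 * (q' t * (1 - t * r) - 5/2 * r * q t))"
    have "((\<lambda>t. (q t)\<^sup>2 * (1 - t * r)^5) has_real_derivative ?D) (at t)"
      by (auto intro!: derivative_eq_intros q t simp: algebra_simps power2_eq_square eval_nat_numeral)
    moreover have "?D \<le> 0"
    proof (rule mult_nonneg_nonpos)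
      have "q' t * (1 - t * r) \<le> \<bar>q' t\<bar> * (1 - t * r)" using tr[OF t] by (intro mult_right_mono) auto
      then show "2 * (q' t * (1 - t * r) - 5/2 * r * q t) \<le> 0" using q'b[OF t] by simp
    qed (use q0[OF t] in simp)
    ultimately show "\<exists>y. ((\<lambda>t. (q t)\<^sup>2 * (1 - t * r)^5) has_real_derivative y) (at t) \<and> y \<le> 0" by blast
  qed simp
  then have up: "(q 1)\<^sup>2 * (1 - r)^5 \<le> (q 0)\<^sup>2" by simp
  have "(q 0)\<^sup>2 / (1 - 0 * r)^5 \<le> (q 1)\<^sup>2 / (1 - 1 * r)^5"
  proof (rule DERIV_nonneg_imp_nondecreasing[of 0 1 "\<lambda>t. (q t)\<^sup>2 / (1 - t * r)^5"])
    fix t :: real assume t: "0 \<le> t" "t \<le> 1"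
    define d where "d = 1 - t * r"
    have d: "d > 0" using tr[OF t] by (simp add: d_def)
    let ?D = "(2 * q t * q' t * d^5 - (5 * d^4 * (- r)) * (q t)\<^sup>2) / (d^5 * d^5)"
    have "((\<lambda>t. (q t)\<^sup>2) has_real_derivative 2 * q t * q' t) (at t)"
      "((\<lambda>t. (1 - t * r)^5) has_real_derivative 5 * d^4 * (- r)) (at t)"
      by (auto intro!: derivative_eq_intros q t simp: d_def)
    from DERIV_divide[OF this]
    have "((\<lambda>t. (q t)\<^sup>2 / (1 - t * r)^5) has_real_derivative ?D) (at t)"
      using d unfolding d_def[symmetric] by (simp add: mult.commute[of "q t ^ 2"])
    moreover have num: "2 * q t * q' t * d^5 - (5 * d^4 * (- r)) * (q t)\<^sup>2
        = q t * d^4 * (2 * (q' t * d + 5/2 * r * q t))"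
      by (simp add: algebra_simps power2_eq_square eval_nat_numeral)
    moreover have "0 \<le> ?D"
      unfolding num
    proof (intro divide_nonneg_nonneg mult_nonneg_nonneg)
      have "- (q' t * d) \<le> \<bar>q' t\<bar> * d"
        using mult_right_mono[OF abs_ge_minus_self[of "q' t"], of d] d by simp
      then show "0 \<le> q' t * d + 5/2 * r * q t" using q'b[OF t] by (simp add: d_def)
    qed (use q0[OF t] d in simp_all)
    ultimately show "\<exists>y. ((\<lambda>t. (q t)\<^sup>2 / (1 - t * r)^5) has_real_derivative y) (at t) \<and> 0 \<le> y"
      by blast
  qed simp
  then have "(q 0)\<^sup>2 \<le> (q 1)\<^sup>2 / (1 - r)^5" by simp
  moreover have r5: "0 < (1 - r)^5" using r by simp
  ultimately have lo: "(q 0)\<^sup>2 * (1 - r)^5 \<le> (q 1)\<^sup>2" by (simp add: field_simps)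
  have "(1 - R)^5 \<le> (1 - r)^5" using r y(2) by (intro power_mono) auto
  then have w: "1 \<le> (1 + \<omega>)\<^sup>2 * (1 - r)^5"
    using \<omega>(2) order_trans mult_left_mono zero_le_power2 by metis
  have *: "a \<le> (1 + \<omega>) * b" if "a\<^sup>2 * (1 - r)^5 \<le> b\<^sup>2" "0 \<le> b" for a b
  proof (rule power2_le_imp_le)
    have "a\<^sup>2 \<le> a\<^sup>2 * ((1 + \<omega>)\<^sup>2 * (1 - r)^5)" using mult_left_mono[OF w, of "a\<^sup>2"] by simp
    also have "\<dots> = (1 + \<omega>)\<^sup>2 * (a\<^sup>2 * (1 - r)^5)" by (simp add: ac_simps)
    also have "\<dots> \<le> (1 + \<omega>)\<^sup>2 * b\<^sup>2" using that by (intro mult_left_mono) auto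
    finally show "a\<^sup>2 \<le> ((1 + \<omega>) * b)\<^sup>2" by (simp add: power_mult_distrib)
  qed (use that \<omega> in auto)
  have q01: "q 0 = u \<bullet> (G x *v u)" "q 1 = u \<bullet> (G y *v u)" by (simp_all add: q_def y_eq)
  show "u \<bullet> (G y *v u) \<le> (1 + \<omega>) * (u \<bullet> (G x *v u))" "u \<bullet> (G x *v u) \<le> (1 + \<omega>) * (u \<bullet> (G y *v u))"
    using *[OF up q0] *[OF lo q0] q01 by auto
qed

lemma nrm_compare:
  assumes "x \<in> S" "nrm x (y - x) \<le> R" "R < 1" "0 \<le> \<omega>" "1 \<le> (1 + \<omega>)\<^sup>2 * (1 - R)^5" "1 + \<omega> \<le> k\<^sup>2" "0 \<le> k"
  shows "nrm y u \<le> k * nrm x u" "nrm x u \<le> k * nrm y u"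
    "dnrm x u \<le> k * dnrm y u" "dnrm y u \<le> k * dnrm x u"
proof -
  note h = hess_compare[OF assms(1-5)]
  have *: "nrm a v \<le> k * nrm b v" if "v \<bullet> (G a *v v) \<le> (1 + \<omega>) * (v \<bullet> (G b *v v))" "b \<in> S" for a b v
  proof -
    have "v \<bullet> (G a *v v) \<le> k\<^sup>2 * (v \<bullet> (G b *v v))"
      using that(1) mult_right_mono[OF assms(6) G_nonneg[OF that(2), of v]] by linarith
    then have "sqrt (v \<bullet> (G a *v v)) \<le> sqrt (k\<^sup>2 * (v \<bullet> (G b *v v)))" by (rule real_sqrt_le_mono)
    then show ?thesis using assms(7) by (simp add: mnorm_def real_sqrt_mult)
  qed
  have 1: "nrm y v \<le> k * nrm x v" and 2: "nrm x v \<le> k * nrm y v" for v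
    using *[OF h(2) assms(1)] *[OF h(3) h(1)] by auto
  show "nrm y u \<le> k * nrm x u" "nrm x u \<le> k * nrm y u" using 1 2 by auto
  show "dnrm x u \<le> k * dnrm y u" "dnrm y u \<le> k * dnrm x u"
    using mnorm_inv_mono[OF G_spd[OF h(1)] G_spd[OF assms(1)] 1]
      mnorm_inv_mono[OF G_spd[OF assms(1)] G_spd[OF h(1)] 2] by auto
qed

text \<open>By the mean value theorem the remainder, tested against \<open>u\<close>, is a value of
  the difference between the Hessian at some point of the segment and the one at \<open>c\<close>.
  \<open>hess_compare\<close> bounds this difference on the diagonal,
  \<open>symmetric_form_bound\<close> elsewhere.\<close>

lemma grad_linearization:
  assumes c: "c \<in> S" and y: "nrm c (y - c) \<le> R" "nrm c (y' - c) \<le> R" "R < 1"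
    and \<omega>: "0 \<le> \<omega>" "1 \<le> (1 + \<omega>)\<^sup>2 * (1 - R)^5"
  shows "dnrm c (g y - g y' - G c *v (y - y')) \<le> \<omega> * nrm c (y - y')"
proof (rule mnorm_inv_leI[OF G_spd[OF c]])
  fix u
  define v where "v = y - y'"
  have near: "nrm c (y' + t *\<^sub>R v - c) \<le> R" if "0 \<le> t" "t \<le> 1" for t
  proof -
    have "y' + t *\<^sub>R v - c = (1 - t) *\<^sub>R (y' - c) + t *\<^sub>R (y - c)" by (simp add: v_def algebra_simps)
    then show ?thesis using mnorm_convex[OF G_spd[OF c] y(2,1) that] by simp
  qed
  note cmp = hess_compare[OF c near y(3) \<omega>]
  have "\<exists>z>0. z < 1 \<and> (u \<bullet> g (y' + 1 *\<^sub>R v) - 1 * (u \<bullet> (G c *v v))) - (u \<bullet> g (y' + 0 *\<^sub>R v) - 0 * (u \<bullet> (G c *v v)))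
    = (1 - 0) * (u \<bullet> (G (y' + z *\<^sub>R v) *v v) - 1 * (u \<bullet> (G c *v v)))"
    by (intro MVT2 DERIV_diff g_line cmp(1)) (auto intro!: derivative_eq_intros)
  then obtain z where z: "0 < z" "z < 1"
    and eq: "u \<bullet> (g y - g y' - G c *v (y - y')) = u \<bullet> ((G (y' + z *\<^sub>R v) - G c) *v v)"
    by (auto simp: v_def inner_diff_right matrix_vector_mult_diff_rdistrib)
  define B where "B = G (y' + z *\<^sub>R v) - G c"
  have zS: "y' + z *\<^sub>R v \<in> S" using cmp(1) z by simp
  have "\<bar>u \<bullet> (B *v v)\<bar> \<le> \<omega> * nrm c u * nrm c v"
  proof (rule symmetric_form_bound[OF G_spd[OF c]])
    show "a \<bullet> (B *v b) = b \<bullet> (B *v a)" for a b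
      by (simp add: B_def matrix_vector_mult_diff_rdistrib inner_diff_right G_sym[OF zS, of a b] G_sym[OF c, of a b])
    fix w
    let ?a = "w \<bullet> (G (y' + z *\<^sub>R v) *v w)" and ?b = "w \<bullet> (G c *v w)"
    have 1: "?a \<le> (1 + \<omega>) * ?b" "?b \<le> (1 + \<omega>) * ?a" using cmp(2,3) z by auto
    \<comment> \<open>This is \<open>1 / (1 + \<omega>) \<ge> 1 - \<omega>\<close>, done without
      division.\<close>
    have "?b - \<omega> * ?b \<le> ?a"
    proof (cases "?a \<le> ?b")
      case True
      then have "\<omega> * ?a \<le> \<omega> * ?b" using \<omega>(1) by (rule mult_left_mono)
      then show ?thesis using 1(2) by (simp add: algebra_simps)
    next
      case False
      moreover have "0 \<le> \<omega> * ?b" using \<omega>(1) G_nonneg[OF c] by simp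
      ultimately show ?thesis by linarith
    qed
    then have "\<bar>?a - ?b\<bar> \<le> \<omega> * ?b" using 1(1) by (simp add: algebra_simps abs_le_iff)
    then show "\<bar>w \<bullet> (B *v w)\<bar> \<le> \<omega> * (nrm c w)\<^sup>2"
      by (simp add: B_def mnorm_sq[OF G_spd[OF c]] matrix_vector_mult_diff_rdistrib inner_diff_right)
  qed
  then show "\<bar>u \<bullet> (g y - g y' - G c *v (y - y'))\<bar> \<le> \<omega> * nrm c (y - y') * nrm c u"
    by (simp add: eq B_def v_def ac_simps)
qed

text \<open>At parameter \<open>t\<close> the local norm of \<open>h\<close> is at least
  \<open>r / (1 + t r)\<close>, with \<open>r\<close> its value at \<open>x\<close>, and the square
  of this quotient is minus its own derivative. So the right-hand side is nondecreasing in
  \<open>t\<close>, which bounds the growth of the gradient from below.\<close>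

lemma grad_growth:
  assumes "x \<in> S" "x + t *\<^sub>R h \<in> S" "0 \<le> t"
  shows "h \<bullet> g x + nrm x h \<le> h \<bullet> g (x + t *\<^sub>R h) + nrm x h / (1 + t * nrm x h)"
proof -
  define r where "r = nrm x h"
  have r: "0 \<le> r" using assms by (simp add: r_def)
  note seg = segment_in_S[OF assms(1,2)]
  have "h \<bullet> g (x + 0 *\<^sub>R h) + r / (1 + 0 * r) \<le> h \<bullet> g (x + t *\<^sub>R h) + r / (1 + t * r)"
  proof (rule DERIV_nonneg_imp_nondecreasing[of 0 t "\<lambda>t. h \<bullet> g (x + t *\<^sub>R h) + r / (1 + t * r)"])
    fix q assume q: "0 \<le> q" "q \<le> t"
    have p: "0 < 1 + q * r" using q r by (simp add: add_pos_nonneg)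
    have "((\<lambda>t. h \<bullet> g (x + t *\<^sub>R h) + r / (1 + t * r)) has_real_derivative
        h \<bullet> (G (x + q *\<^sub>R h) *v h) + - (r * r) / ((1 + q * r) * (1 + q * r))) (at q)"
      using p by (intro DERIV_add g_line seg q) (auto intro!: derivative_eq_intros)
    moreover have "(r / (1 + q * r))\<^sup>2 \<le> (nrm (x + q *\<^sub>R h) h)\<^sup>2"
      using nrm_line_lower[OF assms(1) seg[OF q] q(1)] p r by (intro power_mono) (auto simp: r_def)
    then have "0 \<le> h \<bullet> (G (x + q *\<^sub>R h) *v h) + - (r * r) / ((1 + q * r) * (1 + q * r))"
      using mnorm_sq[OF G_spd[OF seg[OF q]], of h] by (simp add: power2_eq_square)
    ultimately show "\<exists>y. ((\<lambda>t. h \<bullet> g (x + t *\<^sub>R h) + r / (1 + t * r)) has_real_derivative y) (at q) \<and> 0 \<le> y"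
      by blast
  qed (rule assms(3))
  then show ?thesis by (simp add: r_def)
qed

text \<open>A quantitative inverse function theorem for \<open>g\<close>: with \<open>r\<close> the
  distance, \<open>grad_growth\<close> and Cauchy give \<open>r^2 / (1 + r) \<le> r \<rho>\<close>.
  It locates points of which only the gradient is known, such as \<open>dual_point s\<close>, and at
  \<rho> = 0 it is injectivity.\<close>

lemma nrm_diff_le_grad_diff:
  assumes "x \<in> S" "y \<in> S" "dnrm x (g y - g x) \<le> \<rho>" "\<rho> < 1"
  shows "nrm x (y - x) \<le> \<rho> / (1 - \<rho>)"
proof -
  define r where "r = nrm x (y - x)"
  have r0: "0 \<le> r" and \<rho>0: "0 \<le> \<rho>"
    using assms order_trans[OF dnrm_nonneg[OF assms(1), of "g y - g x"] assms(3)] by (simp_all add: r_def)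
  have "r - r / (1 + r) \<le> (y - x) \<bullet> (g y - g x)"
    using grad_growth[of x 1 "y - x"] assms by (simp add: r_def inner_diff_right)
  also have "\<dots> \<le> r * dnrm x (g y - g x)"
    unfolding r_def using mnorm_dual_cauchy[OF G_spd[OF assms(1)]] abs_le_D1 by blast
  also have "\<dots> \<le> r * \<rho>" using assms(3) r0 by (rule mult_left_mono)
  finally have le: "r - r / (1 + r) \<le> r * \<rho>" .
  have "r \<le> \<rho> * (1 + r)"
  proof (cases "r = 0")
    case False
    then have "r > 0" using r0 by simp
    have "r * (r / (1 + r)) = r - r / (1 + r)" using r0 by (simp add: field_simps)
    with le have "r / (1 + r) \<le> \<rho>" using \<open>r > 0\<close> by (metis mult_le_cancel_left_pos)
    then show ?thesis using r0 by (simp add: divide_le_eq)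
  qed (use \<rho>0 in simp)
  then show ?thesis using assms(4) by (simp add: r_def[symmetric] field_simps)
qed

lemma inj_g: "x \<in> S \<Longrightarrow> y \<in> S \<Longrightarrow> g x = g y \<Longrightarrow> x = y"
  using nrm_diff_le_grad_diff[of x y 0] mnorm_pos[OF G_spd, of x "y - x"] by fastforce

section \<open>Logarithmic homogeneity and the dual cone\<close>

lemma scale_in_S: "x \<in> S \<Longrightarrow> 0 < t \<Longrightarrow> t *\<^sub>R x \<in> S"
proof -
  assume x: "x \<in> S" and t: "0 < t"
  have "(*\<^sub>R) t ` S \<subseteq> S"
    using t K_cone S_sub by (intro interior_maximal open_scaling S_open) (auto simp: mem_cone)
  then show ?thesis using x by auto
qed

lemma add_in_S: "x \<in> S \<Longrightarrow> v \<in> K \<Longrightarrow> x + v \<in> S"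
proof -
  assume x: "x \<in> S" and v: "v \<in> K"
  have "v + y \<in> K" if "y \<in> K" for y
    using v that K_cone K_convex convex_cone[of K] by blast
  then have "(+) v ` S \<subseteq> S"
    using S_sub by (intro interior_maximal open_translation S_open) auto
  then show ?thesis using x by (auto simp: add.commute)
qed

lemma F_scale: "x \<in> S \<Longrightarrow> 0 < t \<Longrightarrow> F (t *\<^sub>R x) = F x - \<theta> * ln t"
  using LHSCB by (simp add: LHSCB_def)

text \<open>\<open>F (t y)\<close> is differentiated at \<open>x\<close> in two ways, by the chain
  rule and by homogeneity; \<open>G_scale\<close> does the same with \<open>g\<close>.\<close>

lemma g_scale:
  assumes x: "x \<in> S" and t: "0 < t"
  shows "g (t *\<^sub>R x) = (1 / t) *\<^sub>R g x"
proof -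
  have "((\<lambda>y. F (t *\<^sub>R y)) has_derivative (\<lambda>h. (t *\<^sub>R h) \<bullet> g (t *\<^sub>R x))) (at x)"
    by (rule has_derivative_compose[where f = "\<lambda>y. t *\<^sub>R y" and g = F, OF _ F_has_derivative[OF scale_in_S[OF x t]]])
      (auto intro!: derivative_eq_intros)
  moreover have "((\<lambda>y. F (t *\<^sub>R y)) has_derivative (\<lambda>h. h \<bullet> g x)) (at x)"
    by (rule has_derivative_transform_within_open[OF _ S_open x, of "\<lambda>y. F y - \<theta> * ln t"])
      (auto intro!: derivative_eq_intros F_has_derivative x simp: F_scale t)
  ultimately have "(\<lambda>h. (t *\<^sub>R h) \<bullet> g (t *\<^sub>R x)) = (\<lambda>h. h \<bullet> g x)" by (rule has_derivative_unique)
  then have "\<And>h. h \<bullet> (t *\<^sub>R g (t *\<^sub>R x)) = h \<bullet> g x" by (simp add: fun_eq_iff)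
  then have "t *\<^sub>R g (t *\<^sub>R x) = g x" by (metis vector_eq_rdot inner_commute)
  then show ?thesis using t by (metis divideR_right inverse_eq_divide less_irrefl)
qed

lemma G_scale:
  assumes x: "x \<in> S" and t: "0 < t"
  shows "G (t *\<^sub>R x) *v h = (1 / t\<^sup>2) *\<^sub>R (G x *v h)"
proof -
  have "((\<lambda>y. g (t *\<^sub>R y)) has_derivative (\<lambda>h. G (t *\<^sub>R x) *v (t *\<^sub>R h))) (at x)"
    by (rule has_derivative_compose[where f = "\<lambda>y. t *\<^sub>R y" and g = g, OF _ g_has_derivative[OF scale_in_S[OF x t]]])
      (auto intro!: derivative_eq_intros)
  moreover have "((\<lambda>y. g (t *\<^sub>R y)) has_derivative (\<lambda>h. (1 / t) *\<^sub>R (G x *v h))) (at x)"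
    by (rule has_derivative_transform_within_open[OF _ S_open x, of "\<lambda>y. (1 / t) *\<^sub>R g y"])
      (auto intro!: has_derivative_scaleR_right g_has_derivative x simp: g_scale t)
  ultimately have "(\<lambda>h. G (t *\<^sub>R x) *v (t *\<^sub>R h)) = (\<lambda>h. (1 / t) *\<^sub>R (G x *v h))"
    by (rule has_derivative_unique)
  then have "t *\<^sub>R (G (t *\<^sub>R x) *v h) = (1 / t) *\<^sub>R (G x *v h)"
    by (metis matrix_vector_mult_scaleR)
  then have "(1 / t) *\<^sub>R (t *\<^sub>R (G (t *\<^sub>R x) *v h)) = (1 / t) *\<^sub>R (1 / t) *\<^sub>R (G x *v h)" by simp
  then show ?thesis using t by (simp add: power2_eq_square)
qed

lemma dnrm_scale:
  assumes x: "x \<in> S" and t: "0 < t"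
  shows "dnrm (t *\<^sub>R x) w = t * dnrm x w"
proof -
  let ?P = "matrix_inv (G x)" and ?Q = "matrix_inv (G (t *\<^sub>R x))"
  have "G (t *\<^sub>R x) *v (t\<^sup>2 *\<^sub>R (?P *v w)) = w"
    using t by (simp add: G_scale[OF x t] spd_invertible G_spd x matrix_vector_mult_scaleR)
  then have "?Q *v w = t\<^sup>2 *\<^sub>R (?P *v w)"
    by (metis spd_invertible(2) G_spd scale_in_S x t)
  then show ?thesis using t by (simp add: mnorm_def real_sqrt_mult)
qed

lemma inner_g_self: "x \<in> S \<Longrightarrow> x \<bullet> g x = - \<theta>"
proof -
  assume x: "x \<in> S"
  have "((\<lambda>t. F (x + t *\<^sub>R x)) has_real_derivative x \<bullet> g x) (at 0)"
    using F_line[of x 0 x] x by simp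
  moreover have "((\<lambda>t. F (x + t *\<^sub>R x)) has_real_derivative - \<theta>) (at 0)"
  proof (rule has_field_derivative_transform_within_open)
    show "((\<lambda>t. F x - \<theta> * ln (1 + t)) has_real_derivative - \<theta>) (at 0)"
      by (auto intro!: derivative_eq_intros)
    show "F x - \<theta> * ln (1 + t) = F (x + t *\<^sub>R x)" if "t \<in> {-1<..}" for t
      using F_scale[OF x, of "1 + t"] that by (simp add: algebra_simps)
  qed auto
  ultimately show ?thesis by (rule DERIV_unique)
qed

lemma G_self: "x \<in> S \<Longrightarrow> G x *v x = - g x"
proof -
  assume x: "x \<in> S"
  have "u \<bullet> (G x *v x) = u \<bullet> (- g x)" for u
  proof -
    have "((\<lambda>t. u \<bullet> g (x + t *\<^sub>R x)) has_real_derivative u \<bullet> (G x *v x)) (at 0)"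
      using g_line[of x 0 x u] x by simp
    moreover have "((\<lambda>t. u \<bullet> g (x + t *\<^sub>R x)) has_real_derivative u \<bullet> (- g x)) (at 0)"
    proof (rule has_field_derivative_transform_within_open)
      show "((\<lambda>t. (u \<bullet> g x) / (1 + t)) has_real_derivative u \<bullet> (- g x)) (at 0)"
        by (auto intro!: derivative_eq_intros)
      show "(u \<bullet> g x) / (1 + t) = u \<bullet> g (x + t *\<^sub>R x)" if "t \<in> {-1<..}" for t
        using g_scale[OF x, of "1 + t"] that by (simp add: algebra_simps)
    qed auto
    ultimately show ?thesis by (rule DERIV_unique)
  qed
  then show ?thesis by (metis vector_eq_rdot inner_commute)
qed

lemma nrm_self: "x \<in> S \<Longrightarrow> nrm x x = sqrt \<theta>"
  by (simp add: mnorm_def G_self inner_g_self)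

lemma dnrm_g: "x \<in> S \<Longrightarrow> dnrm x (g x) = sqrt \<theta>"
  using mnorm_inv_mult[OF G_spd, of x x] by (simp add: G_self nrm_self)

text \<open>For an interior direction \<open>y\<close>, a positive derivative would make
  \<open>F\<close> grow at least linearly along the ray of \<open>y\<close> by convexity, while
  homogeneity makes it decrease like \<open>- \<theta> ln t\<close>. Boundary vectors follow after
  adding \<open>(e / \<theta>) z\<close>, which costs exactly \<open>e\<close> because
  \<open>z \<bullet> g z = - \<theta>\<close>.\<close>

lemma inner_g_nonpos:
  assumes z: "z \<in> S" and v: "v \<in> K"
  shows "v \<bullet> g z \<le> 0"
proof -
  have int: "y \<bullet> g z \<le> 0" if y: "y \<in> S" for y
  proof (rule ccontr)
    assume "\<not> y \<bullet> g z \<le> 0"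
    then have a: "y \<bullet> g z > 0" by simp
    define t where "t = max 1 ((F y - F z) / (y \<bullet> g z) + 1)"
    have t: "t \<ge> 1" "t \<ge> (F y - F z) / (y \<bullet> g z) + 1" by (simp_all add: t_def)
    have "F z + (t *\<^sub>R y - z) \<bullet> g z \<le> F (t *\<^sub>R y)"
      using t by (intro F_tangent z scale_in_S y) auto
    also have "F (t *\<^sub>R y) = F y - \<theta> * ln t" using F_scale[OF y, of t] t by simp
    also have "\<dots> \<le> F y" using t theta_ge_1 by simp
    finally have "t * (y \<bullet> g z) + \<theta> \<le> F y - F z"
      using inner_g_self[OF z] by (simp add: inner_diff_left)
    moreover have "((F y - F z) / (y \<bullet> g z) + 1) * (y \<bullet> g z) \<le> t * (y \<bullet> g z)"
      using t a by (intro mult_right_mono) auto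
    moreover have "((F y - F z) / (y \<bullet> g z) + 1) * (y \<bullet> g z) = F y - F z + y \<bullet> g z"
      using a by (simp add: field_simps)
    ultimately show False using a theta_ge_1 by linarith
  qed
  show ?thesis
  proof (rule field_le_epsilon)
    fix e :: real assume e: "e > 0"
    have "((e / \<theta>) *\<^sub>R z + v) \<bullet> g z \<le> 0"
      using e theta_ge_1 by (intro int add_in_S scale_in_S z v) auto
    then show "v \<bullet> g z \<le> 0 + e"
      using theta_ge_1 by (simp add: inner_add_left inner_g_self[OF z])
  qed
qed

text \<open>In \<open>grad_growth\<close> let the ray \<open>z + t v\<close> run to infinity: the
  gradient term stays nonpositive and \<open>r / (1 + t r)\<close> is at most \<open>1 / t\<close>.
  Here \<open>t\<close> is \<open>1 / e\<close>.\<close>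

lemma nrm_le_recession:
  assumes z: "z \<in> S" and v: "v \<in> K"
  shows "nrm z v \<le> - (v \<bullet> g z)"
proof -
  have "v \<bullet> g z + nrm z v \<le> 0"
  proof (rule field_le_epsilon)
    fix e :: real assume e: "e > 0"
    have 1: "z + (1 / e) *\<^sub>R v \<in> S"
      using e K_cone v by (intro add_in_S z) (simp add: mem_cone)
    have "v \<bullet> g z + nrm z v \<le> v \<bullet> g (z + (1 / e) *\<^sub>R v) + nrm z v / (1 + 1 / e * nrm z v)"
      using e by (intro grad_growth z 1) simp
    also have "\<dots> \<le> 0 + nrm z v / (1 + 1 / e * nrm z v)"
      using inner_g_nonpos[OF 1 v] by simp
    also have "nrm z v / (1 + 1 / e * nrm z v) \<le> e"
      using e z by (simp add: field_simps add_pos_nonneg)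
    finally show "v \<bullet> g z + nrm z v \<le> 0 + e" by simp
  qed
  then show ?thesis by simp
qed

text \<open>The dual counterpart of \<open>dikin\<close>: against \<open>v\<close> in
  \<open>K\<close>, the deviation \<open>s + g z\<close> contributes at most the local norm of
  \<open>v\<close>, and by \<open>nrm_le_recession\<close> the vector \<open>- g z\<close> already
  pays for that.\<close>

lemma dual_interiorI:
  assumes z: "z \<in> S" and s: "dnrm z (s + g z) < 1"
  shows "s \<in> interior (dual_cone K)"
proof -
  define U where "U = {s. dnrm z (s + g z) < 1}"
  have "open U"
    unfolding U_def
    by (intro open_Collect_less continuous_on_compose2[OF mnorm_continuous[of UNIV]] continuous_intros) auto
  moreover have "U \<subseteq> dual_cone K"
  proof
    fix s assume "s \<in> U"
    then have s: "dnrm z (s + g z) < 1" by (simp add: U_def)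
    have "0 \<le> s \<bullet> v" if v: "v \<in> K" for v
    proof -
      have "- (v \<bullet> (s + g z)) \<le> nrm z v * dnrm z (s + g z)"
        using mnorm_dual_cauchy[OF G_spd[OF z], of v "s + g z"] by simp
      also have "\<dots> \<le> nrm z v * 1" using s z by (intro mult_left_mono) auto
      also have "\<dots> \<le> - (v \<bullet> g z)" using nrm_le_recession[OF z v] by simp
      finally show ?thesis by (simp add: inner_add_right inner_commute)
    qed
    then show "s \<in> dual_cone K" by (simp add: dual_cone_def)
  qed
  ultimately have "U \<subseteq> interior (dual_cone K)" by (simp add: interior_maximal)
  then show ?thesis using s by (auto simp: U_def)
qed

end

section \<open>The conjugate barrier\<close>

lemma grad_eqI: "GDERIV f x :> d \<Longrightarrow> grad f x = d"
  unfolding grad_def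
proof (rule the_equality)
  fix w assume "GDERIV f x :> d" "GDERIV f x :> w"
  then have "(\<lambda>h. h \<bullet> w) = (\<lambda>h. h \<bullet> d)" unfolding gderiv_def by (metis has_derivative_unique)
  then show "w = d" by (metis inner_commute vector_eq_rdot)
qed

context lhscb
begin

abbreviation "D \<equiv> interior (dual_cone K)"

section \<open>The gradient map onto the interior of the dual cone\<close>

lemma neg_g_in_D: "x \<in> S \<Longrightarrow> - g x \<in> D"
  by (rule dual_interiorI[of x]) simp_all

lemma F_continuous: "continuous_on S F"
  using F_has_derivative has_derivative_continuous continuous_at_imp_continuous_on by blast

lemma g_continuous: "continuous_on S g"
  using g_has_derivative has_derivative_continuous continuous_at_imp_continuous_on by blast

text \<open>Moving from \<open>s\<close> by \<open>e\<close> against the direction of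
  \<open>v\<close> does not leave the dual cone.\<close>

lemma dual_interior_lower_bound:
  assumes "s \<in> D"
  obtains e where "e > 0" "\<And>v. v \<in> K \<Longrightarrow> e * norm v \<le> s \<bullet> v"
proof -
  obtain e where e: "e > 0" "cball s e \<subseteq> dual_cone K"
    using assms mem_interior_cball by blast
  have "e * norm v \<le> s \<bullet> v" if v: "v \<in> K" for v
  proof (cases "v = 0")
    case False
    have "s - (e / norm v) *\<^sub>R v \<in> cball s e" using e(1) False by (simp add: dist_norm)
    then have "s - (e / norm v) *\<^sub>R v \<in> dual_cone K" using e(2) by blast
    then have "0 \<le> (s - (e / norm v) *\<^sub>R v) \<bullet> v" using v unfolding dual_cone_def by blast
    then show ?thesis using False by (simp add: inner_diff_left power2_norm_eq_inner[symmetric] power2_eq_square)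
  qed simp
  with e(1) show ?thesis by (rule that)
qed

lemma nonzero_S: "x \<in> S \<Longrightarrow> x \<noteq> 0"
  using inner_g_self[of x] theta_ge_1 by auto

text \<open>By homogeneity a minimiser of \<open>F\<close> on the bounded slice \<open>s \<bullet> x = \<theta>\<close> minimises \<open>s \<bullet> x + F x\<close> on
  the whole of \<open>S\<close>.\<close>

lemma neg_g_surj:
  assumes s: "s \<in> D"
  shows "\<exists>x\<in>S. g x = - s"
proof -
  obtain e where e: "e > 0" "\<And>v. v \<in> K \<Longrightarrow> e * norm v \<le> s \<bullet> v"
    using dual_interior_lower_bound[OF s] by blast
  have pos: "s \<bullet> x > 0" if "x \<in> S" for x
    using e(2)[OF S_sub[OF that]] e(1) nonzero_S[OF that] by (smt (verit) mult_pos_pos zero_less_norm_iff)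
  have \<theta>: "\<theta> > 0" using theta_ge_1 by simp
  obtain w where w: "w \<in> S" using S_ne by blast
  define x0 where "x0 = (\<theta> / (s \<bullet> w)) *\<^sub>R w"
  have x0: "x0 \<in> S" "s \<bullet> x0 = \<theta>" using w pos[OF w] \<theta> by (auto simp: x0_def intro!: scale_in_S)
  define L where "L = {x \<in> S. s \<bullet> x = \<theta> \<and> F x \<le> F x0}"
  \<comment> \<open>Bounded since \<open>s\<close> dominates the norm on \<open>K\<close>; closed
    since a limit on the frontier would force \<open>F\<close> to infinity along a sequence in
    \<open>L\<close>.\<close>
  have "compact L"
  proof -
    have "norm x \<le> \<theta> / e" if "x \<in> L" for x
      using e(2)[OF S_sub, of x] that e(1) by (simp add: L_def field_simps)
    then have "bounded L" by (auto simp: bounded_iff)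
    moreover have "closed L"
      unfolding closed_sequential_limits
    proof (intro allI impI, elim conjE)
      fix X l assume X: "\<forall>n. X n \<in> L" "X \<longlonglongrightarrow> l"
      have "l \<in> K" using K_closed X S_sub unfolding closed_sequential_limits L_def by blast
      have "(\<lambda>n. s \<bullet> X n) \<longlonglongrightarrow> s \<bullet> l" using X(2) by (intro tendsto_intros)
      then have sl: "s \<bullet> l = \<theta>" using X(1) LIMSEQ_unique[of "\<lambda>n. s \<bullet> X n" "s \<bullet> l" \<theta>] by (simp add: L_def)
      have "l \<in> S"
      proof (rule ccontr)
        assume "l \<notin> S"
        then have "l \<in> frontier K" using \<open>l \<in> K\<close> K_closed by (simp add: frontier_def)
        moreover have "\<forall>i. X i \<in> S" using X(1) by (simp add: L_def)
        ultimately have "filterlim (\<lambda>i. F (X i)) at_top sequentially"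
          using LHSCB X(2) unfolding LHSCB_def by metis
        then have "eventually (\<lambda>i. F (X i) > F x0) sequentially" by (simp add: filterlim_at_top_dense)
        then obtain i where "F (X i) > F x0" by (auto dest: eventually_happens)
        moreover have "F (X i) \<le> F x0" using X(1) by (simp add: L_def)
        ultimately show False by simp
      qed
      have "isCont F l" using F_continuous \<open>l \<in> S\<close> S_open continuous_on_eq_continuous_at by blast
      then have "(\<lambda>n. F (X n)) \<longlonglongrightarrow> F l" using X(2) by (rule isCont_tendsto_compose)
      then have "F l \<le> F x0" using X(1) by (intro LIMSEQ_le_const2[of _ "F l"]) (auto simp: L_def)
      with \<open>l \<in> S\<close> sl show "l \<in> L" by (simp add: L_def)
    qed
    ultimately show ?thesis by (simp add: compact_eq_bounded_closed)
  qed
  moreover have "x0 \<in> L" using x0 by (simp add: L_def)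
  moreover have "continuous_on L F" using F_continuous by (rule continuous_on_subset) (auto simp: L_def)
  ultimately obtain x where x: "x \<in> L" "\<And>y. y \<in> L \<Longrightarrow> F x \<le> F y"
    using continuous_attains_inf[of L F] by blast
  have xS: "x \<in> S" "s \<bullet> x = \<theta>" using x(1) by (auto simp: L_def)
  have slice: "F x \<le> F y" if "y \<in> S" "s \<bullet> y = \<theta>" for y
  proof (cases "y \<in> L")
    case False then show ?thesis using that x(1) by (auto simp: L_def)
  qed (rule x(2))
  \<comment> \<open>Rescaling \<open>y\<close> into the slice changes \<open>F\<close> by
    \<open>\<theta> ln (u / \<theta>)\<close>, which \<open>ln t \<le> t - 1\<close> bounds by the
    change \<open>u - \<theta>\<close> of the linear term.\<close>
  have min: "s \<bullet> x + F x \<le> s \<bullet> y + F y" if y: "y \<in> S" for y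
  proof -
    define u where "u = s \<bullet> y"
    have u: "u > 0" using pos[OF y] by (simp add: u_def)
    have "F x \<le> F ((\<theta> / u) *\<^sub>R y)" using u \<theta> y by (intro slice scale_in_S) (auto simp: u_def)
    also have "\<dots> = F y - \<theta> * ln (\<theta> / u)" using u \<theta> y by (simp add: F_scale)
    finally have "F x + \<theta> * ln (\<theta> / u) \<le> F y" by simp
    moreover have "ln (u / \<theta>) \<le> u / \<theta> - 1" using u \<theta> by (intro ln_le_minus_one) simp
    then have "\<theta> * ln (u / \<theta>) \<le> u - \<theta>" using \<theta> by (simp add: field_simps)
    moreover have "ln (\<theta> / u) = - ln (u / \<theta>)" using u \<theta> by (simp add: ln_div)
    ultimately show ?thesis using xS by (simp add: u_def)
  qed
  have "((\<lambda>y. s \<bullet> y + F y) has_derivative (\<lambda>h. s \<bullet> h + h \<bullet> g x)) (at x)"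
    by (intro has_derivative_add has_derivative_inner_right has_derivative_ident F_has_derivative xS)
  from differential_zero_maxmin[OF xS(1) S_open this]
  have "(\<lambda>h. s \<bullet> h + h \<bullet> g x) = (\<lambda>v. 0)" using min by blast
  then have "\<And>h. (g x + s) \<bullet> h = 0" by (simp add: fun_eq_iff inner_commute inner_add_right add.commute)
  then have "g x + s = 0" by (metis inner_eq_zero_iff)
  then show ?thesis using xS(1) by (auto simp: eq_neg_iff_add_eq_0)
qed

text \<open>The map \<open>X\<close> of the overview; on \<open>D\<close> the choice is forced by
  \<open>inj_g\<close>.\<close>

definition dual_point :: "real^'n \<Rightarrow> real^'n" where
  "dual_point s = (SOME x. x \<in> S \<and> g x = - s)"

lemma dual_point: "s \<in> D \<Longrightarrow> dual_point s \<in> S" "s \<in> D \<Longrightarrow> g (dual_point s) = - s"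
proof -
  assume "s \<in> D"
  then have "\<exists>x. x \<in> S \<and> g x = - s" using neg_g_surj by blast
  then have "dual_point s \<in> S \<and> g (dual_point s) = - s" unfolding dual_point_def by (rule someI_ex)
  then show "dual_point s \<in> S" "g (dual_point s) = - s" by auto
qed

lemma dual_point_eq: "x \<in> S \<Longrightarrow> g x = - s \<Longrightarrow> dual_point s = x"
  using dual_point[of s] neg_g_in_D[of x] inj_g[of "dual_point s" x] by simp

text \<open>The inverse function theorem in the form where a left inverse on \<open>S\<close> is
  already known: it asks for continuity of \<open>g\<close> on \<open>S\<close> and for the
  derivative at one point.\<close>

lemma dual_point_has_derivative:
  assumes s: "s \<in> D"
  shows "(dual_point has_derivative (\<lambda>h. - (matrix_inv (G (dual_point s)) *v h))) (at s)"
proof -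
  let ?x = "dual_point s"
  have x: "?x \<in> S" "- g ?x = s" using dual_point[OF s] by auto
  have "(dual_point has_derivative (\<lambda>h. - (matrix_inv (G ?x) *v h))) (at (- g ?x))"
  proof (rule has_derivative_inverse_strong[of S ?x "\<lambda>x. - g x" _ "\<lambda>h. - (G ?x *v h)"])
    show "continuous_on S (\<lambda>x. - g x)" by (intro continuous_intros g_continuous)
    show "dual_point (- g y) = y" if "y \<in> S" for y using dual_point_eq[OF that] by simp
    show "((\<lambda>x. - g x) has_derivative (\<lambda>h. - (G ?x *v h))) (at ?x)"
      by (intro has_derivative_minus g_has_derivative x)
    have "G ?x *v (- v) = - (G ?x *v v)" for v
      using matrix_vector_mult_scaleR[of "G ?x" "-1" v] by simp
    then show "(\<lambda>h. - (G ?x *v h)) \<circ> (\<lambda>h. - (matrix_inv (G ?x) *v h)) = id"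
      using spd_invertible[OF G_spd[OF x(1)]] by (auto simp: fun_eq_iff)
  qed (use x S_open in auto)
  then show ?thesis using x by simp
qed

lemma conj_barrier_eq:
  assumes s: "s \<in> D"
  shows "conj_barrier K F s = - (s \<bullet> dual_point s) - F (dual_point s)"
  unfolding conj_barrier_def
proof (rule cSup_eq_maximum)
  note x = dual_point[OF s]
  show "- (s \<bullet> dual_point s) - F (dual_point s) \<in> (\<lambda>x. - (s \<bullet> x) - F x) ` S" using x by blast
  fix r assume "r \<in> (\<lambda>x. - (s \<bullet> x) - F x) ` S"
  then obtain y where y: "y \<in> S" "r = - (s \<bullet> y) - F y" by blast
  show "r \<le> - (s \<bullet> dual_point s) - F (dual_point s)"
    using F_tangent[OF x(1) y(1)] y(2) x(2)
    by (simp add: inner_diff_left inner_diff_right inner_commute)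
qed

text \<open>The envelope argument: \<open>dual_point s\<close> is a stationary point of the
  maximised function, so the terms containing its derivative cancel.\<close>

lemma grad_conj_barrier:
  assumes s: "s \<in> D"
  shows "grad (conj_barrier K F) s = - dual_point s"
proof (rule grad_eqI)
  let ?x = "dual_point s"
  define X' where "X' h = - (matrix_inv (G ?x) *v h)" for h
  have d: "(dual_point has_derivative X') (at s)"
    unfolding X'_def by (rule dual_point_has_derivative[OF s])
  have "((\<lambda>t. F (dual_point t)) has_derivative (\<lambda>h. X' h \<bullet> g ?x)) (at s)"
    using has_derivative_compose[OF d F_has_derivative[OF dual_point(1)[OF s]]] .
  then have "((\<lambda>t. - (t \<bullet> dual_point t) - F (dual_point t)) has_derivative
      (\<lambda>h. - (s \<bullet> X' h + h \<bullet> ?x) - X' h \<bullet> g ?x)) (at s)"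
    by (intro has_derivative_diff has_derivative_minus has_derivative_inner d has_derivative_ident)
  then have "((\<lambda>t. - (t \<bullet> dual_point t) - F (dual_point t)) has_derivative (\<lambda>h. h \<bullet> (- ?x))) (at s)"
    by (simp add: dual_point(2)[OF s] inner_commute)
  then have "(conj_barrier K F has_derivative (\<lambda>h. h \<bullet> (- ?x))) (at s)"
    by (rule has_derivative_transform_within_open[OF _ open_interior s]) (simp add: conj_barrier_eq)
  then show "GDERIV (conj_barrier K F) s :> - ?x" by (simp add: gderiv_def)
qed

lemma hessian_conj_barrier:
  assumes s: "s \<in> D"
  shows "hessian (conj_barrier K F) s = matrix_inv (G (dual_point s))"
proof -
  let ?P = "matrix_inv (G (dual_point s))"
  have "((\<lambda>t. - dual_point t) has_derivative (\<lambda>h. ?P *v h)) (at s)"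
    using has_derivative_minus[OF dual_point_has_derivative[OF s]] by simp
  then have "(grad (conj_barrier K F) has_derivative (\<lambda>h. ?P *v h)) (at s)"
    by (rule has_derivative_transform_within_open[OF _ open_interior s]) (simp add: grad_conj_barrier)
  then show ?thesis
    unfolding hessian_def jacobian_def by (simp flip: frechet_derivative_at)
qed

end

section \<open>The scaling matrix\<close>

lemma outer_mult: "outer u v *v w = (v \<bullet> w) *\<^sub>R u"
  by (simp add: vec_eq_iff outer_def matrix_vector_mult_def inner_vec_def sum_distrib_left ac_simps)

lemma scaleR_matrix_mult: "(a *\<^sub>R (W :: real^'n^'m)) *v v = a *\<^sub>R (W *v v)"
  by (simp add: vec_eq_iff matrix_vector_mult_def sum_distrib_left ac_simps)

text \<open>The BFGS update of quasi-Newton methods with step \<open>a\<close> and gradient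
  difference \<open>p\<close>. Both updates of the scaling are instances: \<open>H1_mat\<close> with
  \<open>s\<close> and \<open>x\<close>, \<open>T2_mat\<close> with \<open>delta_D\<close> and
  \<open>delta_P\<close>.\<close>

definition rank_two_update :: "real^'n^'n \<Rightarrow> real^'n \<Rightarrow> real^'n \<Rightarrow> real^'n^'n" where
  "rank_two_update W a p = W + (1 / (a \<bullet> p)) *\<^sub>R outer p p
     - (1 / (a \<bullet> (W *v a))) *\<^sub>R (W ** outer a a ** W)"

lemma rank_two_update_apply:
  "rank_two_update W a p *v v = W *v v + ((p \<bullet> v) / (a \<bullet> p)) *\<^sub>R p
     - ((a \<bullet> (W *v v)) / (a \<bullet> (W *v a))) *\<^sub>R (W *v a)"
  by (simp add: rank_two_update_def matrix_vector_mult_diff_rdistrib matrix_vector_mult_add_rdistrib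
      scaleR_matrix_mult outer_mult matrix_vector_mul_assoc[symmetric] matrix_vector_mult_scaleR)

lemma rank_two_update_secant:
  "a \<bullet> p \<noteq> 0 \<Longrightarrow> a \<bullet> (W *v a) \<noteq> 0 \<Longrightarrow> rank_two_update W a p *v a = p"
  by (simp add: rank_two_update_apply inner_commute)

lemma rank_two_update_sym:
  assumes "\<And>u v. u \<bullet> (W *v v) = v \<bullet> (W *v u)"
  shows "u \<bullet> (rank_two_update W a p *v v) = v \<bullet> (rank_two_update W a p *v u)"
  using assms[of u v] assms[of a u] assms[of a v]
  by (simp add: rank_two_update_apply inner_diff_right inner_add_right inner_commute mult.commute)

text \<open>Both rank-one terms are compared with the one built from \<open>P a\<close>: the added
  term differs from it by the bound for \<open>\<eta>\<close>, the subtracted one by that for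
  \<open>\<epsilon>\<close>, because \<open>W a\<close> is near \<open>P a\<close>. So they cancel
  up to these errors.\<close>

lemma rank_two_update_near:
  assumes P: "spd P" and a: "a \<noteq> 0" and \<eta>: "0 \<le> \<eta>" "\<eta> < 1" "0 \<le> \<epsilon>" "\<epsilon> < 1"
    and p: "\<And>u. \<bar>u \<bullet> (p - P *v a)\<bar> \<le> \<eta> * mnorm P u * mnorm P a"
    and W: "\<And>u v. \<bar>u \<bullet> (W *v v - P *v v)\<bar> \<le> \<epsilon> * mnorm P u * mnorm P v"
    and sym: "\<And>u v. u \<bullet> (W *v v) = v \<bullet> (W *v u)"
  shows "0 < a \<bullet> p" "0 < a \<bullet> (W *v a)"
    and "\<bar>u \<bullet> (rank_two_update W a p *v v - P *v v)\<bar>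
      \<le> (\<epsilon> + (3 * \<eta> + \<eta>\<^sup>2) / (1 - \<eta>) + (3 * \<epsilon> + \<epsilon>\<^sup>2) / (1 - \<epsilon>)) * mnorm P u * mnorm P v"
proof -
  show "0 < a \<bullet> p" by (rule rank_one_update_bound(1)[OF P a \<eta>(1,2) p])
  show "0 < a \<bullet> (W *v a)" by (rule rank_one_update_bound(1)[OF P a \<eta>(3,4) W])
  define X Y Z where "X = (u \<bullet> p) * (v \<bullet> p) / (a \<bullet> p)"
    and "Y = (u \<bullet> (W *v a)) * (v \<bullet> (W *v a)) / (a \<bullet> (W *v a))"
    and "Z = (u \<bullet> (P *v a)) * (v \<bullet> (P *v a)) / (a \<bullet> (P *v a))"
  have "\<bar>X - Z\<bar> \<le> (3 * \<eta> + \<eta>\<^sup>2) / (1 - \<eta>) * (mnorm P u * mnorm P v)"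
    unfolding X_def Z_def by (rule rank_one_update_bound(2)[OF P a \<eta>(1,2) p])
  moreover have "\<bar>Y - Z\<bar> \<le> (3 * \<epsilon> + \<epsilon>\<^sup>2) / (1 - \<epsilon>) * (mnorm P u * mnorm P v)"
    unfolding Y_def Z_def by (rule rank_one_update_bound(2)[OF P a \<eta>(3,4) W])
  moreover have "u \<bullet> (rank_two_update W a p *v v - P *v v) = u \<bullet> (W *v v - P *v v) + X - Y"
    by (simp add: rank_two_update_apply X_def Y_def inner_diff_right inner_add_right sym[of a v] inner_commute ac_simps)
  moreover note W[of u v]
  ultimately show "\<bar>u \<bullet> (rank_two_update W a p *v v - P *v v)\<bar>
      \<le> (\<epsilon> + (3 * \<eta> + \<eta>\<^sup>2) / (1 - \<eta>) + (3 * \<epsilon> + \<epsilon>\<^sup>2) / (1 - \<epsilon>)) * mnorm P u * mnorm P v"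
    unfolding distrib_right mult.assoc by linarith
qed

lemma rank_two_update_scaled:
  assumes "m > 0" and p: "p = m *\<^sub>R q" and W: "\<And>v. W *v v = m *\<^sub>R (V *v v)"
  shows "rank_two_update W a p *v v = m *\<^sub>R (rank_two_update V a q *v v)"
  using assms(1) by (simp add: rank_two_update_apply p W scaleR_diff_right scaleR_add_right mult.commute)

text \<open>Makes the error bounds linear in \<open>\<eta>\<close>, so that only linear arithmetic
  in \<open>\<tau>\<close> is left below.\<close>

lemma rank_two_factor_le:
  fixes \<eta> :: real
  assumes "0 \<le> \<eta>" "\<eta> \<le> h" "h < 1"
  shows "(3 * \<eta> + \<eta>\<^sup>2) / (1 - \<eta>) \<le> (3 + h) / (1 - h) * \<eta>"
proof -
  have "(3 * \<eta> + \<eta>\<^sup>2) / (1 - \<eta>) = (3 + \<eta>) / (1 - \<eta>) * \<eta>" by (simp add: power2_eq_square field_simps)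
  also have "\<dots> \<le> (3 + h) / (1 - h) * \<eta>" using assms by (intro mult_right_mono frac_le) auto
  finally show ?thesis .
qed

context lhscb
begin

text \<open>\<open>s_check\<close> is the midpoint of \<open>s\<close> and \<open>- g z\<close>, so
  the gradients at \<open>z\<close> and at \<open>dual_point s\<close> differ from
  \<open>g c\<close> by \<open>\<delta>/2\<close> in opposite directions, and both points lie within
  about \<open>\<tau>/2\<close> of \<open>c\<close>. Linearizing \<open>g\<close> there shows that
  the inverse Hessian at \<open>c\<close> maps \<open>s\<close> near \<open>z\<close> and
  \<open>\<delta>\<close> near \<open>z - dual_point s\<close>, with errors of order
  \<open>\<tau>^2\<close>. Relative to \<open>s\<close>, whose norm is at least 0.98, this is
  negligible; relative to \<open>\<delta>\<close>, of norm \<open>\<tau>\<close>, it is of order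
  \<open>\<tau>\<close>. So the second update dominates: \<open>4.6 \<tau>\<close> is mostly
  \<open>3 * 1.4 \<tau>\<close>.\<close>

lemma scaling_matrix_near:
  assumes z: "z \<in> S" and s: "s \<in> D" and \<mu>: "\<mu> > 0" and x: "x = \<mu> *\<^sub>R z"
    and m: "mu \<theta> x s = \<mu>" and \<delta>: "\<delta> = s + g z" and \<rho>: "dnrm z \<delta> \<le> \<rho>" "\<rho> \<le> 0.02"
  obtains c M \<tau> where "c \<in> S" "nrm z (c - z) \<le> 0.0102" "\<tau> = dnrm c \<delta>" "\<tau> \<le> 1.0132 * \<rho>" "nrm c (z - c) \<le> 0.506 * \<tau>"
    and "\<And>v. T2_mat K F \<theta> x s *v v = \<mu> *\<^sub>R (M *v v)"
    and "\<And>u v. u \<bullet> (M *v v) = v \<bullet> (M *v u)"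
    and "\<And>u v. \<bar>u \<bullet> (M *v v - matrix_inv (G c) *v v)\<bar> \<le> 4.6 * \<tau> * dnrm c u * dnrm c v"
    and "M *v s = z" "M *v \<delta> = z - dual_point s" "s \<bullet> z = \<theta>" "\<delta> \<bullet> z = 0"
proof -
  have xS: "x \<in> S" using scale_in_S[OF z \<mu>] x by simp
  have gx: "\<mu> *\<^sub>R g x = g z" using \<mu> by (simp add: x g_scale[OF z \<mu>])
  define xt where "xt = dual_point s"
  have xt: "xt \<in> S" "g xt = - s" using dual_point[OF s] by (simp_all add: xt_def)
  have sx: "s \<bullet> x = \<mu> * \<theta>" using m theta_ge_1 by (simp add: mu_def field_simps)
  have sz: "s \<bullet> z = \<theta>" using sx \<mu> by (simp add: x)
  have dz: "\<delta> \<bullet> z = 0" using sz inner_g_self[OF z] by (simp add: \<delta> inner_add_left inner_commute[of "g z"])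
  have dD: "delta_D F \<theta> x s = \<delta>" by (simp add: delta_D_def m s_tilde_def gx \<delta>)
  have dP: "delta_P K F \<theta> x s = \<mu> *\<^sub>R (z - xt)"
    unfolding delta_P_def m x_tilde_def grad_conj_barrier[OF s]
    by (simp add: xt_def x scaleR_diff_right)
  define sc where "sc = s_check F \<theta> x s"
  have sc: "sc = s - (1/2) *\<^sub>R \<delta>" "sc = - g z + (1/2) *\<^sub>R \<delta>"
    by (simp_all add: sc_def s_check_def m s_tilde_def gx \<delta> algebra_simps vec_eq_iff)
  have half: "dnrm y ((1/2) *\<^sub>R \<delta>) = dnrm y \<delta> / 2" for y
    using mnorm_scale[of _ "1/2" \<delta>] by simp
  have \<rho>0: "0 \<le> dnrm z \<delta>" using z by simp
  have scD: "sc \<in> D"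
    using dual_interiorI[OF z, of sc] half[of z] \<rho> by (simp add: sc(2))
  define c where "c = dual_point sc"
  have c: "c \<in> S" "g c = - sc" using dual_point[OF scD] by (simp_all add: c_def)
  define P where "P = matrix_inv (G c)"
  have P: "spd P" using spd_matrix_inv[OF G_spd[OF c(1)]] by (simp add: P_def)
  have gzc: "g z - g c = (1/2) *\<^sub>R \<delta>" and gxc: "g xt - g c = - ((1/2) *\<^sub>R \<delta>)"
  proof -
    have "g z = (1/2) *\<^sub>R \<delta> - sc" by (simp add: sc(2))
    then show "g z - g c = (1/2) *\<^sub>R \<delta>" by (simp add: c(2))
    show "g xt - g c = - ((1/2) *\<^sub>R \<delta>)" by (simp add: c(2) xt(2) sc(1))
  qed
  have "dnrm z (g c - g z) \<le> 0.01"
    using half[of z] \<rho> gzc mnorm_minus_commute[of _ "g c" "g z"] by simp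
  from nrm_diff_le_grad_diff[OF z c(1) this] have cz: "nrm z (c - z) \<le> 0.0102" by simp
  define \<tau> where "\<tau> = dnrm c \<delta>"
  \<comment> \<open>\<open>(1 - 0.0102)^(-5/2)\<close> is below 1.0265, whose square root is below
    1.0132.\<close>
  have "dnrm c \<delta> \<le> 1.0132 * dnrm z \<delta>"
    by (rule nrm_compare(4)[OF z cz, of "0.0265"]) (auto simp: power2_eq_square eval_nat_numeral)
  then have \<tau>: "0 \<le> \<tau>" "\<tau> \<le> 1.0132 * \<rho>" "\<tau> \<le> 0.0203" using \<rho> c(1) by (simp_all add: \<tau>_def)
  have near: "nrm c (y - c) \<le> 0.506 * \<tau>" if "y \<in> S" "dnrm c (g y - g c) = \<tau> / 2" for y
  proof -
    have "nrm c (y - c) \<le> (\<tau> / 2) / (1 - \<tau> / 2)"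
      using that \<tau> by (intro nrm_diff_le_grad_diff c(1)) auto
    also have "\<dots> \<le> (\<tau> / 2) / (1 - 0.0203 / 2)" using \<tau> by (intro divide_left_mono) auto
    also have "\<dots> \<le> 0.506 * \<tau>" using \<tau> by simp
    finally show ?thesis .
  qed
  have zc: "nrm c (z - c) \<le> 0.506 * \<tau>" and xc: "nrm c (xt - c) \<le> 0.506 * \<tau>"
    using near[OF z] near[OF xt(1)] gzc gxc half[of c] by (simp_all add: \<tau>_def)
  define R where "R = 0.506 * \<tau>"
  have R: "0 \<le> R" "R \<le> 0.0103" using \<tau> by (simp_all add: R_def)
  \<comment> \<open>To first order \<open>(1 - R)^(-5/2)\<close> is \<open>1 + (5/2) R\<close>; at
    this size of \<open>R\<close> the coefficient 2.7 leaves room for the higher terms, after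
    Bernoulli has removed the fifth power.\<close>
  have w: "1 \<le> (1 + 2.7 * R)\<^sup>2 * (1 - R)^5"
  proof -
    have "1 \<le> (1 + 5.4 * R + 7.29 * R\<^sup>2) * (1 - 5 * R)"
    proof -
      have "R * R \<le> 11/1000 * R" "R * R * R \<le> 11/1000 * (11/1000) * R"
        using R by (intro mult_right_mono mult_mono; simp)+
      then have "0 \<le> 4/10 * R - 1971/100 * (R * R) - 3645/100 * (R * R * R)" using R(1) by linarith
      then show ?thesis by (simp add: field_simps power2_eq_square)
    qed
    also have "\<dots> \<le> (1 + 2.7 * R)\<^sup>2 * (1 - R)^5"
    proof (rule mult_mono)
      show "1 - 5 * R \<le> (1 - R)^5" using Bernoulli_inequality[of "- R" 5] R by simp
    qed (use R in \<open>auto simp: power2_eq_square algebra_simps\<close>)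
    finally show ?thesis .
  qed
  have lin: "dnrm c (g y - g y' - G c *v (y - y')) \<le> 2.7 * R * nrm c (y - y')"
    if "nrm c (y - c) \<le> R" "nrm c (y' - c) \<le> R" for y y'
    using that R w by (intro grad_linearization[OF c(1)]) auto
  have GP: "P *v (G c *v v) = v" for v using spd_invertible[OF G_spd[OF c(1)]] by (simp add: P_def)
  have Pe: "\<bar>u \<bullet> (P *v e)\<bar> \<le> mnorm P u * mnorm P e" for u e by (rule mnorm_cauchy[OF P])
  have diff: "\<bar>u \<bullet> (v - P *v e)\<bar> \<le> mnorm P u * B" if "mnorm P (e - G c *v v) \<le> B" for u v e B
  proof -
    have "v - P *v e = - (P *v (e - G c *v v))"
      by (simp add: matrix_vector_mult_diff_distrib GP)
    then have "\<bar>u \<bullet> (v - P *v e)\<bar> \<le> mnorm P u * mnorm P (e - G c *v v)" using Pe[of u] by simp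
    also have "\<dots> \<le> mnorm P u * B" using that P by (intro mult_left_mono) auto
    finally show ?thesis .
  qed
  define \<eta>1 where "\<eta>1 = 0.015 * \<tau>"
  \<comment> \<open>\<open>sc = - g c\<close> has dual norm sqrt(\<theta>) \<ge> 1 at
    \<open>c\<close>, and \<open>s\<close> differs from it by \<open>\<delta>/2\<close>.\<close>
  have s1: "0.98 \<le> mnorm P s"
  proof -
    have "1 \<le> sqrt \<theta>" using theta_ge_1 by simp
    also have "sqrt \<theta> = mnorm P sc" using dnrm_g[OF c(1)] by (simp add: P_def c(2))
    also have "\<dots> \<le> mnorm P s + mnorm P ((1/2) *\<^sub>R \<delta>)"
      unfolding sc(1) by (rule mnorm_triangle_diff[OF P])
    also have "\<dots> \<le> mnorm P s + 0.0203 / 2" using half[of c] \<tau> by (simp add: P_def \<tau>_def)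
    finally show ?thesis by simp
  qed
  then have s0: "s \<noteq> 0" by auto
  have close1: "\<bar>u \<bullet> (z - P *v s)\<bar> \<le> \<eta>1 * mnorm P u * mnorm P s" for u
  proof -
    \<comment> \<open>\<open>P\<close> maps \<open>sc\<close> to \<open>c\<close> by homogeneity.
      Therefore \<open>z - P s\<close> is, up to the factor \<open>- P\<close>, the linearization
      error of \<open>g\<close> between \<open>z\<close> and \<open>c\<close>.\<close>
    have "P *v s = c + P *v ((1/2) *\<^sub>R \<delta>)"
    proof -
      have "s = sc + (1/2) *\<^sub>R \<delta>" by (simp add: sc(1))
      moreover have "sc = G c *v c" using G_self[OF c(1)] c(2) by simp
      ultimately show ?thesis by (metis GP matrix_vector_right_distrib)
    qed
    then have eq: "z - P *v s = (z - c) - P *v (g z - g c)" by (simp add: gzc)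
    have "mnorm P (g z - g c - G c *v (z - c)) \<le> 2.7 * R * R"
      using order_trans[OF lin[of z c] mult_left_mono[OF zc, of "2.7 * R"]] zc R
      by (simp add: P_def R_def)
    then have "\<bar>u \<bullet> (z - P *v s)\<bar> \<le> mnorm P u * (2.7 * R * R)"
      unfolding eq by (rule diff)
    also have "\<dots> \<le> mnorm P u * (\<eta>1 * mnorm P s)"
    proof (rule mult_left_mono)
      have "\<tau> * \<tau> \<le> 0.0203 * \<tau>" using \<tau> by (intro mult_right_mono) auto
      then have "2.7 * R * R \<le> \<eta>1 * 0.98" using \<tau>(1) unfolding \<eta>1_def R_def by simp
      also have "\<dots> \<le> \<eta>1 * mnorm P s" using s1 \<tau> by (intro mult_left_mono) (auto simp: \<eta>1_def)
      finally show "2.7 * R * R \<le> \<eta>1 * mnorm P s" .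
    qed (simp add: P)
    finally show ?thesis by (simp add: ac_simps)
  qed
  define \<eta>2 where "\<eta>2 = 1.4 * \<tau>"
  have gd: "g z - g xt = \<delta>" using xt(2) \<delta> by simp
  have close2: "\<bar>u \<bullet> ((z - xt) - P *v \<delta>)\<bar> \<le> \<eta>2 * mnorm P u * mnorm P \<delta>" for u
  proof -
    have "nrm c (z - xt) \<le> nrm c (z - c) + nrm c (xt - c)"
      using mnorm_triangle_diff[OF G_spd[OF c(1)], of "z - c" "xt - c"] by simp
    then have "nrm c (z - xt) \<le> 2 * R" using zc xc by (simp add: R_def)
    then have "2.7 * R * nrm c (z - xt) \<le> 2.7 * R * (2 * R)" using R by (intro mult_left_mono) auto
    then have "mnorm P (g z - g xt - G c *v (z - xt)) \<le> 2.7 * R * (2 * R)"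
      unfolding P_def using lin[of z xt] zc xc by (intro order_trans[OF lin]) (simp_all add: R_def)
    then have "\<bar>u \<bullet> ((z - xt) - P *v \<delta>)\<bar> \<le> mnorm P u * (2.7 * R * (2 * R))"
      unfolding gd by (rule diff)
    also have "\<dots> \<le> mnorm P u * (\<eta>2 * mnorm P \<delta>)"
    proof (rule mult_left_mono)
      have "mnorm P \<delta> = \<tau>" by (simp add: P_def \<tau>_def)
      then show "2.7 * R * (2 * R) \<le> \<eta>2 * mnorm P \<delta>" by (simp add: R_def \<eta>2_def)
    qed (simp add: P)
    finally show ?thesis by (simp add: ac_simps)
  qed
  define N where "N = rank_two_update P s z"
  define M where "M = (if \<delta> = 0 then N else rank_two_update N \<delta> (z - xt))"
  define \<epsilon>1 where "\<epsilon>1 = 0.0463 * \<tau>"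
  have H: "H_mat K F \<theta> x s *v v = \<mu> *\<^sub>R (P *v v)" for v
    by (simp add: H_mat_def m sc_def[symmetric] hessian_conj_barrier[OF scD] c_def[symmetric] P_def
        scaleR_matrix_mult)
  have H1u: "H1_mat K F \<theta> x s = rank_two_update (H_mat K F \<theta> x s) s x"
    by (simp add: H1_mat_def rank_two_update_def Let_def)
  have H1: "H1_mat K F \<theta> x s *v v = \<mu> *\<^sub>R (N *v v)" for v
    unfolding H1u N_def by (rule rank_two_update_scaled[OF \<mu> x H])
  have T2: "T2_mat K F \<theta> x s *v v = \<mu> *\<^sub>R (M *v v)" for v
  proof (cases "\<delta> = 0")
    case True then show ?thesis by (simp add: T2_mat_def Let_def dD M_def H1)
  next
    case False
    then have "T2_mat K F \<theta> x s = rank_two_update (H1_mat K F \<theta> x s) \<delta> (delta_P K F \<theta> x s)"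
      by (simp add: T2_mat_def rank_two_update_def Let_def dD)
    then show ?thesis using False rank_two_update_scaled[OF \<mu> dP H1] by (simp add: M_def)
  qed
  have \<eta>1: "0 \<le> \<eta>1" "\<eta>1 < 1" "\<eta>1 \<le> 0.0004" using \<tau> by (simp_all add: \<eta>1_def)
  have Pz: "\<bar>u \<bullet> (P *v v - P *v v)\<bar> \<le> 0 * mnorm P u * mnorm P v" for u v by simp
  have Nsym: "u \<bullet> (N *v v) = v \<bullet> (N *v u)" for u v
    unfolding N_def by (rule rank_two_update_sym[OF spd_sym[OF P]])
  note Nn = rank_two_update_near[OF P s0 \<eta>1(1,2) _ _ close1 Pz spd_sym[OF P], simplified]
  have Nnear: "\<bar>u \<bullet> (N *v v - P *v v)\<bar> \<le> \<epsilon>1 * mnorm P u * mnorm P v" for u v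
  proof -
    have "(3 * \<eta>1 + \<eta>1\<^sup>2) / (1 - \<eta>1) \<le> (3 + 0.0004) / (1 - 0.0004) * \<eta>1"
      by (rule rank_two_factor_le[OF \<eta>1(1,3)]) simp
    also have "\<dots> \<le> \<epsilon>1" using \<tau> by (simp add: \<epsilon>1_def \<eta>1_def)
    finally have "(3 * \<eta>1 + \<eta>1\<^sup>2) / (1 - \<eta>1) * (mnorm P u * mnorm P v) \<le> \<epsilon>1 * (mnorm P u * mnorm P v)"
      by (rule mult_right_mono) (simp add: P)
    then show ?thesis using Nn(3)[of u v] by (simp add: N_def mult.assoc)
  qed
  have Ns: "N *v s = z"
    unfolding N_def using Nn(1) spd_pos[OF P s0] by (intro rank_two_update_secant) auto
  have \<eta>2: "0 \<le> \<eta>2" "\<eta>2 < 1" "\<eta>2 \<le> 0.02842" using \<tau> by (simp_all add: \<eta>2_def)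
  have \<epsilon>1: "0 \<le> \<epsilon>1" "\<epsilon>1 < 1" "\<epsilon>1 \<le> 0.001" using \<tau> by (simp_all add: \<epsilon>1_def)
  have Msym: "u \<bullet> (M *v v) = v \<bullet> (M *v u)" for u v
    using Nsym rank_two_update_sym[OF Nsym] by (simp add: M_def)
  have Mnear: "\<bar>u \<bullet> (M *v v - P *v v)\<bar> \<le> 4.6 * \<tau> * mnorm P u * mnorm P v" for u v
  proof (cases "\<delta> = 0")
    case True
    have "\<epsilon>1 * (mnorm P u * mnorm P v) \<le> 4.6 * \<tau> * (mnorm P u * mnorm P v)"
      using \<tau> P by (intro mult_right_mono) (auto simp: \<epsilon>1_def)
    then show ?thesis using Nnear[of u v] True by (simp add: M_def mult.assoc)
  next
    case False
    let ?k = "\<epsilon>1 + (3 * \<eta>2 + \<eta>2\<^sup>2) / (1 - \<eta>2) + (3 * \<epsilon>1 + \<epsilon>1\<^sup>2) / (1 - \<epsilon>1)"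
    have "?k \<le> 4.6 * \<tau>"
    proof -
      have "(3 * \<eta>2 + \<eta>2\<^sup>2) / (1 - \<eta>2) \<le> (3 + 0.02842) / (1 - 0.02842) * \<eta>2"
        by (rule rank_two_factor_le[OF \<eta>2(1,3)]) simp
      also have "\<dots> \<le> 4.3645 * \<tau>" using \<tau> by (simp add: \<eta>2_def)
      finally have "(3 * \<eta>2 + \<eta>2\<^sup>2) / (1 - \<eta>2) \<le> 4.3645 * \<tau>" .
      moreover have "(3 * \<epsilon>1 + \<epsilon>1\<^sup>2) / (1 - \<epsilon>1) \<le> (3 + 0.001) / (1 - 0.001) * \<epsilon>1"
        by (rule rank_two_factor_le[OF \<epsilon>1(1,3)]) simp
      moreover have "(3 + 0.001) / (1 - 0.001) * \<epsilon>1 \<le> 0.14 * \<tau>" using \<tau> by (simp add: \<epsilon>1_def)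
      moreover have "\<epsilon>1 + 4.3645 * \<tau> + 0.14 * \<tau> \<le> 4.6 * \<tau>" using \<tau> by (simp add: \<epsilon>1_def)
      ultimately show ?thesis by linarith
    qed
    then have "?k * (mnorm P u * mnorm P v) \<le> 4.6 * \<tau> * (mnorm P u * mnorm P v)"
      by (rule mult_right_mono) (simp add: P)
    moreover have "\<bar>u \<bullet> (M *v v - P *v v)\<bar> \<le> ?k * mnorm P u * mnorm P v"
      using rank_two_update_near(3)[OF P False \<eta>2(1,2) \<epsilon>1(1,2) close2 Nnear Nsym, of u v] False
      by (simp add: M_def)
    ultimately show ?thesis unfolding mult.assoc by (rule order_trans[rotated])
  qed
  have Md: "M *v \<delta> = z - xt"
  proof (cases "\<delta> = 0")
    case True
    then have "g z = g xt" using gd by simp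
    then have "z = xt" using inj_g[OF z xt(1)] by simp
    then show ?thesis using True by simp
  next
    case False
    note n = rank_two_update_near(1,2)[OF P False \<eta>2(1,2) \<epsilon>1(1,2) close2 Nnear Nsym]
    then have "rank_two_update N \<delta> (z - xt) *v \<delta> = z - xt"
      by (intro rank_two_update_secant) auto
    then show ?thesis using False by (simp add: M_def)
  qed
  \<comment> \<open>The second update keeps the first secant equation, because
    \<open>\<delta>\<close> is orthogonal to \<open>z = N s\<close> and \<open>z - xt\<close> is
    orthogonal to \<open>s\<close>. Both follow from \<open>s \<bullet> z = \<theta>\<close> and
    Euler's identity \<open>inner_g_self\<close>.\<close>
  have Ms: "M *v s = z"
  proof (cases "\<delta> = 0")
    case False
    have "xt \<bullet> s = \<theta>" using inner_g_self[OF xt(1)] xt(2) by simp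
    then have "(z - xt) \<bullet> s = 0" using sz by (simp add: inner_diff_right inner_commute)
    then show ?thesis using False dz by (simp add: M_def rank_two_update_apply Ns)
  qed (simp add: M_def Ns)
  show ?thesis
    by (rule that[OF c(1) cz \<tau>_def \<tau>(2) zc T2 Msym _ Ms _ sz dz])
      (use Mnear Md in \<open>auto simp: P_def xt_def\<close>)
qed

end

section \<open>Predictor and corrector steps\<close>

context lhscb
begin

text \<open>The vector \<open>w\<close> is chosen so that the scaling equation reads
  \<open>M w = d\<close>. As \<open>d\<close> is orthogonal to \<open>ds\<close>, expanding at
  \<open>a = - w - ds\<close> gives a Pythagorean identity: the form \<open>M\<close> at
  \<open>a\<close> is the sum of its values at \<open>w\<close> and at \<open>ds\<close>. This
  controls \<open>w\<close> by \<open>a\<close>, which is \<open>s\<close> for a predictor and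
  \<open>\<delta>\<close> for a corrector. The last bound says that the predicted gradient change
  \<open>G d\<close> is nearly \<open>w\<close>, since \<open>M\<close> is nearly the inverse of
  \<open>G c\<close>.\<close>

lemma search_direction_bounds:
  assumes c: "c \<in> S" and \<epsilon>: "0 \<le> \<epsilon>" "\<epsilon> < 1"
    and near: "\<And>u v. \<bar>u \<bullet> (M *v v - matrix_inv (G c) *v v)\<bar> \<le> \<epsilon> * dnrm c u * dnrm c v"
    and sym: "\<And>u v. u \<bullet> (M *v v) = v \<bullet> (M *v u)"
    and eq: "d + M *v ds = - (M *v a)" and orth: "ds \<bullet> d = 0" and w: "w = - (a + ds)"
  shows "(1 - \<epsilon>) * (dnrm c w)\<^sup>2 \<le> a \<bullet> (M *v a)"
    and "nrm c d \<le> (1 + \<epsilon>) * dnrm c w"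
    and "dnrm c (G c *v d - w) \<le> \<epsilon> * dnrm c w"
proof -
  define P where "P = matrix_inv (G c)"
  have P: "spd P" using spd_matrix_inv[OF G_spd[OF c]] by (simp add: P_def)
  have PG: "P *v (G c *v v) = v" for v using spd_invertible[OF G_spd[OF c]] by (simp add: P_def)
  have "w = (-1) *\<^sub>R (a + ds)" by (simp add: w)
  then have "M *v w = - (M *v (a + ds))"
    using matrix_vector_mult_scaleR[of M "-1" "a + ds"] by simp
  also have "\<dots> = d" using eq by (simp add: matrix_vector_right_distrib flip: eq_diff_eq)
  finally have Mw: "M *v w = d" .
  have low: "(1 - \<epsilon>) * (dnrm c v)\<^sup>2 \<le> v \<bullet> (M *v v)" for v
    using near[of v v] mnorm_sq[OF P, of v]
    by (simp add: P_def[symmetric] inner_diff_right power2_eq_square algebra_simps)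
  have a: "a = - w - ds" by (simp add: w)
  have "a \<bullet> (M *v a) = w \<bullet> (M *v w) + 2 * (ds \<bullet> (M *v w)) + ds \<bullet> (M *v ds)"
    unfolding a using sym[of w ds] matrix_vector_mult_diff_distrib[of M "- w" ds]
      matrix_vector_mult_scaleR[of M "-1" w]
    by (simp add: inner_diff_left inner_diff_right)
  also have "\<dots> = w \<bullet> (M *v w) + ds \<bullet> (M *v ds)" by (simp add: Mw orth)
  finally show "(1 - \<epsilon>) * (dnrm c w)\<^sup>2 \<le> a \<bullet> (M *v a)"
    using low[of w] low[of ds] \<epsilon> by (smt (verit) mult_nonneg_nonneg zero_le_power2)
  have "(nrm c d)\<^sup>2 = (G c *v d) \<bullet> (M *v w - P *v w) + (G c *v d) \<bullet> (P *v w)"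
    using mnorm_sq[OF G_spd[OF c]] by (simp add: Mw inner_diff_right inner_commute)
  also have "\<dots> \<le> \<epsilon> * nrm c d * dnrm c w + nrm c d * dnrm c w"
    using near[of "G c *v d" w] mnorm_cauchy[OF P, of "G c *v d" w]
    unfolding P_def mnorm_inv_mult[OF G_spd[OF c]] by linarith
  also have "\<dots> = nrm c d * ((1 + \<epsilon>) * dnrm c w)" by (simp add: algebra_simps)
  finally have "nrm c d * nrm c d \<le> nrm c d * ((1 + \<epsilon>) * dnrm c w)" by (simp add: power2_eq_square)
  then show "nrm c d \<le> (1 + \<epsilon>) * dnrm c w"
    using \<epsilon> c by (cases "nrm c d = 0") (auto simp: less_le mult_le_cancel_left)
  show "dnrm c (G c *v d - w) \<le> \<epsilon> * dnrm c w"
  proof (rule mnorm_inv_leI[OF G_spd[OF c]])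
    fix u
    have "u \<bullet> (G c *v d - w) = (G c *v u) \<bullet> (M *v w - P *v w)"
      using spd_sym[OF P, of w "G c *v u"] G_sym[OF c, of u d]
      by (simp add: Mw PG inner_diff_right inner_commute)
    then show "\<bar>u \<bullet> (G c *v d - w)\<bar> \<le> \<epsilon> * dnrm c w * nrm c u"
      using near[of "G c *v u" w] mnorm_inv_mult[OF G_spd[OF c], of u] by (simp add: P_def ac_simps)
  qed
qed

lemma mu_pos: "x \<in> S \<Longrightarrow> s \<in> D \<Longrightarrow> 0 < mu \<theta> x s"
proof -
  assume x: "x \<in> S" and s: "s \<in> D"
  obtain e where "e > 0" "e * norm x \<le> s \<bullet> x"
    using dual_interior_lower_bound[OF s] S_sub[OF x] by metis
  then have "0 < s \<bullet> x" using nonzero_S[OF x] by (smt (verit) mult_pos_pos zero_less_norm_iff)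
  then show ?thesis using theta_ge_1 by (simp add: mu_def)
qed

text \<open>By \<open>g_scale\<close> and \<open>dnrm_scale\<close> this is the dual local norm of
  \<open>delta_D\<close> at \<open>x\<close>, divided by \<open>mu\<close>. Normalising the point
  instead removes \<open>mu\<close> from the estimates.\<close>

definition proximity :: "real^'n \<Rightarrow> real^'n \<Rightarrow> real" where
  "proximity x s = (let z = (1 / mu \<theta> x s) *\<^sub>R x in dnrm z (s + g z))"

lemma mnorm_triangle4:
  assumes "spd W"
  shows "mnorm W (a + b + c + d) \<le> mnorm W a + mnorm W b + mnorm W c + mnorm W d"
  using mnorm_triangle[OF assms, of "a + b + c" d] mnorm_triangle[OF assms, of "a + b" c]
    mnorm_triangle[OF assms, of a b] by linarith

lemma predictor_step:
  assumes x: "x \<in> S" and s: "s \<in> D" and prox: "proximity x s \<le> 0.004"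
    and dir: "dx + T2_mat K F \<theta> x s *v ds = - x" and orth: "ds \<bullet> dx = 0"
    and \<alpha>: "\<alpha> = 0.047464 / sqrt \<theta>"
  shows "x + \<alpha> *\<^sub>R dx \<in> S" "s + \<alpha> *\<^sub>R ds \<in> D"
    "mu \<theta> (x + \<alpha> *\<^sub>R dx) (s + \<alpha> *\<^sub>R ds) = (1 - \<alpha>) * mu \<theta> x s"
    "proximity (x + \<alpha> *\<^sub>R dx) (s + \<alpha> *\<^sub>R ds) \<le> 0.016"
proof -
  define \<mu> where "\<mu> = mu \<theta> x s"
  have \<mu>: "\<mu> > 0" using mu_pos[OF x s] by (simp add: \<mu>_def)
  define z where "z = (1 / \<mu>) *\<^sub>R x"
  have z: "z \<in> S" unfolding z_def using \<mu> by (intro scale_in_S x) simp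
  have xz: "x = \<mu> *\<^sub>R z" using \<mu> by (simp add: z_def)
  define \<delta> where "\<delta> = s + g z"
  have \<rho>: "dnrm z \<delta> \<le> 0.004" using prox by (simp add: proximity_def Let_def \<delta>_def z_def \<mu>_def)
  obtain c M \<tau> where c: "c \<in> S" and \<tau>: "\<tau> = dnrm c \<delta>" "\<tau> \<le> 1.0132 * 0.004"
    and zc: "nrm c (z - c) \<le> 0.506 * \<tau>"
    and T2: "\<And>v. T2_mat K F \<theta> x s *v v = \<mu> *\<^sub>R (M *v v)"
    and sym: "\<And>u v. u \<bullet> (M *v v) = v \<bullet> (M *v u)"
    and near: "\<And>u v. \<bar>u \<bullet> (M *v v - matrix_inv (G c) *v v)\<bar> \<le> 4.6 * \<tau> * dnrm c u * dnrm c v"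
    and Ms: "M *v s = z" and sz: "s \<bullet> z = \<theta>"
    by (rule scaling_matrix_near[OF z s \<mu> xz \<mu>_def[symmetric] \<delta>_def \<rho>]) auto
  define d where "d = (1 / \<mu>) *\<^sub>R dx"
  have dx: "dx = \<mu> *\<^sub>R d" using \<mu> by (simp add: d_def)
  have "\<mu> *\<^sub>R (d + M *v ds) = \<mu> *\<^sub>R (- (M *v s))"
    using dir by (simp add: dx T2 xz[symmetric] Ms scaleR_add_right)
  then have eq: "d + M *v ds = - (M *v s)" using \<mu> by (metis less_irrefl scaleR_cancel_left)
  have od: "ds \<bullet> d = 0" using orth \<mu> by (simp add: dx)
  have \<tau>0: "0 \<le> \<tau>" using c by (simp add: \<tau>(1))
  define \<epsilon> where "\<epsilon> = 4.6 * \<tau>"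
  have \<epsilon>: "0 \<le> \<epsilon>" "\<epsilon> \<le> 0.0187" "\<epsilon> < 1" using \<tau> \<tau>0 by (simp_all add: \<epsilon>_def)
  define w where "w = - (s + ds)"
  note b = search_direction_bounds[OF c \<epsilon>(1,3) near[folded \<epsilon>_def] sym eq od w_def]
  have \<theta>: "\<theta> \<ge> 1" "sqrt \<theta> \<ge> 1" using theta_ge_1 by auto
  have \<alpha>0: "0 < \<alpha>" "\<alpha> \<le> 0.047464" using \<theta> by (auto simp: \<alpha> field_simps)
  have w0: "0 \<le> dnrm c w" using c by simp
  \<comment> \<open>The root of \<theta> in the bound on \<open>w\<close> cancels against the step
    length, and \<open>0.047464 / sqrt (1 - 0.0187)\<close> is below 0.04792.\<close>
  have \<alpha>w: "\<alpha> * dnrm c w \<le> 0.04792"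
  proof (rule power2_le_imp_le)
    have "(1 - 0.0187) * (dnrm c w)\<^sup>2 \<le> (1 - \<epsilon>) * (dnrm c w)\<^sup>2" using \<epsilon> by (intro mult_right_mono) auto
    also have "\<dots> \<le> \<theta>" using b(1) by (simp add: Ms sz)
    finally have "\<alpha>\<^sup>2 * ((1 - 0.0187) * (dnrm c w)\<^sup>2) \<le> \<alpha>\<^sup>2 * \<theta>" by (rule mult_left_mono) simp
    also have "\<alpha>\<^sup>2 * \<theta> = 0.047464\<^sup>2" using \<theta> by (simp add: \<alpha> power_divide)
    finally show "(\<alpha> * dnrm c w)\<^sup>2 \<le> 0.04792\<^sup>2"
      by (simp add: power_mult_distrib power2_eq_square mult.assoc mult.left_commute)
  qed simp
  have \<alpha>d: "nrm c (\<alpha> *\<^sub>R d) \<le> 0.0489"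
  proof -
    have "nrm c (\<alpha> *\<^sub>R d) \<le> (1 + \<epsilon>) * (\<alpha> * dnrm c w)"
      using mult_left_mono[OF b(2), of \<alpha>] \<alpha>0 by (simp add: mnorm_scale ac_simps)
    also have "\<dots> \<le> (1 + 0.0187) * 0.04792" using \<epsilon> \<alpha>w \<alpha>0 w0 by (intro mult_mono) auto
    finally show ?thesis by simp
  qed
  define z' where "z' = z + \<alpha> *\<^sub>R d"
  have zR: "nrm c (z - c) \<le> 0.051" using zc \<tau> by simp
  have z'R: "nrm c (z' - c) \<le> 0.051"
    using mnorm_triangle[OF G_spd[OF c], of "z - c" "\<alpha> *\<^sub>R d"] zc \<alpha>d \<tau> by (simp add: z'_def algebra_simps)
  have num: "(1::real) \<le> (1 + 0.14)\<^sup>2 * (1 - 0.051)^5" by (simp add: power2_eq_square eval_nat_numeral)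
  have z'S: "z' \<in> S" using hess_compare(1)[OF c z'R _ _ num] by simp
  define e where "e = g z' - g z - G c *v (z' - z)"
  have e: "dnrm c e \<le> 0.14 * 0.0489"
    using grad_linearization[OF c z'R zR _ _ num] \<alpha>d by (simp add: e_def z'_def)
  \<comment> \<open>The new \<open>mu\<close> will be \<open>(1 - \<alpha>) \<mu>\<close>, so this
    is the normalised new point.\<close>
  define zp where "zp = (1 / (1 - \<alpha>)) *\<^sub>R z'"
  have \<alpha>1: "1 - \<alpha> > 0" using \<alpha>0 by simp
  define sp xp where "sp = s + \<alpha> *\<^sub>R ds" and "xp = x + \<alpha> *\<^sub>R dx"
  have xp: "xp = \<mu> *\<^sub>R z'" by (simp add: xp_def z'_def xz dx scaleR_add_right)
  then show "x + \<alpha> *\<^sub>R dx \<in> S" using scale_in_S[OF z'S \<mu>] by (simp add: xp_def)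
  have zpS: "zp \<in> S" unfolding zp_def using \<alpha>1 by (intro scale_in_S z'S) simp
  have gzp: "g zp = (1 - \<alpha>) *\<^sub>R g z'" unfolding zp_def using \<alpha>1 by (subst g_scale[OF z'S]) auto
  \<comment> \<open>Dividing the point by \<open>1 - \<alpha>\<close> multiplies its gradient by
    \<open>1 - \<alpha>\<close>, which matches the part \<open>(1 - \<alpha>) s\<close> of the new
    dual iterate. Besides \<open>(1 - \<alpha>) \<delta>\<close> only second-order terms are left:
    the error of \<open>M\<close>, the term \<open>\<alpha>^2 w\<close>, and the linearization error
    \<open>e\<close>, which has the largest bound.\<close>
  have decomp: "sp + g zp = (1 - \<alpha>) *\<^sub>R \<delta> + ((1 - \<alpha>) * \<alpha>) *\<^sub>R (G c *v d - w)
      + (- (\<alpha> * \<alpha>)) *\<^sub>R w + (1 - \<alpha>) *\<^sub>R e"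
  proof -
    have "G c *v (z' - z) = \<alpha> *\<^sub>R (G c *v d)" by (simp add: z'_def matrix_vector_mult_scaleR)
    then have gz': "g z' = g z + \<alpha> *\<^sub>R (G c *v d) + e" by (simp add: e_def)
    have ds: "ds = - w - s" by (simp add: w_def)
    show ?thesis unfolding gzp gz' sp_def ds \<delta>_def
      by (simp add: vec_eq_iff algebra_simps)
  qed
  have \<delta>c: "dnrm c (sp + g zp) \<le> 0.01408"
  proof -
    define t u where "t = \<alpha> * dnrm c (G c *v d - w)" and "u = \<alpha> * dnrm c w"
    have "t \<le> \<epsilon> * u"
      using mult_left_mono[OF b(3), of \<alpha>] \<alpha>0 by (simp add: t_def u_def ac_simps)
    also have "\<dots> \<le> 0.0187 * 0.04792"
      using \<epsilon> \<alpha>w \<alpha>0 w0 unfolding u_def by (intro mult_mono) auto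
    finally have t: "t \<le> 0.0187 * 0.04792" .
    have tu: "0 \<le> t" "0 \<le> u" "u \<le> 0.04792" using \<alpha>0 \<alpha>w c by (simp_all add: t_def u_def)
    have "dnrm c (sp + g zp) \<le> dnrm c ((1 - \<alpha>) *\<^sub>R \<delta>) + dnrm c (((1 - \<alpha>) * \<alpha>) *\<^sub>R (G c *v d - w))
      + dnrm c ((- (\<alpha> * \<alpha>)) *\<^sub>R w) + dnrm c ((1 - \<alpha>) *\<^sub>R e)"
      unfolding decomp by (rule mnorm_triangle4[OF spd_matrix_inv[OF G_spd[OF c]]])
    also have "\<dots> = (1 - \<alpha>) * \<tau> + (1 - \<alpha>) * t + \<alpha> * u + (1 - \<alpha>) * dnrm c e"
      unfolding mnorm_scale \<tau>(1) t_def u_def using \<alpha>0 by (simp add: abs_mult)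
    also have "\<dots> \<le> 1 * (1.0132 * 0.004) + 1 * (0.0187 * 0.04792)
      + 0.047464 * 0.04792 + 1 * (0.14 * 0.0489)"
      by (intro add_mono mult_mono) (use \<tau> \<tau>0 \<alpha>0 t tu e c in simp_all)
    finally show ?thesis by simp
  qed
  have "dnrm z' (sp + g zp) \<le> 1.068 * dnrm c (sp + g zp)"
    by (rule nrm_compare(4)[OF c z'R _ _ num]) (auto simp: power2_eq_square)
  then have z'b: "dnrm z' (sp + g zp) \<le> 1.068 * 0.01408" using \<delta>c by simp
  have "dnrm zp (sp + g zp) = 1 / (1 - \<alpha>) * dnrm z' (sp + g zp)"
    unfolding zp_def using \<alpha>1 by (intro dnrm_scale z'S) simp
  also have "\<dots> \<le> 1 / (1 - 0.047464) * (1.068 * 0.01408)"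
    using \<alpha>0 \<alpha>1 z'S by (intro mult_mono divide_left_mono z'b) auto
  finally have "dnrm zp (sp + g zp) \<le> 1 / (1 - 0.047464) * (1.068 * 0.01408)" .
  then have fin: "dnrm zp (sp + g zp) \<le> 0.016" by simp
  then show "s + \<alpha> *\<^sub>R ds \<in> D" using dual_interiorI[OF zpS, of sp] by (simp add: sp_def)
  have "sp \<bullet> xp = \<mu> * ((s + \<alpha> *\<^sub>R ds) \<bullet> (z + \<alpha> *\<^sub>R d))" by (simp add: sp_def xp z'_def)
  also have "(s + \<alpha> *\<^sub>R ds) \<bullet> (z + \<alpha> *\<^sub>R d) = s \<bullet> z + \<alpha> * (s \<bullet> d + ds \<bullet> z) + \<alpha> * \<alpha> * (ds \<bullet> d)"
    by (simp add: inner_add_left inner_add_right algebra_simps)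
  \<comment> \<open>By symmetry and \<open>M s = z\<close> the left-hand side is
    \<open>s \<bullet> (d + M ds)\<close>, hence minus the form \<open>M\<close> at
    \<open>s\<close>.\<close>
  also have "s \<bullet> d + ds \<bullet> z = - \<theta>"
  proof -
    have "ds \<bullet> z = s \<bullet> (M *v ds)" using sym[of ds s] by (simp add: Ms)
    then have "s \<bullet> d + ds \<bullet> z = s \<bullet> (d + M *v ds)" by (simp add: inner_add_right)
    then show ?thesis by (simp add: eq Ms sz)
  qed
  finally have "sp \<bullet> xp = \<mu> * ((1 - \<alpha>) * \<theta>)" by (simp add: sz od algebra_simps)
  then have mup: "mu \<theta> xp sp = (1 - \<alpha>) * \<mu>" using \<theta> by (simp add: mu_def)
  then show "mu \<theta> (x + \<alpha> *\<^sub>R dx) (s + \<alpha> *\<^sub>R ds) = (1 - \<alpha>) * mu \<theta> x s"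
    by (simp add: xp_def sp_def \<mu>_def)
  have "(1 / mu \<theta> xp sp) *\<^sub>R xp = zp" unfolding mup using \<mu> \<alpha>1 by (simp add: xp zp_def)
  then show "proximity (x + \<alpha> *\<^sub>R dx) (s + \<alpha> *\<^sub>R ds) \<le> 0.016"
    using fin by (simp add: proximity_def flip: xp_def sp_def)
qed

text \<open>A full step changes the gradient by about \<open>G d\<close>, which is nearly
  \<open>w = - (\<delta> + ds)\<close>. The new residual is therefore the error
  \<open>G d - w\<close> plus the linearization error, both products of two small quantities.
  \<open>mu\<close> stays, because \<open>\<delta>\<close> is orthogonal to
  \<open>z\<close>.\<close>

lemma corrector_step:
  assumes x: "x \<in> S" and s: "s \<in> D" and prox: "proximity x s \<le> 0.016"
    and dir: "dx + T2_mat K F \<theta> x s *v ds = - x + mu \<theta> x s *\<^sub>R dual_point s" and orth: "ds \<bullet> dx = 0"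
  shows "x + dx \<in> S" "s + ds \<in> D" "mu \<theta> (x + dx) (s + ds) = mu \<theta> x s"
    "proximity (x + dx) (s + ds) \<le> 0.004"
proof -
  define \<mu> where "\<mu> = mu \<theta> x s"
  have \<mu>: "\<mu> > 0" using mu_pos[OF x s] by (simp add: \<mu>_def)
  define z where "z = (1 / \<mu>) *\<^sub>R x"
  have z: "z \<in> S" unfolding z_def using \<mu> by (intro scale_in_S x) simp
  have xz: "x = \<mu> *\<^sub>R z" using \<mu> by (simp add: z_def)
  define \<delta> where "\<delta> = s + g z"
  have \<rho>: "dnrm z \<delta> \<le> 0.016" using prox by (simp add: proximity_def Let_def \<delta>_def z_def \<mu>_def)
  obtain c M \<tau> where c: "c \<in> S" and \<tau>: "\<tau> = dnrm c \<delta>" "\<tau> \<le> 1.0132 * 0.016"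
    and zc: "nrm c (z - c) \<le> 0.506 * \<tau>"
    and T2: "\<And>v. T2_mat K F \<theta> x s *v v = \<mu> *\<^sub>R (M *v v)"
    and sym: "\<And>u v. u \<bullet> (M *v v) = v \<bullet> (M *v u)"
    and near: "\<And>u v. \<bar>u \<bullet> (M *v v - matrix_inv (G c) *v v)\<bar> \<le> 4.6 * \<tau> * dnrm c u * dnrm c v"
    and Ms: "M *v s = z" and M\<delta>: "M *v \<delta> = z - dual_point s" and sz: "s \<bullet> z = \<theta>" and \<delta>z: "\<delta> \<bullet> z = 0"
    by (rule scaling_matrix_near[OF z s \<mu> xz \<mu>_def[symmetric] \<delta>_def \<rho>]) auto
  define d where "d = (1 / \<mu>) *\<^sub>R dx"
  have dx: "dx = \<mu> *\<^sub>R d" using \<mu> by (simp add: d_def)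
  have "\<mu> *\<^sub>R (d + M *v ds) = \<mu> *\<^sub>R (- (M *v \<delta>))"
    using dir unfolding T2 \<mu>_def[symmetric] M\<delta> by (simp add: dx xz[symmetric] scaleR_add_right scaleR_diff_right)
  then have eq: "d + M *v ds = - (M *v \<delta>)" using \<mu> by (metis less_irrefl scaleR_cancel_left)
  have od: "ds \<bullet> d = 0" using orth \<mu> by (simp add: dx)
  have \<tau>0: "0 \<le> \<tau>" "\<tau> \<le> 0.016212" using c \<tau>(2) by (simp_all add: \<tau>(1))
  define \<epsilon> where "\<epsilon> = 4.6 * \<tau>"
  have \<epsilon>: "0 \<le> \<epsilon>" "\<epsilon> \<le> 0.0746" "\<epsilon> < 1" using \<tau> \<tau>0 by (simp_all add: \<epsilon>_def)
  define w where "w = - (\<delta> + ds)"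
  note b = search_direction_bounds[OF c \<epsilon>(1,3) near[folded \<epsilon>_def] sym eq od w_def]
  have \<theta>: "\<theta> \<ge> 1" using theta_ge_1 by auto
  have w0: "0 \<le> dnrm c w" using c by simp
  have P: "spd (matrix_inv (G c))" by (rule spd_matrix_inv[OF G_spd[OF c]])
  \<comment> \<open>The squared norm is at most \<open>(1 + \<epsilon>) / (1 - \<epsilon>)\<close>
    times \<open>\<tau>^2\<close>: here \<open>a\<close> is \<open>\<delta>\<close>, and
    \<open>M\<close> is within \<open>\<epsilon>\<close> of the matrix that defines
    \<open>\<tau>\<close>.\<close>
  have w: "dnrm c w \<le> 0.01748"
  proof (rule power2_le_imp_le)
    have "(1 - 0.0746) * (dnrm c w)\<^sup>2 \<le> (1 - \<epsilon>) * (dnrm c w)\<^sup>2" using \<epsilon> by (intro mult_right_mono) auto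
    also have "\<dots> \<le> \<delta> \<bullet> (M *v \<delta>)" by (rule b(1))
    also have "\<dots> = \<delta> \<bullet> (M *v \<delta> - matrix_inv (G c) *v \<delta>) + \<tau>\<^sup>2"
      by (simp add: inner_diff_right \<tau>(1) mnorm_sq[OF P])
    also have "\<dots> \<le> \<epsilon> * \<tau>\<^sup>2 + \<tau>\<^sup>2"
      using near[of \<delta> \<delta>] by (simp add: \<epsilon>_def \<tau>(1) power2_eq_square)
    also have "\<dots> = (1 + \<epsilon>) * \<tau>\<^sup>2" by (simp add: algebra_simps)
    also have "\<dots> \<le> (1 + 0.0746) * 0.016212\<^sup>2" using \<epsilon> \<tau>0 by (intro mult_mono power_mono) auto
    finally show "(dnrm c w)\<^sup>2 \<le> 0.01748\<^sup>2" by (simp add: power2_eq_square)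
  qed simp
  have d: "nrm c d \<le> 0.0188"
  proof -
    have "nrm c d \<le> (1 + \<epsilon>) * dnrm c w" by (rule b(2))
    also have "\<dots> \<le> (1 + 0.0746) * 0.01748" using \<epsilon> w w0 by (intro mult_mono) auto
    finally show ?thesis by simp
  qed
  define z' where "z' = z + d"
  have zR: "nrm c (z - c) \<le> 0.0271" using zc \<tau> by simp
  have z'R: "nrm c (z' - c) \<le> 0.0271"
    using mnorm_triangle[OF G_spd[OF c], of "z - c" d] zc d \<tau> by (simp add: z'_def algebra_simps)
  have num: "(1::real) \<le> (1 + 0.072)\<^sup>2 * (1 - 0.0271)^5" by (simp add: power2_eq_square eval_nat_numeral)
  have z'S: "z' \<in> S" using hess_compare(1)[OF c z'R _ _ num] by simp
  define e where "e = g z' - g z - G c *v (z' - z)"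
  have e: "dnrm c e \<le> 0.072 * 0.0188"
    using grad_linearization[OF c z'R zR _ _ num] d by (simp add: e_def z'_def)
  define sp xp where "sp = s + ds" and "xp = x + dx"
  have xp: "xp = \<mu> *\<^sub>R z'" by (simp add: xp_def z'_def xz dx scaleR_add_right)
  then show "x + dx \<in> S" using scale_in_S[OF z'S \<mu>] by (simp add: xp_def)
  have decomp: "sp + g z' = (G c *v d - w) + e"
    by (simp add: sp_def e_def w_def \<delta>_def z'_def)
  have "dnrm c (sp + g z') \<le> \<epsilon> * dnrm c w + dnrm c e"
    unfolding decomp using mnorm_triangle[OF P, of "G c *v d - w" e] b(3) by linarith
  also have "\<dots> \<le> 0.0746 * 0.01748 + 0.072 * 0.0188"
    using \<epsilon> w w0 e by (intro add_mono mult_mono) auto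
  finally have \<delta>c: "dnrm c (sp + g z') \<le> 0.0027" by simp
  have "dnrm z' (sp + g z') \<le> 1.036 * dnrm c (sp + g z')"
    by (rule nrm_compare(4)[OF c z'R _ _ num]) (auto simp: power2_eq_square)
  then have fin: "dnrm z' (sp + g z') \<le> 0.004" using \<delta>c by simp
  then show "s + ds \<in> D" using dual_interiorI[OF z'S, of sp] by (simp add: sp_def)
  have "sp \<bullet> xp = \<mu> * ((s + ds) \<bullet> (z + d))" by (simp add: sp_def xp z'_def)
  also have "(s + ds) \<bullet> (z + d) = s \<bullet> z + (s \<bullet> d + ds \<bullet> z) + ds \<bullet> d"
    by (simp add: inner_add_left inner_add_right)
  also have "s \<bullet> d + ds \<bullet> z = 0"
  proof -
    have "ds \<bullet> z = s \<bullet> (M *v ds)" using sym[of ds s] by (simp add: Ms)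
    then have "s \<bullet> d + ds \<bullet> z = s \<bullet> (d + M *v ds)" by (simp add: inner_add_right)
    also have "\<dots> = - (\<delta> \<bullet> (M *v s))" using sym[of s \<delta>] by (simp add: eq)
    finally show ?thesis by (simp add: Ms \<delta>z)
  qed
  finally have "sp \<bullet> xp = \<mu> * \<theta>" by (simp add: sz od)
  then have mup: "mu \<theta> xp sp = \<mu>" using \<theta> by (simp add: mu_def)
  then show "mu \<theta> (x + dx) (s + ds) = mu \<theta> x s" by (simp add: xp_def sp_def \<mu>_def)
  have "(1 / mu \<theta> xp sp) *\<^sub>R xp = z'" unfolding mup using \<mu> by (simp add: xp)
  then show "proximity (x + dx) (s + ds) \<le> 0.004"
    using fin by (simp add: proximity_def flip: xp_def sp_def)
qed

text \<open>Serves the solvability of the step equations. At distance 0.02, which covers both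
  thresholds, the relative error \<open>4.6 \<tau>\<close> stays below 0.1, so \<open>M\<close>
  inherits definiteness.\<close>

lemma T2_spd:
  assumes x: "x \<in> S" and s: "s \<in> D" and prox: "proximity x s \<le> 0.02"
  shows "spd (T2_mat K F \<theta> x s)"
proof -
  define \<mu> where "\<mu> = mu \<theta> x s"
  have \<mu>: "\<mu> > 0" using mu_pos[OF x s] by (simp add: \<mu>_def)
  define z where "z = (1 / \<mu>) *\<^sub>R x"
  have z: "z \<in> S" unfolding z_def using \<mu> by (intro scale_in_S x) simp
  have xz: "x = \<mu> *\<^sub>R z" using \<mu> by (simp add: z_def)
  have \<rho>: "dnrm z (s + g z) \<le> 0.02" using prox by (simp add: proximity_def Let_def z_def \<mu>_def)
  obtain c M \<tau> where c: "c \<in> S" and \<tau>: "\<tau> \<le> 1.0132 * 0.02"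
    and T2: "\<And>v. T2_mat K F \<theta> x s *v v = \<mu> *\<^sub>R (M *v v)"
    and sym: "\<And>u v. u \<bullet> (M *v v) = v \<bullet> (M *v u)"
    and near: "\<And>u v. \<bar>u \<bullet> (M *v v - matrix_inv (G c) *v v)\<bar> \<le> 4.6 * \<tau> * dnrm c u * dnrm c v"
    by (rule scaling_matrix_near[OF z s \<mu> xz \<mu>_def[symmetric] refl \<rho>]) auto
  have P: "spd (matrix_inv (G c))" by (rule spd_matrix_inv[OF G_spd[OF c]])
  have "0 < v \<bullet> (M *v v)" if "v \<noteq> 0" for v
  proof -
    have "dnrm c v > 0" by (rule mnorm_pos[OF P that])
    then have "4.6 * \<tau> * (dnrm c v * dnrm c v) < 1 * (dnrm c v * dnrm c v)"
      using \<tau> by (intro mult_strict_right_mono) auto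
    moreover have "v \<bullet> (matrix_inv (G c) *v v) = dnrm c v * dnrm c v"
      using mnorm_sq[OF P, of v] by (simp add: power2_eq_square)
    ultimately show ?thesis using near[of v v] unfolding inner_diff_right mult.assoc by linarith
  qed
  then show ?thesis using sym \<mu> unfolding spd_def T2 by simp
qed

end

text \<open>Eliminating \<open>ds\<close> and \<open>dx\<close> leaves the Schur complement
  \<open>A T A^T\<close>, which is injective because a surjective \<open>A\<close> has an injective
  transpose and \<open>T\<close> is definite.\<close>

lemma normal_equations_unique:
  fixes A :: "real^'n^'m" and T :: "real^'n^'n"
  assumes A: "surj ((*v) A)" and T: "spd T"
  shows "\<exists>!(dx, dy, ds). transpose A *v dy + ds = 0 \<and> A *v dx = 0 \<and> dx + T *v ds = r"
proof -
  define B where "B = A ** T ** transpose A"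
  have Bv: "B *v v = A *v (T *v (transpose A *v v))" for v
    by (simp only: B_def matrix_vector_mul_assoc matrix_mul_assoc)
  have ker: "v = 0" if "B *v v = 0" for v
  proof -
    have "(transpose A *v v) \<bullet> (T *v (transpose A *v v)) = v \<bullet> (B *v v)"
      unfolding Bv by (simp add: dot_lmul_matrix)
    then have "transpose A *v v = 0" using that spd_pos[OF T] by (metis inner_zero_right less_irrefl)
    moreover obtain u where "v = A *v u" using A by (metis surjD)
    ultimately have "v \<bullet> v = 0" by (metis dot_lmul_matrix inner_zero_left vector_transpose_matrix
        transpose_transpose inner_commute)
    then show ?thesis by simp
  qed
  have inj: "inj ((*v) B)" using ker by (simp add: linear_injective_0 matrix_vector_mul_linear)
  then have "surj ((*v) B)" using linear_injective_imp_surjective matrix_vector_mul_linear by blast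
  then obtain y where y: "B *v y = - (A *v r)" by (metis surjD)
  have neg: "W *v (- v) = - (W *v v)" for W :: "real^'a^'b" and v
    using matrix_vector_mult_scaleR[of W "-1" v] by simp
  have "transpose A *v dy + ds = 0 \<and> A *v dx = 0 \<and> dx + T *v ds = r
      \<longleftrightarrow> dy = y \<and> ds = - (transpose A *v y) \<and> dx = r - T *v (- (transpose A *v y))" for dx dy ds
  proof
    assume h: "transpose A *v dy + ds = 0 \<and> A *v dx = 0 \<and> dx + T *v ds = r"
    then have ds: "ds = - (transpose A *v dy)" by (simp add: eq_neg_iff_add_eq_0 add.commute)
    have dx: "dx = r - T *v ds" using h by (simp add: algebra_simps)
    have "A *v r + B *v dy = 0"
      using h unfolding dx ds Bv by (simp add: neg matrix_vector_right_distrib)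
    then have "B *v dy = B *v y" using y minus_unique by metis
    then have "dy = y" using inj by (simp add: inj_eq)
    then show "dy = y \<and> ds = - (transpose A *v y) \<and> dx = r - T *v (- (transpose A *v y))"
      using ds dx by simp
  next
    assume h: "dy = y \<and> ds = - (transpose A *v y) \<and> dx = r - T *v (- (transpose A *v y))"
    then show "transpose A *v dy + ds = 0 \<and> A *v dx = 0 \<and> dx + T *v ds = r"
      using y by (simp add: neg matrix_vector_right_distrib Bv)
  qed
  then show ?thesis by auto
qed

section \<open>Complexity\<close>

text \<open>From \<open>1 - a \<le> exp (- a)\<close>; the summand 1 pays for rounding the exponent
  up.\<close>

lemma power_halving_bound:
  fixes \<theta> r :: real
  assumes \<theta>: "1 \<le> \<theta>" and r: "0 < r" "r \<le> 1"
  obtains m :: nat where "(1 - 0.047464 / sqrt \<theta>) ^ m \<le> r"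
    "real m \<le> ln (1 / r) * sqrt \<theta> / 0.047464 + 1"
proof -
  define a where "a = 0.047464 / sqrt \<theta>"
  have sq: "sqrt \<theta> \<ge> 1" using \<theta> by simp
  have "a \<le> 0.047464 / 1" unfolding a_def using sq by (intro divide_left_mono) auto
  then have "a < 1" by simp
  moreover have "0 < a" unfolding a_def using \<theta> by (intro divide_pos_pos) auto
  ultimately have a: "0 < a" "a < 1" by auto
  define m where "m = nat \<lceil>ln (1 / r) / a\<rceil>"
  have "0 \<le> ln (1 / r) / a" using a r by simp
  then have m: "ln (1 / r) / a \<le> real m" "real m \<le> ln (1 / r) / a + 1" unfolding m_def by linarith+
  have "(1 - a) ^ m \<le> exp (- a) ^ m" using a exp_ge_add_one_self[of "- a"] by (intro power_mono) auto
  also have "\<dots> = exp (- (real m * a))" by (simp add: exp_of_nat_mult[symmetric])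
  also have "\<dots> \<le> exp (- ln (1 / r))" using m(1) a by (simp add: field_simps)
  also have "\<dots> = r" using r by (simp add: exp_minus)
  finally show ?thesis using that[of m] m(2) by (simp add: a_def)
qed

context lhscb
begin

lemma iteration_step:
  fixes A :: "real^'n^'m"
  assumes feas: "interior_feasible A b c K x y s"
    and prox: "proximity x s \<le> (if even k then 0.004 else 0.016)"
    and dir: "search_direction A K F \<theta> (pc_gamma k) x s dx dy ds"
  defines "x' \<equiv> x + pc_alpha \<theta> k *\<^sub>R dx" and "y' \<equiv> y + pc_alpha \<theta> k *\<^sub>R dy" and "s' \<equiv> s + pc_alpha \<theta> k *\<^sub>R ds"
  shows "interior_feasible A b c K x' y' s'"
    "proximity x' s' \<le> (if even (Suc k) then 0.004 else 0.016)"
    "mu \<theta> x' s' = (if even k then 1 - 0.047464 / sqrt \<theta> else 1) * mu \<theta> x s"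
proof -
  have xs: "x \<in> S" "s \<in> D" and lin: "A *v x = b" "transpose A *v y + s = c"
    using feas by (auto simp: interior_feasible_def)
  have d: "transpose A *v dy + ds = 0" "A *v dx = 0"
    "dx + T2_mat K F \<theta> x s *v ds = - x + (pc_gamma k * mu \<theta> x s) *\<^sub>R dual_point s"
    using dir by (auto simp: search_direction_def grad_conj_barrier[OF xs(2)])
  have "ds = - (transpose A *v dy)" using d(1) by (simp add: eq_neg_iff_add_eq_0 add.commute)
  then have orth: "ds \<bullet> dx = 0" using d(2) by (simp add: dot_lmul_matrix)
  have core: "x' \<in> S \<and> s' \<in> D \<and> proximity x' s' \<le> (if even (Suc k) then 0.004 else 0.016)
    \<and> mu \<theta> x' s' = (if even k then 1 - 0.047464 / sqrt \<theta> else 1) * mu \<theta> x s"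
  proof (cases "even k")
    case True
    then have "dx + T2_mat K F \<theta> x s *v ds = - x" "proximity x s \<le> 0.004"
      using d(3) prox by (simp_all add: pc_gamma_def)
    note p = predictor_step[OF xs this(2,1) orth refl]
    show ?thesis using p True by (simp add: x'_def s'_def pc_alpha_def)
  next
    case False
    then have "dx + T2_mat K F \<theta> x s *v ds = - x + mu \<theta> x s *\<^sub>R dual_point s" "proximity x s \<le> 0.016"
      using d(3) prox by (simp_all add: pc_gamma_def)
    note p = corrector_step[OF xs this(2,1) orth]
    show ?thesis using p False by (simp add: x'_def s'_def pc_alpha_def)
  qed
  then show "proximity x' s' \<le> (if even (Suc k) then 0.004 else 0.016)"
    "mu \<theta> x' s' = (if even k then 1 - 0.047464 / sqrt \<theta> else 1) * mu \<theta> x s" by auto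
  have "A *v x' = b"
    by (simp add: x'_def matrix_vector_right_distrib matrix_vector_mult_scaleR d(2) lin)
  moreover have "transpose A *v y' + s' = (transpose A *v y + s) + pc_alpha \<theta> k *\<^sub>R (transpose A *v dy + ds)"
    unfolding y'_def s'_def matrix_vector_right_distrib matrix_vector_mult_scaleR scaleR_add_right
    by (simp only: add.assoc add.left_commute)
  then have "transpose A *v y' + s' = c" unfolding d(1) lin(2) by simp
  ultimately show "interior_feasible A b c K x' y' s'" using core by (simp add: interior_feasible_def)
qed

lemma search_direction_unique:
  fixes A :: "real^'n^'m"
  assumes A: "surj ((*v) A)" and feas: "interior_feasible A b c K x y s"
    and prox: "proximity x s \<le> (if even (k::nat) then 0.004 else 0.016)"
  shows "\<exists>!(dx, dy, ds). search_direction A K F \<theta> \<gamma> x s dx dy ds"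
proof -
  have "proximity x s \<le> 0.02" using prox by (simp split: if_splits)
  then have "spd (T2_mat K F \<theta> x s)" using feas by (intro T2_spd) (auto simp: interior_feasible_def)
  from normal_equations_unique[OF A this] show ?thesis unfolding search_direction_def .
qed

lemma proximity_central:
  assumes "x \<in> S" "s \<in> D" "delta_D F \<theta> x s = 0"
  shows "proximity x s = 0"
proof -
  have "g ((1 / mu \<theta> x s) *\<^sub>R x) = mu \<theta> x s *\<^sub>R g x"
    using mu_pos[OF assms(1,2)] by (subst g_scale[OF assms(1)]) auto
  then have "s + g ((1 / mu \<theta> x s) *\<^sub>R x) = 0"
    using assms(3) by (simp add: delta_D_def s_tilde_def)
  then show ?thesis by (simp add: proximity_def Let_def)
qed

end

theorem corollary8p4:
  fixes K :: "(real^'n) set" and F :: "real^'n \<Rightarrow> real" and \<theta> :: real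
    and A :: "real^'n^'m" and b :: "real^'m" and c :: "real^'n"
    and x0 s0 :: "real^'n" and y0 :: "real^'m"
  assumes "proper_cone K"
    and "LHSCB \<theta> K F"
    and "surj ((*v) A)"
    and "interior_feasible A b c K x0 y0 s0"
    and "delta_D F \<theta> x0 s0 = 0"
  shows
    "(\<exists>x y s. pd_run A K F \<theta> pc_gamma (pc_alpha \<theta>) x0 y0 s0 x y s) \<and>
     (\<forall>x y s. pd_run A K F \<theta> pc_gamma (pc_alpha \<theta>) x0 y0 s0 x y s \<longrightarrow>
        (\<forall>k. interior_feasible A b c K (x k) (y k) (s k) \<and>
           (\<exists>!(dx, dy, ds). search_direction A K F \<theta> (pc_gamma k) (x k) (s k) dx dy ds)) \<and>
        (\<forall>k. \<exists>j::nat. real j \<le> 42 * sqrt \<theta> \<and>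
           mu \<theta> (x (k + j)) (s (k + j)) \<le> mu \<theta> (x k) (s k) / 2) \<and>
        (\<forall>\<epsilon>::real. 0 < \<epsilon> \<and> \<epsilon> \<le> 1/2 \<longrightarrow>
           (\<exists>k::nat. real k \<le> complexity_const * sqrt \<theta> * ln (1 / \<epsilon>) \<and>
              mu \<theta> (x k) (s k) \<le> \<epsilon> * mu \<theta> x0 s0)))"
proof -
  interpret lhscb K F \<theta> using assms by unfold_locales
  define \<rho> :: "nat \<Rightarrow> real" where "\<rho> k = (if even k then 0.004 else 0.016)" for k
  define inv where "inv k x y s \<longleftrightarrow> interior_feasible A b c K x y s \<and> proximity x s \<le> \<rho> k" for k x y s
  have init: "inv 0 x0 y0 s0"
    using assms(4) proximity_central[OF _ _ assms(5)] by (simp add: inv_def \<rho>_def interior_feasible_def)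
  have dir: "\<exists>!(dx, dy, ds). search_direction A K F \<theta> (pc_gamma k) x s dx dy ds" if "inv k x y s" for k x y s
    using that search_direction_unique[OF assms(3)] unfolding inv_def \<rho>_def by blast
  have step: "inv (Suc k) (x + pc_alpha \<theta> k *\<^sub>R dx) (y + pc_alpha \<theta> k *\<^sub>R dy) (s + pc_alpha \<theta> k *\<^sub>R ds)"
    "mu \<theta> (x + pc_alpha \<theta> k *\<^sub>R dx) (s + pc_alpha \<theta> k *\<^sub>R ds)
      = (if even k then 1 - 0.047464 / sqrt \<theta> else 1) * mu \<theta> x s"
    if "inv k x y s" "search_direction A K F \<theta> (pc_gamma k) x s dx dy ds" for k x y s dx dy ds
    using iteration_step[of A b c x y s k dx dy ds] that unfolding inv_def \<rho>_def by auto
  \<comment> \<open>A direction is known to exist only where the invariant holds, so the run is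
    built together with the invariant by dependent choice. \<open>P\<close> also pins the starting
    point at index 0.\<close>
  have run: "\<exists>x y s. pd_run A K F \<theta> pc_gamma (pc_alpha \<theta>) x0 y0 s0 x y s"
  proof -
    define Q where "Q k t t' \<longleftrightarrow> (case t of (x, y, s) \<Rightarrow> \<exists>dx dy ds. search_direction A K F \<theta> (pc_gamma k) x s dx dy ds \<and>
        t' = (x + pc_alpha \<theta> k *\<^sub>R dx, y + pc_alpha \<theta> k *\<^sub>R dy, s + pc_alpha \<theta> k *\<^sub>R ds))" for k t t'
    define P where "P k t \<longleftrightarrow> (case t of (x, y, s) \<Rightarrow> inv k x y s) \<and> (k = 0 \<longrightarrow> t = (x0, y0, s0))" for k t
    have "\<exists>f. \<forall>n. P n (f n) \<and> Q n (f n) (f (Suc n))"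
    proof (rule dependent_nat_choice)
      show "\<exists>t. P 0 t" using init by (auto simp: P_def)
      fix t and n :: nat assume "P n t"
      moreover obtain x y s where t: "t = (x, y, s)" by (cases t)
      ultimately have i: "inv n x y s" by (simp add: P_def)
      from dir[OF this] obtain dx dy ds where d: "search_direction A K F \<theta> (pc_gamma n) x s dx dy ds" by auto
      show "\<exists>t'. P (Suc n) t' \<and> Q n t t'"
        using step(1)[OF i d] d
        by (intro exI[of _ "(x + pc_alpha \<theta> n *\<^sub>R dx, y + pc_alpha \<theta> n *\<^sub>R dy, s + pc_alpha \<theta> n *\<^sub>R ds)"])
          (auto simp: P_def Q_def t)
    qed
    then obtain f where f: "\<And>n. P n (f n)" "\<And>n. Q n (f n) (f (Suc n))" by blast
    have "f 0 = (x0, y0, s0)" using f(1)[of 0] by (simp add: P_def)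
    moreover have "\<exists>dx dy ds. search_direction A K F \<theta> (pc_gamma k) (fst (f k)) (snd (snd (f k))) dx dy ds \<and>
        fst (f (Suc k)) = fst (f k) + pc_alpha \<theta> k *\<^sub>R dx \<and>
        fst (snd (f (Suc k))) = fst (snd (f k)) + pc_alpha \<theta> k *\<^sub>R dy \<and>
        snd (snd (f (Suc k))) = snd (snd (f k)) + pc_alpha \<theta> k *\<^sub>R ds" for k
    proof -
      obtain u v w where "f k = (u, v, w)" by (cases "f k")
      with f(2)[of k] show ?thesis unfolding Q_def by fastforce
    qed
    ultimately have "pd_run A K F \<theta> pc_gamma (pc_alpha \<theta>) x0 y0 s0
        (\<lambda>k. fst (f k)) (\<lambda>k. fst (snd (f k))) (\<lambda>k. snd (snd (f k)))"
      by (simp add: pd_run_def)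
    then show ?thesis by blast
  qed
  have sq: "1 \<le> sqrt \<theta>" using theta_ge_1 by simp
  have main: "(\<forall>k. interior_feasible A b c K (x k) (y k) (s k) \<and>
           (\<exists>!(dx, dy, ds). search_direction A K F \<theta> (pc_gamma k) (x k) (s k) dx dy ds)) \<and>
        (\<forall>k. \<exists>j::nat. real j \<le> 42 * sqrt \<theta> \<and>
           mu \<theta> (x (k + j)) (s (k + j)) \<le> mu \<theta> (x k) (s k) / 2) \<and>
        (\<forall>\<epsilon>::real. 0 < \<epsilon> \<and> \<epsilon> \<le> 1/2 \<longrightarrow>
           (\<exists>k::nat. real k \<le> complexity_const * sqrt \<theta> * ln (1 / \<epsilon>) \<and>
              mu \<theta> (x k) (s k) \<le> \<epsilon> * mu \<theta> x0 s0))"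
    if r: "pd_run A K F \<theta> pc_gamma (pc_alpha \<theta>) x0 y0 s0 x y s" for x y s
  proof -
    have r0: "x 0 = x0" "y 0 = y0" "s 0 = s0" using r by (auto simp: pd_run_def)
    have rS: "\<exists>dx dy ds. search_direction A K F \<theta> (pc_gamma k) (x k) (s k) dx dy ds \<and>
        x (Suc k) = x k + pc_alpha \<theta> k *\<^sub>R dx \<and> y (Suc k) = y k + pc_alpha \<theta> k *\<^sub>R dy \<and>
        s (Suc k) = s k + pc_alpha \<theta> k *\<^sub>R ds" for k
      using r by (simp add: pd_run_def)
    have inv: "inv k (x k) (y k) (s k)" for k
    proof (induction k)
      case 0 then show ?case using init r0 by simp
    next
      case (Suc k)
      then show ?case using rS[of k] step(1) by metis
    qed
    define q where "q = 1 - 0.047464 / sqrt \<theta>"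
    define m where "m k = mu \<theta> (x k) (s k)" for k
    have mS: "m (Suc k) = (if even k then q else 1) * m k" for k
      using rS[of k] step(2)[OF inv[of k]] unfolding m_def q_def by metis
    \<comment> \<open>Whatever the parity of \<open>k\<close>, two consecutive iterations contain
      exactly one predictor step.\<close>
    have m2: "m (k + 2 * i) = q ^ i * m k" for k i
      by (induction i) (simp_all add: mS)
    have mpos: "0 < m k" for k
      using inv[of k] by (auto simp: m_def inv_def interior_feasible_def intro: mu_pos)
    have reduce: "\<exists>i::nat. real (2 * i) \<le> 2 * (ln (1 / r) * sqrt \<theta> / 0.047464 + 1) \<and> m (k + 2 * i) \<le> r * m k"
      if r01: "0 < r" "r \<le> 1" for r k
    proof -
      obtain i where i: "q ^ i \<le> r" "real i \<le> ln (1 / r) * sqrt \<theta> / 0.047464 + 1"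
        using power_halving_bound[OF theta_ge_1 r01] unfolding q_def by blast
      have "m (k + 2 * i) \<le> r * m k"
        unfolding m2 using i(1) less_imp_le[OF mpos] by (rule mult_right_mono)
      then show ?thesis using i(2) by (intro exI[of _ i]) simp
    qed
    have half: "\<exists>j::nat. real j \<le> 42 * sqrt \<theta> \<and> m (k + j) \<le> m k / 2" for k
    proof -
      obtain i where i: "real (2 * i) \<le> 2 * (ln (1 / (1/2)) * sqrt \<theta> / 0.047464 + 1)" "m (k + 2 * i) \<le> 1/2 * m k"
        using reduce[of "1/2" k] by auto
      define u v where "u = sqrt \<theta>" and "v = ln 2 * sqrt \<theta>"
      \<comment> \<open>\<open>2 (25/36) / 0.047464 + 2\<close> is about 31.3; the rounding term 2
        is absorbed because sqrt(\<theta>) \<ge> 1.\<close>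
      have "v \<le> 25/36 * u" unfolding u_def v_def using ln2_le_25_over_36 sq by (intro mult_right_mono) auto
      moreover have "1 \<le> u" using sq by (simp add: u_def)
      ultimately have "2 * (v / 0.047464 + 1) \<le> 42 * u" by simp
      then have "2 * (ln (1 / (1/2)) * sqrt \<theta> / 0.047464 + 1) \<le> 42 * sqrt \<theta>"
        by (simp add: u_def v_def)
      then show ?thesis using i by (intro exI[of _ "2 * i"]) auto
    qed
    \<comment> \<open>Reached by one use of \<open>reduce\<close> with \<open>r = \<epsilon>\<close>
      instead of chaining halvings; \<open>\<epsilon> \<le> 1/2\<close> gives
      \<open>T \<ge> 1\<close> below, which absorbs the rounding.\<close>
    have cx: "\<exists>k::nat. real k \<le> complexity_const * sqrt \<theta> * ln (1 / \<epsilon>) \<and> m k \<le> \<epsilon> * m 0"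
      if e: "0 < \<epsilon>" "\<epsilon> \<le> 1/2" for \<epsilon>
    proof -
      obtain i where i: "real (2 * i) \<le> 2 * (ln (1 / \<epsilon>) * sqrt \<theta> / 0.047464 + 1)" "m (2 * i) \<le> \<epsilon> * m 0"
        using reduce[of \<epsilon> 0] e by auto
      define L where "L = ln (1 / \<epsilon>)"
      have "ln 2 \<le> L" unfolding L_def using e by (subst ln_le_cancel_iff) (auto simp: field_simps)
      moreover have l2: "0 < ln (2::real)" "ln (2::real) \<le> 25/36" using ln2_le_25_over_36 by auto
      ultimately have L: "1 \<le> L / ln 2" "0 \<le> L" by (simp add: field_simps, linarith)
      define T where "T = L / ln 2 * sqrt \<theta>"
      have T: "1 \<le> T" unfolding T_def using mult_mono[OF L(1) sq] L l2 by simp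
      have "L * sqrt \<theta> = ln 2 * T" using l2 by (simp add: T_def)
      also have "\<dots> \<le> 25/36 * T" using l2 T by (intro mult_right_mono) auto
      finally have "2 * (L * sqrt \<theta> / 0.047464 + 1) \<le> 84 * T" using T by (simp add: field_simps)
      also have "84 * T = complexity_const * sqrt \<theta> * L" by (simp add: T_def complexity_const_def)
      finally show ?thesis using i by (intro exI[of _ "2 * i"]) (auto simp: L_def)
    qed
    show ?thesis
      using inv dir[OF inv] half cx r0 unfolding m_def inv_def by auto
  qed
  show ?thesis using run main by blast
qed

end
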